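(* Let $\alpha>-1$ and let $f\in \mathcal{N}^{+}(H^{\alpha}(\varphi))$ for some $\varphi$ in the unit ball of $Mult(A^{2}_{\alpha})$. Then $f$ has non-tangential boundary values $f(\xi)$ for almost all $\xi\in\mathbb{T}$.
   Context: $\mathbb{D}$ is the open unit disc, $\mathbb{T}=\partial\mathbb{D}$, $\mathcal{O}(\mathbb{D})$ the space of holomorphic functions on $\mathbb{D}$, and $dA$ is area measure. Bergman spaces: for $\alpha>-1$, $A^2_\alpha$ is the Hilbert space of analytic $f$ on $\mathbb{D}$ with $\int_{\mathbb{D}}|f(z)|^2(1-|z|^2)^\alpha\,dA(z)<\infty$, with inner product $\langle f,g\rangle=\int_{\mathbb{D}} f(z)\overline{g(z)}(1-|z|^2)^\alpha\,dA(z)$ normalized so that the reproducing kernel is $K^\alpha_w(z)=\frac{1}{(1-z\overline{w})^{2+\alpha}}$. Sub-Bergman spaces: for $\varphi$ in the unit ball of the multiplier algebra of $A^2_\alpha$, $T_\varphi:A^2_\alpha\to A^2_\alpha$, $T_\varphi f=\varphi f$, is the (contractive) analytic Toeplitz operator, and $D^\alpha_\varphi=(I-T_\varphi T_\varphi^* )^{1/2}$ is the defect operator. The sub-Bergman space $H^\alpha(\varphi)$ is the range of $D^\alpha_\varphi$ with inner product $\langle D^\alpha_\varphi x,D^\alpha_\varphi y\rangle_{H^\alpha(\varphi)}=\langle x,y\rangle_{A^2_\alpha}$ for $x,y\in A^2_\alpha\ominus\ker D^\alpha_\varphi$; it is a reproducing kernel Hilbert space with kernel $K^{\alpha,\varphi}_w(z)=\frac{1-\varphi(z)\overline{\varphi(w)}}{(1-z\overline{w})^{2+\alpha}}$.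 Smirnov class: for a reproducing kernel Hilbert space $H$ of analytic functions on $\mathbb{D}$, $Mult(H)=\{\varphi\in\mathcal{O}(\mathbb{D}):\varphi H\subseteq H\}$ and $\mathcal{N}^{+}(H)=\{\gamma/\psi:\ \gamma,\psi\in Mult(H),\ \overline{\psi H}=H\}$, the closure being in the norm of $H$.
   Formalization: The formal theorem also assumes that H^α(φ) is not the zero space, i.e. that φ is not a unimodular constant; in that case every holomorphic function on the disc, such as Σ z^(2^n), lies in N⁺(H^α(φ)) and the claim is false. *)

theory Defs
  imports "HOL-Complex_Analysis.Complex_Analysis"
begin

subsection \<open>Weighted Bergman spaces\<close>

text \<open>
  The factor \<open>(\<alpha> + 1) / pi\<close> makes this a probability measure on the unit disc; with it the
  reproducing kernel of the Bergman space is \<open>1 / (1 - z * cnj w) powr (2 + \<alpha>)\<close>.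
\<close>

definition bergman_measure :: "real \<Rightarrow> complex measure" where
  "bergman_measure \<alpha> = density lborel
     (\<lambda>z. ennreal (indicator (ball 0 1) z * ((\<alpha> + 1) / pi * (1 - (cmod z)\<^sup>2) powr \<alpha>)))"

text \<open>
  A function on the disc is represented by its extension by zero to the whole plane, so that
  equality of elements of the space is equality of functions.
\<close>

definition bergman :: "real \<Rightarrow> (complex \<Rightarrow> complex) set" where
  "bergman \<alpha> = {f. f holomorphic_on ball 0 1 \<and> (\<forall>z. z \<notin> ball 0 1 \<longrightarrow> f z = 0)
      \<and> integrable (bergman_measure \<alpha>) (\<lambda>z. (cmod (f z))\<^sup>2)}"

definition bergman_inner :: "real \<Rightarrow> (complex \<Rightarrow> complex) \<Rightarrow> (complex \<Rightarrow> complex) \<Rightarrow> complex" where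
  "bergman_inner \<alpha> f g = (LINT z|bergman_measure \<alpha>. f z * cnj (g z))"

definition norm_of :: "((complex \<Rightarrow> complex) \<Rightarrow> (complex \<Rightarrow> complex) \<Rightarrow> complex)
    \<Rightarrow> (complex \<Rightarrow> complex) \<Rightarrow> real" where
  "norm_of ip f = sqrt (Re (ip f f))"

subsection \<open>Multipliers and the Smirnov class\<close>

definition mult_op :: "(complex \<Rightarrow> complex) \<Rightarrow> (complex \<Rightarrow> complex) \<Rightarrow> (complex \<Rightarrow> complex)" where
  "mult_op \<phi> f = (\<lambda>z. \<phi> z * f z)"

definition Mult :: "(complex \<Rightarrow> complex) set \<Rightarrow> (complex \<Rightarrow> complex) set" where
  "Mult H = {\<phi>. \<phi> holomorphic_on ball 0 1 \<and> mult_op \<phi> ` H \<subseteq> H}"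

text \<open>
  This is the closed unit ball. It contains the unimodular constants, the only symbols for which
  the sub-Bergman space is zero; on the zero space every holomorphic function is a multiplier.
\<close>

definition bergman_mult_unit_ball :: "real \<Rightarrow> (complex \<Rightarrow> complex) set" where
  "bergman_mult_unit_ball \<alpha> = {\<phi> \<in> Mult (bergman \<alpha>).
     \<forall>f\<in>bergman \<alpha>. norm_of (bergman_inner \<alpha>) (mult_op \<phi> f) \<le> norm_of (bergman_inner \<alpha>) f}"

definition closure_wrt :: "(complex \<Rightarrow> complex) set
    \<Rightarrow> ((complex \<Rightarrow> complex) \<Rightarrow> (complex \<Rightarrow> complex) \<Rightarrow> complex)
    \<Rightarrow> (complex \<Rightarrow> complex) set \<Rightarrow> (complex \<Rightarrow> complex) set" where
  "closure_wrt H ip S = {g\<in>H. \<forall>e>0. \<exists>s\<in>S. norm_of ip (\<lambda>z. g z - s z) < e}"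

text \<open>
  If the functions in \<open>H\<close> have no common zero in the disc and point evaluations are continuous,
  then a multiplier \<open>\<psi>\<close> with \<open>\<psi>H\<close> dense has no zeros there, so the quotient is never
  a division by zero.
\<close>

definition smirnov_class :: "(complex \<Rightarrow> complex) set
    \<Rightarrow> ((complex \<Rightarrow> complex) \<Rightarrow> (complex \<Rightarrow> complex) \<Rightarrow> complex) \<Rightarrow> (complex \<Rightarrow> complex) set" where
  "smirnov_class H ip = {f. \<exists>\<gamma>\<in>Mult H. \<exists>\<psi>\<in>Mult H.
     closure_wrt H ip (mult_op \<psi> ` H) = H \<and> (\<forall>z\<in>ball 0 1. f z = \<gamma> z / \<psi> z)}"

subsection \<open>Defect operators and sub-Bergman spaces\<close>

definition bergman_adjoint :: "real \<Rightarrow> ((complex \<Rightarrow> complex) \<Rightarrow> (complex \<Rightarrow> complex))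
    \<Rightarrow> (complex \<Rightarrow> complex) \<Rightarrow> (complex \<Rightarrow> complex)" where
  "bergman_adjoint \<alpha> T f =
     (THE g. g \<in> bergman \<alpha> \<and> (\<forall>h\<in>bergman \<alpha>. bergman_inner \<alpha> (T h) f = bergman_inner \<alpha> h g))"

definition bergman_bounded_op :: "real \<Rightarrow> ((complex \<Rightarrow> complex) \<Rightarrow> (complex \<Rightarrow> complex)) \<Rightarrow> bool" where
  "bergman_bounded_op \<alpha> B \<longleftrightarrow> B ` bergman \<alpha> \<subseteq> bergman \<alpha>
     \<and> (\<forall>f\<in>bergman \<alpha>. \<forall>g\<in>bergman \<alpha>. \<forall>a b.
          B (\<lambda>z. a * f z + b * g z) = (\<lambda>z. a * B f z + b * B g z))
     \<and> (\<exists>C. \<forall>f\<in>bergman \<alpha>. norm_of (bergman_inner \<alpha>) (B f) \<le> C * norm_of (bergman_inner \<alpha>) f)"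

definition bergman_positive_op :: "real \<Rightarrow> ((complex \<Rightarrow> complex) \<Rightarrow> (complex \<Rightarrow> complex)) \<Rightarrow> bool" where
  "bergman_positive_op \<alpha> B \<longleftrightarrow> bergman_bounded_op \<alpha> B
     \<and> (\<forall>f\<in>bergman \<alpha>. bergman_inner \<alpha> (B f) f \<in> \<real>\<^sub>\<ge>\<^sub>0)"

text \<open>
  The positive square root is unique as an operator on the Bergman space; the choice operator
  only leaves its values on functions outside that space unspecified.
\<close>

definition bergman_sqrt_op :: "real \<Rightarrow> ((complex \<Rightarrow> complex) \<Rightarrow> (complex \<Rightarrow> complex))
    \<Rightarrow> (complex \<Rightarrow> complex) \<Rightarrow> (complex \<Rightarrow> complex)" where
  "bergman_sqrt_op \<alpha> A = (SOME B. bergman_positive_op \<alpha> B \<and> (\<forall>f\<in>bergman \<alpha>. B (B f) = A f))"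

definition defect_op :: "real \<Rightarrow> (complex \<Rightarrow> complex) \<Rightarrow> (complex \<Rightarrow> complex) \<Rightarrow> (complex \<Rightarrow> complex)" where
  "defect_op \<alpha> \<phi> = bergman_sqrt_op \<alpha>
     (\<lambda>f z. f z - mult_op \<phi> (bergman_adjoint \<alpha> (mult_op \<phi>) f) z)"

definition sub_bergman :: "real \<Rightarrow> (complex \<Rightarrow> complex) \<Rightarrow> (complex \<Rightarrow> complex) set" where
  "sub_bergman \<alpha> \<phi> = defect_op \<alpha> \<phi> ` bergman \<alpha>"

definition defect_ker_compl :: "real \<Rightarrow> (complex \<Rightarrow> complex) \<Rightarrow> (complex \<Rightarrow> complex) set" where
  "defect_ker_compl \<alpha> \<phi> = {x \<in> bergman \<alpha>. \<forall>y\<in>bergman \<alpha>.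
     defect_op \<alpha> \<phi> y = (\<lambda>z. 0) \<longrightarrow> bergman_inner \<alpha> x y = 0}"

text \<open>
  The defect operator maps the orthogonal complement of its kernel bijectively onto its range,
  and the inner product of the range is transported along this bijection.
\<close>

definition sub_bergman_inner :: "real \<Rightarrow> (complex \<Rightarrow> complex)
    \<Rightarrow> (complex \<Rightarrow> complex) \<Rightarrow> (complex \<Rightarrow> complex) \<Rightarrow> complex" where
  "sub_bergman_inner \<alpha> \<phi> f g = bergman_inner \<alpha>
     (inv_into (defect_ker_compl \<alpha> \<phi>) (defect_op \<alpha> \<phi>) f)
     (inv_into (defect_ker_compl \<alpha> \<phi>) (defect_op \<alpha> \<phi>) g)"

subsection \<open>Non-tangential limits\<close>

definition stolz_region :: "real \<Rightarrow> complex \<Rightarrow> complex set" where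
  "stolz_region M \<xi> = {z \<in> ball 0 1. cmod (z - \<xi>) < M * (1 - cmod z)}"

definition has_nontangential_limit :: "(complex \<Rightarrow> complex) \<Rightarrow> complex \<Rightarrow> complex \<Rightarrow> bool" where
  "has_nontangential_limit f \<xi> l \<longleftrightarrow> (\<forall>M>1. (f \<longlongrightarrow> l) (at \<xi> within stolz_region M \<xi>))"

end

theory Submission
  imports Defs
begin

text \<open>
  Multipliers of a nonzero sub-Bergman space \<open>H = D ` A\<close>, where \<open>D\<close> is the defect operator on the
  Bergman space \<open>A\<close>, are bounded functions. A function in the Smirnov class of \<open>H\<close> is
  therefore a quotient \<open>\<gamma> / \<psi>\<close> of bounded holomorphic functions, and \<open>\<psi>\<close> is not identically
  zero because \<open>\<psi> H\<close> is dense in \<open>H\<close> and \<open>H\<close> is not zero. Fatou's theorem provides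
  non-tangential limits of \<open>\<gamma>\<close> and \<open>\<psi>\<close> almost everywhere, the uniqueness theorem of F. and M.
  Riesz says that those of \<open>\<psi>\<close> are nonzero almost everywhere, and the quotient of the limits is
  the limit of the quotient.

  Boundedness of multipliers (\<open>multiplier_of_range_bounded\<close>). Let \<open>N w\<close> be the norm of the
  functional \<open>x \<mapsto> (D x) w\<close> on \<open>A\<close>. If \<open>\<gamma>\<close> multiplies \<open>H\<close> into itself, then for every \<open>x\<close>
  there is a \<open>y\<close> with \<open>\<gamma> \<cdot> D x = D y\<close>, so the functionals \<open>x \<mapsto> \<gamma> w \<cdot> (D x) w / N w\<close> are bounded
  at \<open>x\<close> by the norm of \<open>y\<close>, uniformly in \<open>w\<close>. By uniform boundedness their norms
  \<open>\<bar>\<gamma> w\<bar>\<close> are bounded. The points \<open>w\<close> with \<open>N w = 0\<close>, which are isolated, are covered by the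
  continuity of \<open>\<gamma>\<close>. The inputs are that \<open>A\<close> is a Hilbert space on which point evaluations are
  continuous (\<open>bergman_local_bound\<close>, \<open>bergman_complete\<close>) and that the positive square root
  defining \<open>D\<close> exists (\<open>defect_sqrt_exists\<close>).

  Fatou's theorem (\<open>fatou_nontangential_limits\<close>). A primitive \<open>G\<close> of a bounded function \<open>F\<close> is
  Lipschitz, hence extends to the closed disc, and \<open>t \<mapsto> G (cis t)\<close> is Lipschitz, hence differentiable
  almost everywhere (\<open>lipschitz_differentiable_ae\<close>, from Vitali's covering theorem). At a point of
  differentiability the Cauchy formula for \<open>G' = F\<close>, corrected by the reflected point so that its
  kernel decays like the Poisson kernel, gives the non-tangential limit of \<open>F\<close>.

  Uniqueness (\<open>nontangential_limits_nonzero\<close>). Dividing out zeros by Blaschke factors and taking an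
  \<open>n\<close>-th root of the rest shows that the means of \<open>\<bar>\<psi>\<bar>\<close> to the power \<open>1 / n\<close> over circles of
  radius near \<open>1\<close> are at least \<open>\<kappa>\<close> to the power \<open>1 / n\<close> for a fixed \<open>\<kappa> > 0\<close>. This survives in the radial limit, and letting
  \<open>n\<close> tend to infinity leaves the measure of the set where the boundary function is nonzero.
\<close>

section \<open>Reproducing kernel Hilbert spaces of functions\<close>

text \<open>
  A Hilbert space of functions is kept as a set with an inner product, because the spaces that
  occur depend on parameters. Scalar multiplication and addition are pointwise. Definiteness of the
  inner product follows from the bound on point evaluations.
\<close>

locale rkhs =
  fixes H :: "(complex \<Rightarrow> complex) set"
    and ip :: "(complex \<Rightarrow> complex) \<Rightarrow> (complex \<Rightarrow> complex) \<Rightarrow> complex"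
  assumes zero_mem: "(\<lambda>z. 0) \<in> H"
    and lincomb_mem: "f \<in> H \<Longrightarrow> g \<in> H \<Longrightarrow> (\<lambda>z. a * f z + b * g z) \<in> H"
    and ip_lincomb: "f \<in> H \<Longrightarrow> g \<in> H \<Longrightarrow> h \<in> H \<Longrightarrow>
          ip (\<lambda>z. a * f z + b * g z) h = a * ip f h + b * ip g h"
    and ip_commute: "f \<in> H \<Longrightarrow> g \<in> H \<Longrightarrow> ip g f = cnj (ip f g)"
    and ip_self_nonneg: "f \<in> H \<Longrightarrow> 0 \<le> Re (ip f f)"
    and evaluation_bounded: "\<exists>C. \<forall>f\<in>H. cmod (f z) \<le> C * norm_of ip f"
    and complete: "(\<And>n. s n \<in> H) \<Longrightarrow>
          (\<And>e. 0 < e \<Longrightarrow> \<exists>N. \<forall>m\<ge>N. \<forall>n\<ge>N. norm_of ip (\<lambda>z. s m z - s n z) < e) \<Longrightarrow>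
          \<exists>g\<in>H. (\<lambda>n. norm_of ip (\<lambda>z. s n z - g z)) \<longlonglongrightarrow> 0"
begin

abbreviation nrm :: "(complex \<Rightarrow> complex) \<Rightarrow> real" where
  "nrm \<equiv> norm_of ip"

lemma add_mem: "f \<in> H \<Longrightarrow> g \<in> H \<Longrightarrow> (\<lambda>z. f z + g z) \<in> H"
  using lincomb_mem[of f g 1 1] by simp

lemma diff_mem: "f \<in> H \<Longrightarrow> g \<in> H \<Longrightarrow> (\<lambda>z. f z - g z) \<in> H"
  using lincomb_mem[of f g 1 "-1"] by simp

lemma scale_mem: "f \<in> H \<Longrightarrow> (\<lambda>z. a * f z) \<in> H"
  using lincomb_mem[of f f a 0] by simp

lemma ip_add: "f \<in> H \<Longrightarrow> g \<in> H \<Longrightarrow> h \<in> H \<Longrightarrow> ip (\<lambda>z. f z + g z) h = ip f h + ip g h"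
  using ip_lincomb[of f g h 1 1] by simp

lemma ip_diff: "f \<in> H \<Longrightarrow> g \<in> H \<Longrightarrow> h \<in> H \<Longrightarrow> ip (\<lambda>z. f z - g z) h = ip f h - ip g h"
  using ip_lincomb[of f g h 1 "-1"] by simp

lemma ip_scale: "f \<in> H \<Longrightarrow> h \<in> H \<Longrightarrow> ip (\<lambda>z. a * f z) h = a * ip f h"
  using ip_lincomb[of f f h a 0] by simp

lemma ip_add_right: "f \<in> H \<Longrightarrow> g \<in> H \<Longrightarrow> h \<in> H \<Longrightarrow> ip h (\<lambda>z. f z + g z) = ip h f + ip h g"
  using ip_commute[OF add_mem[of f g], of h] ip_add[of f g h] ip_commute[of f h] ip_commute[of g h]
  by simp

lemma ip_diff_right: "f \<in> H \<Longrightarrow> g \<in> H \<Longrightarrow> h \<in> H \<Longrightarrow> ip h (\<lambda>z. f z - g z) = ip h f - ip h g"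
  using ip_commute[OF diff_mem[of f g], of h] ip_diff[of f g h] ip_commute[of f h] ip_commute[of g h]
  by simp

lemma ip_scale_right: "f \<in> H \<Longrightarrow> h \<in> H \<Longrightarrow> ip h (\<lambda>z. a * f z) = cnj a * ip h f"
  using ip_commute[OF scale_mem[of f a], of h] ip_scale[of f h a] ip_commute[of f h]
  by simp

lemma ip_zero: "h \<in> H \<Longrightarrow> ip (\<lambda>z. 0) h = 0"
  using ip_scale[OF zero_mem, of h 0] by simp

lemma ip_zero_right: "h \<in> H \<Longrightarrow> ip h (\<lambda>z. 0) = 0"
  using ip_commute[OF zero_mem, of h] ip_zero[of h] by simp

lemma nrm_nonneg: "f \<in> H \<Longrightarrow> 0 \<le> nrm f"
  by (simp add: norm_of_def ip_self_nonneg)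

lemma ip_self: "f \<in> H \<Longrightarrow> ip f f = of_real ((nrm f)\<^sup>2)"
proof -
  assume f: "f \<in> H"
  have "Im (ip f f) = Im (cnj (ip f f))"
    by (rule arg_cong[OF ip_commute[OF f f]])
  then have "Im (ip f f) = 0" by simp
  then show ?thesis
    using ip_self_nonneg[OF f] by (simp add: norm_of_def complex_eq_iff)
qed

lemma nrm_scale: "f \<in> H \<Longrightarrow> nrm (\<lambda>z. a * f z) = cmod a * nrm f"
proof -
  assume f: "f \<in> H"
  have "ip (\<lambda>z. a * f z) (\<lambda>z. a * f z) = of_real ((cmod a * nrm f)\<^sup>2)"
    using f scale_mem[OF f, of a]
    by (simp add: ip_scale ip_scale_right ip_self power_mult_distrib mult_ac
        flip: complex_norm_square)
  then show ?thesis
    using f by (simp add: norm_of_def[of ip "\<lambda>z. a * f z"] nrm_nonneg)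
qed

lemma nrm_zero: "nrm (\<lambda>z. 0) = 0"
  using nrm_scale[OF zero_mem, of 0] by simp

lemma nrm_eq_0D: "f \<in> H \<Longrightarrow> nrm f = 0 \<Longrightarrow> f = (\<lambda>z. 0)"
  using evaluation_bounded by (fastforce simp: fun_eq_iff)

lemma nrm_diff_commute: "f \<in> H \<Longrightarrow> g \<in> H \<Longrightarrow> nrm (\<lambda>z. f z - g z) = nrm (\<lambda>z. g z - f z)"
  using nrm_scale[of "\<lambda>z. f z - g z" "-1"] diff_mem[of f g] by simp

lemma nrm_add_square:
  assumes "f \<in> H" "g \<in> H"
  shows "(nrm (\<lambda>z. f z + g z))\<^sup>2 = (nrm f)\<^sup>2 + (nrm g)\<^sup>2 + 2 * Re (ip f g)"
proof -
  have "complex_of_real ((nrm (\<lambda>z. f z + g z))\<^sup>2) = ip (\<lambda>z. f z + g z) (\<lambda>z. f z + g z)"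
    using add_mem[OF assms] by (simp add: ip_self)
  also have "\<dots> = of_real ((nrm f)\<^sup>2) + of_real ((nrm g)\<^sup>2) + (ip f g + cnj (ip f g))"
    using assms add_mem[OF assms]
    by (simp add: ip_add ip_add_right ip_self ip_commute[of f g])
  also have "\<dots> = of_real ((nrm f)\<^sup>2 + (nrm g)\<^sup>2 + 2 * Re (ip f g))"
    by (simp add: complex_add_cnj)
  finally show ?thesis
    using of_real_eq_iff by blast
qed

lemma nrm_diff_square:
  assumes "f \<in> H" "g \<in> H"
  shows "(nrm (\<lambda>z. f z - g z))\<^sup>2 = (nrm f)\<^sup>2 + (nrm g)\<^sup>2 - 2 * Re (ip f g)"
  using nrm_add_square[OF assms(1) scale_mem[OF assms(2), of "-1"]] assms
    nrm_scale[OF assms(2), of "-1"] ip_scale_right[OF assms(2,1), of "-1"]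
  by simp

text \<open>
  The squared distance from \<open>y\<close> to the line through \<open>h\<close>. It yields both the Cauchy-Schwarz
  inequality and the orthogonality of minimal distances.
\<close>

lemma nrm_diff_component:
  assumes y: "y \<in> H" and h: "h \<in> H" and "nrm h \<noteq> 0"
  shows "(nrm (\<lambda>z. y z - ip y h / of_real ((nrm h)\<^sup>2) * h z))\<^sup>2
    = (nrm y)\<^sup>2 - (cmod (ip y h))\<^sup>2 / (nrm h)\<^sup>2"
proof -
  let ?c = "ip y h / of_real ((nrm h)\<^sup>2)"
  have "cnj ?c * ip y h = of_real ((cmod (ip y h))\<^sup>2 / (nrm h)\<^sup>2)"
    using complex_norm_square[of "ip y h"] by (simp add: mult.commute)
  then have "Re (ip y (\<lambda>z. ?c * h z)) = (cmod (ip y h))\<^sup>2 / (nrm h)\<^sup>2"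
    using ip_scale_right[OF h y, of ?c] by (metis Re_complex_of_real)
  moreover have "(nrm (\<lambda>z. ?c * h z))\<^sup>2 = (cmod (ip y h))\<^sup>2 / (nrm h)\<^sup>2"
    using nrm_scale[OF h, of ?c] \<open>nrm h \<noteq> 0\<close>
    by (simp add: norm_divide norm_mult power2_eq_square)
  ultimately show ?thesis
    using nrm_diff_square[OF y scale_mem[OF h, of ?c]] by simp
qed

lemma cauchy_schwarz:
  assumes f: "f \<in> H" and g: "g \<in> H"
  shows "cmod (ip f g) \<le> nrm f * nrm g"
proof (cases "nrm g = 0")
  case True
  then have "ip g f = 0"
    using nrm_eq_0D[OF g] ip_zero[OF f] by simp
  then show ?thesis
    using ip_commute[OF g f] True by simp
next
  case False
  then have "(cmod (ip f g))\<^sup>2 / (nrm g)\<^sup>2 \<le> (nrm f)\<^sup>2"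
    using nrm_diff_component[OF f g False]
      zero_le_power2[of "nrm (\<lambda>z. f z - ip f g / of_real ((nrm g)\<^sup>2) * g z)"]
    by linarith
  then have "(cmod (ip f g))\<^sup>2 \<le> (nrm f * nrm g)\<^sup>2"
    using False by (simp add: pos_divide_le_eq power_mult_distrib)
  then show ?thesis
    by (rule power2_le_imp_le) (simp add: f g nrm_nonneg)
qed

lemma nrm_triangle:
  assumes f: "f \<in> H" and g: "g \<in> H"
  shows "nrm (\<lambda>z. f z + g z) \<le> nrm f + nrm g"
proof (rule power2_le_imp_le)
  have "Re (ip f g) \<le> nrm f * nrm g"
    using cauchy_schwarz[OF f g] complex_Re_le_cmod order_trans by blast
  then show "(nrm (\<lambda>z. f z + g z))\<^sup>2 \<le> (nrm f + nrm g)\<^sup>2"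
    by (simp add: nrm_add_square[OF f g] power2_sum)
qed (simp add: f g nrm_nonneg)

lemma nrm_triangle_diff:
  assumes "f \<in> H" "g \<in> H" "h \<in> H"
  shows "nrm (\<lambda>z. f z - h z) \<le> nrm (\<lambda>z. f z - g z) + nrm (\<lambda>z. g z - h z)"
  using nrm_triangle[OF diff_mem[OF assms(1,2)] diff_mem[OF assms(2,3)]] by simp

lemma nrm_diff_le: "f \<in> H \<Longrightarrow> g \<in> H \<Longrightarrow> nrm (\<lambda>z. f z - g z) \<le> nrm f + nrm g"
  using nrm_triangle_diff[of f "\<lambda>z. 0" g] nrm_scale[of g "-1"] by (simp add: zero_mem)

definition converges_to :: "(nat \<Rightarrow> complex \<Rightarrow> complex) \<Rightarrow> (complex \<Rightarrow> complex) \<Rightarrow> bool" where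
  "converges_to s g \<longleftrightarrow> (\<forall>n. s n \<in> H) \<and> g \<in> H \<and> (\<lambda>n. nrm (\<lambda>z. s n z - g z)) \<longlonglongrightarrow> 0"

lemma converges_toI_bound:
  assumes "\<And>n. s n \<in> H" "g \<in> H" "\<And>n. nrm (\<lambda>z. s n z - g z) \<le> b n" "b \<longlonglongrightarrow> 0"
  shows "converges_to s g"
  unfolding converges_to_def
proof (intro conjI allI)
  show "(\<lambda>n. nrm (\<lambda>z. s n z - g z)) \<longlonglongrightarrow> 0"
    by (rule tendsto_sandwich[OF _ _ tendsto_const assms(4)])
       (auto simp: assms intro!: always_eventually nrm_nonneg diff_mem)
qed (use assms in auto)

lemma converges_to_pointwise:
  assumes "converges_to s g"
  shows "(\<lambda>n. s n z) \<longlonglongrightarrow> g z"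
proof -
  obtain C where C: "\<And>f. f \<in> H \<Longrightarrow> cmod (f z) \<le> C * nrm f"
    using evaluation_bounded by blast
  have "(\<lambda>n. s n z - g z) \<longlonglongrightarrow> 0"
  proof (rule Lim_null_comparison)
    show "\<forall>\<^sub>F n in sequentially. norm (s n z - g z) \<le> C * nrm (\<lambda>z. s n z - g z)"
      using assms C[OF diff_mem] by (auto simp: converges_to_def)
    show "(\<lambda>n. C * nrm (\<lambda>z. s n z - g z)) \<longlonglongrightarrow> 0"
      using assms tendsto_mult_right_zero by (auto simp: converges_to_def)
  qed
  then show ?thesis
    by (simp add: LIM_zero_iff)
qed

lemma converges_to_unique:
  "converges_to s g \<Longrightarrow> converges_to s h \<Longrightarrow> g = h"
  using LIMSEQ_unique converges_to_pointwise by (metis ext)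

lemma converges_to_lincomb:
  assumes s: "converges_to s g" and t: "converges_to t h"
  shows "converges_to (\<lambda>n z. a * s n z + b * t n z) (\<lambda>z. a * g z + b * h z)"
proof (rule converges_toI_bound)
  fix n
  have "nrm (\<lambda>z. a * (s n z - g z) + b * (t n z - h z))
      \<le> nrm (\<lambda>z. a * (s n z - g z)) + nrm (\<lambda>z. b * (t n z - h z))"
    using s t by (intro nrm_triangle scale_mem diff_mem) (auto simp: converges_to_def)
  also have "\<dots> = cmod a * nrm (\<lambda>z. s n z - g z) + cmod b * nrm (\<lambda>z. t n z - h z)"
    using s t by (simp add: nrm_scale diff_mem converges_to_def)
  finally show "nrm (\<lambda>z. a * s n z + b * t n z - (a * g z + b * h z))
      \<le> cmod a * nrm (\<lambda>z. s n z - g z) + cmod b * nrm (\<lambda>z. t n z - h z)"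
    by (simp add: algebra_simps)
next
  show "(\<lambda>n. cmod a * nrm (\<lambda>z. s n z - g z) + cmod b * nrm (\<lambda>z. t n z - h z)) \<longlonglongrightarrow> 0"
    using s t by (auto simp: converges_to_def intro!: tendsto_add_zero tendsto_mult_right_zero)
qed (use s t in \<open>auto simp: converges_to_def lincomb_mem\<close>)

lemma converges_to_ip:
  assumes s: "converges_to s g" and h: "h \<in> H"
  shows "(\<lambda>n. ip (s n) h) \<longlonglongrightarrow> ip g h"
proof -
  have "(\<lambda>n. ip (s n) h - ip g h) \<longlonglongrightarrow> 0"
  proof (rule Lim_null_comparison)
    show "\<forall>\<^sub>F n in sequentially. norm (ip (s n) h - ip g h) \<le> nrm (\<lambda>z. s n z - g z) * nrm h"
    proof (intro always_eventually allI)
      fix n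
      have "s n \<in> H" "g \<in> H"
        using s by (auto simp: converges_to_def)
      then show "norm (ip (s n) h - ip g h) \<le> nrm (\<lambda>z. s n z - g z) * nrm h"
        using cauchy_schwarz[OF diff_mem[of "s n" g] h] ip_diff[of "s n" g h] h by simp
    qed
    show "(\<lambda>n. nrm (\<lambda>z. s n z - g z) * nrm h) \<longlonglongrightarrow> 0"
      using s tendsto_mult_left_zero by (auto simp: converges_to_def)
  qed
  then show ?thesis
    by (simp add: LIM_zero_iff)
qed

lemma converges_to_nrm_le:
  assumes s: "converges_to s g" and f: "f \<in> H" and le: "\<forall>\<^sub>F n in sequentially. nrm (\<lambda>z. s n z - f z) \<le> r"
  shows "nrm (\<lambda>z. g z - f z) \<le> r"
proof -
  have lim: "(\<lambda>n. nrm (\<lambda>z. s n z - g z) + r) \<longlonglongrightarrow> 0 + r"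
    using s by (intro tendsto_intros) (auto simp: converges_to_def)
  have "\<forall>\<^sub>F n in sequentially. nrm (\<lambda>z. g z - f z) \<le> nrm (\<lambda>z. s n z - g z) + r"
    using le
  proof eventually_elim
    case (elim n)
    then show ?case
      using s nrm_triangle_diff[of g "s n" f] nrm_diff_commute[of g "s n"] f
      by (auto simp: converges_to_def)
  qed
  then show ?thesis
    using tendsto_lowerbound[OF lim] by simp
qed

text \<open>
  Completeness in the form in which it is used: a modulus of convergence \<open>b\<close> is given and is
  inherited by the limit.
\<close>

lemma cauchy_converges:
  assumes s: "\<And>n. s n \<in> H" and b: "\<And>m n. n \<le> m \<Longrightarrow> nrm (\<lambda>z. s m z - s n z) \<le> b n"
    and b0: "b \<longlonglongrightarrow> 0"
  obtains g where "converges_to s g" "\<And>n. nrm (\<lambda>z. g z - s n z) \<le> b n"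
proof -
  have "\<exists>N. \<forall>m\<ge>N. \<forall>n\<ge>N. nrm (\<lambda>z. s m z - s n z) < e" if "e > 0" for e
  proof -
    obtain N where N: "\<And>n. n \<ge> N \<Longrightarrow> norm (b n) < e"
      using LIMSEQ_D[OF b0 \<open>e > 0\<close>] by auto
    show ?thesis
    proof (intro exI[of _ N] allI impI)
      fix m n assume "N \<le> m" "N \<le> n"
      then show "nrm (\<lambda>z. s m z - s n z) < e"
        using b[of m n] b[of n m] N[of m] N[of n] nrm_diff_commute[OF s s, of m n]
        by (cases "m \<le> n") auto
    qed
  qed
  then have "\<exists>g\<in>H. (\<lambda>n. nrm (\<lambda>z. s n z - g z)) \<longlonglongrightarrow> 0"
    by (rule complete[OF s])
  then obtain g where g: "converges_to s g"
    using s by (auto simp: converges_to_def)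
  moreover have "nrm (\<lambda>z. g z - s n z) \<le> b n" for n
    using converges_to_nrm_le[OF g s] b eventually_sequentially by blast
  ultimately show thesis
    using that by blast
qed

subsection \<open>Orthogonal projection and the Riesz representation\<close>

text \<open>
  By the parallelogram law, a sequence in \<open>M\<close> whose distances to \<open>x\<close> approach the infimum is a Cauchy
  sequence; the infimum is attained at its limit \<open>m\<close>, and \<open>x - m\<close> is orthogonal to \<open>M\<close> because moving
  from \<open>m\<close> in a direction of \<open>M\<close> cannot reduce the distance.
\<close>

lemma orthogonal_projection:
  assumes M: "M \<subseteq> H" "(\<lambda>z. 0) \<in> M"
    and M_lin: "\<And>f g a b. f \<in> M \<Longrightarrow> g \<in> M \<Longrightarrow> (\<lambda>z. a * f z + b * g z) \<in> M"
    and M_closed: "\<And>s g. (\<And>n. s n \<in> M) \<Longrightarrow> converges_to s g \<Longrightarrow> g \<in> M"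
    and x: "x \<in> H"
  obtains m where "m \<in> M" "\<And>h. h \<in> M \<Longrightarrow> ip (\<lambda>z. x z - m z) h = 0"
proof -
  define D where "D = (\<lambda>m. nrm (\<lambda>z. x z - m z)) ` M"
  define d where "d = Inf D"
  have D: "D \<noteq> {}" "bdd_below D" "\<And>y. y \<in> D \<Longrightarrow> 0 \<le> y"
    using M x by (auto simp: D_def intro!: bdd_belowI[of _ 0] nrm_nonneg diff_mem)
  have d_le: "d \<le> nrm (\<lambda>z. x z - m z)" if "m \<in> M" for m
    using that D cInf_lower[of _ D] by (auto simp: d_def D_def)
  have d0: "0 \<le> d"
    using D cInf_greatest by (auto simp: d_def)
  have "\<exists>m\<in>M. nrm (\<lambda>z. x z - m z) < d + 1 / real (Suc n)" for n
    using D cInf_lessD[of D "d + 1 / real (Suc n)"] by (auto simp: d_def D_def)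
  then obtain s where s: "\<And>n. s n \<in> M" "\<And>n. nrm (\<lambda>z. x z - s n z) < d + 1 / real (Suc n)"
    by metis
  have sH: "s n \<in> H" for n using s M by auto
  define b where "b n = sqrt (4 * ((d + 1 / real (Suc n))\<^sup>2 - d\<^sup>2))" for n
  have cauchy: "nrm (\<lambda>z. s m z - s n z) \<le> b n" if "n \<le> m" for m n
  proof -
    let ?u = "\<lambda>z. x z - s n z" and ?v = "\<lambda>z. x z - s m z"
    have uv: "?u \<in> H" "?v \<in> H" using x sH by (auto intro: diff_mem)
    have "(\<lambda>z. 1/2 * s n z + 1/2 * s m z) \<in> M"
      using M_lin s by blast
    from d_le[OF this] have "2 * d \<le> 2 * nrm (\<lambda>z. x z - (1/2 * s n z + 1/2 * s m z))"
      by simp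
    also have "\<dots> = nrm (\<lambda>z. 2 * (x z - (1/2 * s n z + 1/2 * s m z)))"
      using nrm_scale[OF diff_mem[OF x lincomb_mem[OF sH sH, of "1/2" n "1/2" m]], of 2] by simp
    also have "\<dots> = nrm (\<lambda>z. ?u z + ?v z)"
      by (simp add: algebra_simps)
    finally have "(2 * d)\<^sup>2 \<le> (nrm (\<lambda>z. ?u z + ?v z))\<^sup>2"
      using d0 by (intro power_mono) auto
    moreover have "nrm ?u \<le> d + 1 / real (Suc n)"
      using s(2)[of n] by simp
    moreover have "nrm ?v \<le> d + 1 / real (Suc n)"
      using s(2)[of m] frac_le[of 1 1 "real (Suc n)" "real (Suc m)"] \<open>n \<le> m\<close> by simp
    ultimately have "(nrm (\<lambda>z. ?u z - ?v z))\<^sup>2 \<le> 4 * ((d + 1 / real (Suc n))\<^sup>2 - d\<^sup>2)"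
      using nrm_add_square[OF uv] nrm_diff_square[OF uv]
        power_mono[of "nrm ?u" "d + 1 / real (Suc n)" 2]
        power_mono[of "nrm ?v" "d + 1 / real (Suc n)" 2] uv
      by (simp add: nrm_nonneg power_mult_distrib algebra_simps)
    then show ?thesis
      unfolding b_def by (intro real_le_rsqrt) simp
  qed
  have "b \<longlonglongrightarrow> sqrt (4 * ((d + 0)\<^sup>2 - d\<^sup>2))"
    unfolding b_def by (intro tendsto_intros LIMSEQ_inverse_real_of_nat[unfolded inverse_eq_divide])
  then have b0: "b \<longlonglongrightarrow> 0" by simp
  obtain m where m: "converges_to s m"
    by (rule cauchy_converges[OF sH cauchy b0])
  then have mM: "m \<in> M" using M_closed s(1) by blast
  then have mH: "m \<in> H" using M by blast
  let ?y = "\<lambda>z. x z - m z"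
  have yH: "?y \<in> H" using x mH by (rule diff_mem)
  have "nrm ?y \<le> d"
  proof -
    have lim: "(\<lambda>n. nrm (\<lambda>z. s n z - m z) + (d + 1 / real (Suc n))) \<longlonglongrightarrow> 0 + (d + 0)"
      using m unfolding converges_to_def
      by (intro tendsto_intros LIMSEQ_inverse_real_of_nat[unfolded inverse_eq_divide]) auto
    have "nrm ?y \<le> nrm (\<lambda>z. s n z - m z) + (d + 1 / real (Suc n))" for n
      using nrm_triangle_diff[OF x sH[of n] mH] s(2)[of n] by simp
    then show ?thesis
      using tendsto_lowerbound[OF lim, of "nrm ?y"] by simp
  qed
  then have yd: "nrm ?y = d" using d_le[OF mM] by simp
  have "ip ?y h = 0" if h: "h \<in> M" for h
  proof (cases "nrm h = 0")
    case True
    then have "h = (\<lambda>z. 0)" using h M nrm_eq_0D by blast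
    then show ?thesis using ip_zero_right[OF yH] by simp
  next
    case False
    have hH: "h \<in> H" using h M by blast
    let ?c = "ip ?y h / of_real ((nrm h)\<^sup>2)"
    have "(\<lambda>z. 1 * m z + ?c * h z) \<in> M"
      using M_lin[OF mM h] by blast
    from d_le[OF this] have "d \<le> nrm (\<lambda>z. ?y z - ?c * h z)"
      by (simp add: algebra_simps)
    then have "d\<^sup>2 \<le> (nrm (\<lambda>z. ?y z - ?c * h z))\<^sup>2"
      using d0 by (intro power_mono) auto
    then have "(cmod (ip ?y h))\<^sup>2 / (nrm h)\<^sup>2 \<le> 0"
      using nrm_diff_component[OF yH hH False] yd by simp
    then show ?thesis
      using False by (simp add: divide_le_0_iff)
  qed
  then show thesis using that mM by blast
qed

text \<open>
  A functional that is not zero is determined up to a scalar by its kernel, so it is given by the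
  inner product with a vector orthogonal to the kernel.
\<close>

lemma riesz_representation:
  assumes L_lin: "\<And>f g a b. f \<in> H \<Longrightarrow> g \<in> H \<Longrightarrow> L (\<lambda>z. a * f z + b * g z) = a * L f + b * L g"
    and L_bound: "\<And>f. f \<in> H \<Longrightarrow> cmod (L f) \<le> C * nrm f"
  obtains g where "g \<in> H" "\<And>h. h \<in> H \<Longrightarrow> L h = ip h g"
proof (cases "\<forall>h\<in>H. L h = 0")
  case True
  then show thesis
    using that[OF zero_mem] ip_zero_right by simp
next
  case False
  then obtain x where x: "x \<in> H" "L x \<noteq> 0" by blast
  have L_diff: "L (\<lambda>z. f z - g z) = L f - L g" if "f \<in> H" "g \<in> H" for f g
    using L_lin[OF that, of 1 "-1"] by simp
  define M where "M = {h\<in>H. L h = 0}"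
  have "L (\<lambda>z. 0) = 0"
    using L_lin[OF zero_mem zero_mem, of 0 0] by simp
  then have M: "M \<subseteq> H" "(\<lambda>z. 0) \<in> M" using zero_mem by (auto simp: M_def)
  obtain m where m: "m \<in> M" "\<And>h. h \<in> M \<Longrightarrow> ip (\<lambda>z. x z - m z) h = 0"
  proof (rule orthogonal_projection[OF M _ _ x(1)])
    show "(\<lambda>z. a * f z + b * g z) \<in> M" if "f \<in> M" "g \<in> M" for f g a b
      using that L_lin lincomb_mem by (auto simp: M_def)
    show "g \<in> M" if s: "\<And>n. s n \<in> M" and g: "converges_to s g" for s g
    proof -
      have gH: "g \<in> H" using g by (simp add: converges_to_def)
      have "cmod (L g) \<le> C * nrm (\<lambda>z. s n z - g z)" for n
      proof -
        have "s n \<in> H" "L (s n) = 0" using s[of n] by (auto simp: M_def)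
        then show ?thesis
          using L_bound[OF diff_mem[of "s n" g]] L_diff[of "s n" g] gH by simp
      qed
      moreover have "(\<lambda>n. C * nrm (\<lambda>z. s n z - g z)) \<longlonglongrightarrow> 0"
        using g tendsto_mult_right_zero by (auto simp: converges_to_def)
      ultimately have "cmod (L g) \<le> 0"
        by (intro LIMSEQ_le_const) auto
      then show ?thesis using gH by (simp add: M_def)
    qed
  qed (rule that)
  define y where "y = (\<lambda>z. x z - m z)"
  have mH: "m \<in> H" "L m = 0" using m by (auto simp: M_def)
  then have y: "y \<in> H" "L y \<noteq> 0"
    using x L_diff by (auto simp: y_def diff_mem)
  have ny: "nrm y \<noteq> 0"
    using nrm_eq_0D[OF y(1)] y(2) \<open>L (\<lambda>z. 0) = 0\<close> by metis
  let ?c = "cnj (L y) / of_real ((nrm y)\<^sup>2)"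
  show thesis
  proof (rule that)
    show "(\<lambda>z. ?c * y z) \<in> H" using y by (intro scale_mem)
    fix h assume h: "h \<in> H"
    have "(\<lambda>z. 1 * h z + (- (L h / L y)) * y z) \<in> M"
      using L_lin[OF h y(1), of 1 "- (L h / L y)"] y lincomb_mem[OF h y(1), of 1 "- (L h / L y)"]
      by (simp add: M_def)
    from m(2)[OF this] have "ip y (\<lambda>z. 1 * h z + (- (L h / L y)) * y z) = 0"
      by (simp add: y_def)
    then have "ip (\<lambda>z. 1 * h z + (- (L h / L y)) * y z) y = 0"
      using ip_commute[OF y(1) lincomb_mem[OF h y(1), of 1 "- (L h / L y)"]] by simp
    then have "ip h y = L h / L y * of_real ((nrm y)\<^sup>2)"
      using ip_lincomb[OF h y(1) y(1), of 1 "- (L h / L y)"] ip_self[OF y(1)] by simp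
    then show "L h = ip h (\<lambda>z. ?c * y z)"
      using ip_scale_right[OF y(1) h, of ?c] y ny by simp
  qed
qed

subsection \<open>The uniform boundedness principle\<close>

text \<open>
  If the functionals are not uniformly bounded, then inside every ball there is a smaller ball on
  which some functional exceeds any prescribed number. The common point of a nested sequence of such
  balls violates pointwise boundedness.
\<close>

lemma uniform_boundedness:
  fixes L :: "'i \<Rightarrow> (complex \<Rightarrow> complex) \<Rightarrow> complex"
  assumes L_lin: "\<And>i f g a b. i \<in> I \<Longrightarrow> f \<in> H \<Longrightarrow> g \<in> H \<Longrightarrow>
        L i (\<lambda>z. a * f z + b * g z) = a * L i f + b * L i g"
    and L_bound: "\<And>i. i \<in> I \<Longrightarrow> \<exists>C. \<forall>f\<in>H. cmod (L i f) \<le> C * nrm f"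
    and pointwise: "\<And>f. f \<in> H \<Longrightarrow> \<exists>C. \<forall>i\<in>I. cmod (L i f) \<le> C"
  shows "\<exists>C. \<forall>i\<in>I. \<forall>f\<in>H. cmod (L i f) \<le> C * nrm f"
proof (rule ccontr)
  assume unbounded: "\<not> ?thesis"
  have L_diff: "L i (\<lambda>z. f z - g z) = L i f - L i g" if "i \<in> I" "f \<in> H" "g \<in> H" for i f g
    using L_lin[OF that, of 1 "-1"] by simp
  have large: "\<exists>i\<in>I. \<exists>y\<in>H. nrm (\<lambda>z. y z - x z) \<le> r \<and> cmod (L i y) > K"
    if x: "x \<in> H" and r: "0 < r" for x r K
  proof -
    obtain i f where i: "i \<in> I" and f: "f \<in> H" and big: "cmod (L i f) > 2 * \<bar>K\<bar> / r * nrm f"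
      using unbounded by (meson not_le)
    have nf: "0 < nrm f"
    proof -
      have "nrm f \<noteq> 0"
      proof
        assume "nrm f = 0"
        moreover from L_bound[OF i] obtain C where "cmod (L i f) \<le> C * nrm f"
          using f by blast
        ultimately show False using big by simp
      qed
      then show ?thesis using nrm_nonneg[OF f] by simp
    qed
    define c where "c = complex_of_real (r / nrm f)"
    define y where "y = (\<lambda>z. 1 * x z + c * f z)"
    have y: "y \<in> H" using lincomb_mem[OF x f, of 1 c] by (simp add: y_def)
    have dist: "nrm (\<lambda>z. y z - x z) = r"
      using nrm_scale[OF f, of c] nf r by (simp add: y_def c_def norm_divide)
    have Ly: "L i y = L i x + c * L i f"
      using L_lin[OF i x f, of 1 c] by (simp add: y_def)
    have "cmod (c * L i f) = r / nrm f * cmod (L i f)"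
      using nf r by (simp add: c_def norm_mult norm_divide)
    also have "\<dots> > r / nrm f * (2 * \<bar>K\<bar> / r * nrm f)"
      using big nf r by (intro mult_strict_left_mono) auto
    also have "r / nrm f * (2 * \<bar>K\<bar> / r * nrm f) = 2 * \<bar>K\<bar>"
      using nf r by simp
    finally have "cmod (L i y) > K \<or> cmod (L i x) > K"
      using Ly norm_triangle_ineq4[of "L i y" "L i x"] by auto
    then show ?thesis
    proof
      assume "cmod (L i y) > K"
      then show ?thesis using i y dist by auto
    next
      assume "cmod (L i x) > K"
      then show ?thesis using i x r nrm_zero by (intro bexI[of _ i] bexI[of _ x]) auto
    qed
  qed
  \<comment> \<open>A pair is a closed ball; \<open>P n p q\<close> says that \<open>q\<close> lies in \<open>p\<close>, is at most half as large, and that some functional exceeds \<open>n\<close> on \<open>q\<close>.\<close>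
  define P where "P n p q \<longleftrightarrow> snd q \<le> snd p / 2 \<and> nrm (\<lambda>z. fst q z - fst p z) + snd q \<le> snd p
      \<and> (\<exists>i\<in>I. \<forall>y\<in>H. nrm (\<lambda>z. y z - fst q z) \<le> snd q \<longrightarrow> real n < cmod (L i y))"
    for n :: nat and p q :: "(complex \<Rightarrow> complex) \<times> real"
  have step: "\<exists>q. (fst q \<in> H \<and> 0 < snd q) \<and> P n p q" if p: "fst p \<in> H \<and> 0 < snd p" for n p
  proof -
    obtain i y where i: "i \<in> I" and y: "y \<in> H" "nrm (\<lambda>z. y z - fst p z) \<le> snd p / 2"
      and Ly: "cmod (L i y) > real n + 1"
      using large[of "fst p" "snd p / 2" "real n + 1"] p by auto
    obtain C where C: "\<And>f. f \<in> H \<Longrightarrow> cmod (L i f) \<le> C * nrm f"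
      using L_bound[OF i] by blast
    define r where "r = min (snd p / 2) (1 / (\<bar>C\<bar> + 1))"
    have r: "0 < r" "r \<le> snd p / 2" "r \<le> 1 / (\<bar>C\<bar> + 1)"
      using p by (auto simp: r_def)
    have "real n < cmod (L i v)" if v: "v \<in> H" "nrm (\<lambda>z. v z - y z) \<le> r" for v
    proof -
      have "cmod (L i v - L i y) \<le> C * nrm (\<lambda>z. v z - y z)"
        using C[OF diff_mem[OF v(1) y(1)]] L_diff[OF i v(1) y(1)] by simp
      also have "\<dots> \<le> (\<bar>C\<bar> + 1) * (1 / (\<bar>C\<bar> + 1))"
        using v r nrm_nonneg[OF diff_mem[OF v(1) y(1)]] by (intro mult_mono) auto
      also have "\<dots> = 1" by (simp add: field_simps)
      finally show ?thesis
        using Ly norm_triangle_ineq2[of "L i y" "L i v"] by (simp add: norm_minus_commute)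
    qed
    then show ?thesis
      using i y r by (intro exI[of _ "(y, r)"]) (auto simp: P_def)
  qed
  obtain q where q: "\<And>n. fst (q n) \<in> H \<and> 0 < snd (q n)" "\<And>n. P n (q n) (q (Suc n))"
    using dependent_nat_choice[of "\<lambda>_ p. fst p \<in> H \<and> 0 < snd p" P] step
      zero_mem by (metis fst_conv snd_conv zero_less_one)
  have nest: "nrm (\<lambda>z. fst (q m) z - fst (q n) z) + snd (q m) \<le> snd (q n)" if "n \<le> m" for m n
    using that
  proof (induction m rule: dec_induct)
    case base
    then show ?case by (simp add: nrm_zero)
  next
    case (step m)
    then show ?case
      using q(2)[of m] nrm_triangle_diff[of "fst (q (Suc m))" "fst (q m)" "fst (q n)"] q(1)
      by (auto simp: P_def)
  qed
  have radius: "snd (q n) \<le> snd (q 0) * (1/2) ^ n" for n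
  proof (induction n)
    case (Suc n)
    then show ?case using q(2)[of n] by (auto simp: P_def)
  qed simp
  have close: "nrm (\<lambda>z. fst (q m) z - fst (q n) z) \<le> snd (q n)" if "n \<le> m" for m n
    using nest[OF that] q(1)[of m] by simp
  have radius0: "(\<lambda>n. snd (q n)) \<longlonglongrightarrow> 0"
  proof (rule Lim_null_comparison)
    show "\<forall>\<^sub>F n in sequentially. norm (snd (q n)) \<le> snd (q 0) * (1/2) ^ n"
      using radius q(1) by (auto simp: less_imp_le)
    show "(\<lambda>n. snd (q 0) * (1/2) ^ n) \<longlonglongrightarrow> 0"
      by (intro tendsto_mult_right_zero LIMSEQ_realpow_zero) auto
  qed
  obtain x where x: "converges_to (\<lambda>n. fst (q n)) x"
    "\<And>n. nrm (\<lambda>z. x z - fst (q n) z) \<le> snd (q n)"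
    by (rule cauchy_converges[OF _ close radius0]) (use q(1) in auto)
  have xH: "x \<in> H" using x by (simp add: converges_to_def)
  then obtain C where C: "\<And>i. i \<in> I \<Longrightarrow> cmod (L i x) \<le> C"
    using pointwise by blast
  obtain n where n: "C \<le> real n" using real_arch_simple by blast
  from q(2)[of n] xH x(2)[of "Suc n"] obtain i where "i \<in> I" "real n < cmod (L i x)"
    unfolding P_def by blast
  then show False using C n by fastforce
qed

subsection \<open>Square roots of positive contractions\<close>

text \<open>
  A solution of \<open>Y = (X + Y\<^sup>2) / 2\<close> makes \<open>I - Y\<close> a square root of \<open>I - X\<close>. It is the limit of the
  iteration \<open>T (n + 1) = (X + (T n)\<^sup>2) / 2\<close> from \<open>T 0 = 0\<close>. The numbers \<open>y (n + 1) = (1 + (y n)\<^sup>2) / 2\<close>,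
  the same iteration with \<open>X\<close> replaced by its norm bound \<open>1\<close>, dominate it: \<open>T n\<close> has norm at most
  \<open>y n\<close> and \<open>T (n + 1) - T n\<close> has norm at most \<open>y (n + 1) - y n\<close>. Since \<open>y\<close> is increasing and bounded
  by \<open>1\<close>, the iteration converges in norm.
\<close>

lemma contraction_fixed_point:
  assumes X_mem: "\<And>f. f \<in> H \<Longrightarrow> X f \<in> H"
    and X_lin: "\<And>f g a b. f \<in> H \<Longrightarrow> g \<in> H \<Longrightarrow>
          X (\<lambda>z. a * f z + b * g z) = (\<lambda>z. a * X f z + b * X g z)"
    and X_contr: "\<And>f. f \<in> H \<Longrightarrow> nrm (X f) \<le> nrm f"
    and X_sym: "\<And>f g. f \<in> H \<Longrightarrow> g \<in> H \<Longrightarrow> ip (X f) g = ip f (X g)"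
  obtains Y where "\<And>f. f \<in> H \<Longrightarrow> Y f \<in> H"
    "\<And>f g a b. f \<in> H \<Longrightarrow> g \<in> H \<Longrightarrow>
       Y (\<lambda>z. a * f z + b * g z) = (\<lambda>z. a * Y f z + b * Y g z)"
    "\<And>f. f \<in> H \<Longrightarrow> nrm (Y f) \<le> nrm f"
    "\<And>f g. f \<in> H \<Longrightarrow> g \<in> H \<Longrightarrow> ip (Y f) g = ip f (Y g)"
    "\<And>f. f \<in> H \<Longrightarrow> Y f = (\<lambda>z. 1/2 * X f z + 1/2 * Y (Y f) z)"
proof -
  define T where "T = rec_nat (\<lambda>f z. 0) (\<lambda>n S f z. 1/2 * X f z + 1/2 * S (S f) z)"
  define y :: "nat \<Rightarrow> real" where "y = rec_nat 0 (\<lambda>n c. (1 + c\<^sup>2) / 2)"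
  have T_simps: "T 0 = (\<lambda>f z. 0)" "\<And>n. T (Suc n) = (\<lambda>f z. 1/2 * X f z + 1/2 * T n (T n f) z)"
    by (simp_all add: T_def)
  have y_simps: "y 0 = 0" "\<And>n. y (Suc n) = (1 + (y n)\<^sup>2) / 2"
    by (simp_all add: y_def)
  have y_bounds: "0 \<le> y n \<and> y n \<le> 1" for n
  proof (induction n)
    case (Suc n)
    then have "(y n)\<^sup>2 \<le> 1" by (simp add: power_le_one)
    then show ?case by (simp add: y_simps)
  qed (simp add: y_simps)
  have y_step: "y n \<le> y (Suc n)" for n
    using zero_le_power2[of "1 - y n"] by (simp add: y_simps power2_diff)
  then have y_mono: "incseq y" by (rule incseq_SucI)
  obtain L where L: "y \<longlonglongrightarrow> L" "\<And>n. y n \<le> L"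
    using incseq_convergent[OF y_mono, of 1] y_bounds by blast
  have T_mem: "T n f \<in> H" if "f \<in> H" for n f
    using that by (induction n arbitrary: f) (simp_all add: T_simps zero_mem X_mem lincomb_mem[of _ _ "1/2" "1/2", simplified])
  have T_lin: "T n (\<lambda>z. a * f z + b * g z) = (\<lambda>z. a * T n f z + b * T n g z)"
    if "f \<in> H" "g \<in> H" for n f g a b
    using that
  proof (induction n arbitrary: f g)
    case (Suc n)
    have "T n (T n (\<lambda>z. a * f z + b * g z)) = (\<lambda>z. a * T n (T n f) z + b * T n (T n g) z)"
      by (simp only: Suc.IH[OF Suc.prems] Suc.IH[OF T_mem T_mem, OF Suc.prems])
    then show ?case
      unfolding T_simps X_lin[OF Suc.prems] by (simp add: fun_eq_iff algebra_simps)
  qed (simp add: T_simps)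
  have T_diff: "T n (\<lambda>z. f z - g z) = (\<lambda>z. T n f z - T n g z)" if "f \<in> H" "g \<in> H" for n f g
    using T_lin[OF that, of n 1 "-1"] by simp
  have T_sym: "ip (T n f) g = ip f (T n g)" if "f \<in> H" "g \<in> H" for n f g
    using that
  proof (induction n arbitrary: f g)
    case 0
    then show ?case using ip_commute[OF zero_mem, of f] by (simp add: T_simps ip_zero)
  next
    case (Suc n)
    have "ip (T (Suc n) f) g = 1/2 * ip (X f) g + 1/2 * ip (T n (T n f)) g"
      unfolding T_simps by (intro ip_lincomb X_mem T_mem Suc.prems)
    also have "\<dots> = 1/2 * ip f (X g) + 1/2 * ip f (T n (T n g))"
      by (simp only: X_sym[OF Suc.prems] Suc.IH[OF T_mem Suc.prems(2), OF Suc.prems(1)]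
          Suc.IH[OF Suc.prems(1) T_mem, OF Suc.prems(2)])
    also have "\<dots> = ip f (T (Suc n) g)"
      unfolding T_simps
      by (simp only: ip_add_right ip_scale_right scale_mem X_mem T_mem Suc.prems) simp
    finally show ?case .
  qed
  have T_norm: "nrm (T n f) \<le> y n * nrm f" if "f \<in> H" for n f
    using that
  proof (induction n arbitrary: f)
    case 0
    then show ?case by (simp add: T_simps y_simps nrm_zero)
  next
    case (Suc n)
    have "nrm (T n (T n f)) \<le> y n * (y n * nrm f)"
      using Suc.IH[OF T_mem[OF Suc.prems, of n]] y_bounds[of n]
        mult_left_mono[OF Suc.IH[OF Suc.prems], of "y n"] by simp
    moreover have "nrm (T (Suc n) f) \<le> nrm (\<lambda>z. 1/2 * X f z) + nrm (\<lambda>z. 1/2 * T n (T n f) z)"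
      unfolding T_simps by (intro nrm_triangle scale_mem X_mem T_mem Suc.prems)
    ultimately show ?case
      using X_contr[OF Suc.prems] nrm_scale[OF X_mem[OF Suc.prems], of "1/2"]
        nrm_scale[OF T_mem[OF T_mem[OF Suc.prems]], of "1/2" n n]
      by (simp add: y_simps power2_eq_square algebra_simps)
  qed
  have T_step: "nrm (\<lambda>z. T (Suc n) f z - T n f z) \<le> (y (Suc n) - y n) * nrm f" if "f \<in> H" for n f
    using that
  proof (induction n arbitrary: f)
    case 0
    then show ?case
      using T_norm[OF 0, of "Suc 0"] by (simp add: T_simps y_simps)
  next
    case (Suc n)
    \<comment> \<open>The identity \<open>S\<^sup>2 - R\<^sup>2 = S (S - R) + (S - R) R\<close>, valid without commutativity, reduces the next difference to the present one.\<close>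
    let ?u = "T (Suc n) (\<lambda>z. T (Suc n) f z - T n f z)"
    let ?v = "\<lambda>z. T (Suc n) (T n f) z - T n (T n f) z"
    have f: "f \<in> H" by fact
    have d: "(\<lambda>z. T (Suc n) f z - T n f z) \<in> H"
      by (intro diff_mem T_mem f)
    have u: "nrm ?u \<le> y (Suc n) * ((y (Suc n) - y n) * nrm f)"
      by (rule order_trans[OF T_norm[OF d] mult_left_mono[OF Suc.IH[OF f]]]) (simp add: y_bounds)
    have v: "nrm ?v \<le> (y (Suc n) - y n) * (y n * nrm f)"
      by (rule order_trans[OF Suc.IH[OF T_mem[OF f]] mult_left_mono[OF T_norm[OF f]]])
         (simp add: y_step)
    have uv: "nrm (\<lambda>z. ?u z + ?v z) \<le> nrm ?u + nrm ?v"
      by (intro nrm_triangle diff_mem T_mem d f)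
    have split: "(\<lambda>z. T (Suc (Suc n)) f z - T (Suc n) f z) = (\<lambda>z. 1/2 * (?u z + ?v z))"
    proof -
      have "?u = (\<lambda>z. T (Suc n) (T (Suc n) f) z - T (Suc n) (T n f) z)"
        by (intro T_diff T_mem f)
      moreover have "T (Suc (Suc n)) f z - T (Suc n) f z
          = 1/2 * (T (Suc n) (T (Suc n) f) z - T n (T n f) z)" for z
        unfolding T_simps(2)[of "Suc n"] unfolding T_simps(2)[of n, THEN fun_cong, of f]
        by (simp add: algebra_simps)
      ultimately show ?thesis by (simp add: fun_eq_iff)
    qed
    have "nrm (\<lambda>z. T (Suc (Suc n)) f z - T (Suc n) f z) = 1/2 * nrm (\<lambda>z. ?u z + ?v z)"
      using nrm_scale[OF add_mem[OF T_mem[OF d, of "Suc n"] diff_mem[OF T_mem T_mem, OF T_mem T_mem, OF f f,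
            of "Suc n" n n n]], of "1/2"]
      by (simp only: split) simp
    also have "\<dots> \<le> 1/2 * (nrm ?u + nrm ?v)"
      using uv by simp
    also have "\<dots> \<le> 1/2 * (y (Suc n) * ((y (Suc n) - y n) * nrm f) + (y (Suc n) - y n) * (y n * nrm f))"
      by (intro mult_left_mono add_mono u v) simp
    also have "\<dots> = ((y (Suc n))\<^sup>2 - (y n)\<^sup>2) / 2 * nrm f"
      by (simp add: power2_eq_square algebra_simps)
    also have "\<dots> = (y (Suc (Suc n)) - y (Suc n)) * nrm f"
      by (simp add: y_simps(2)[of "Suc n"] y_simps(2)[of n] diff_divide_distrib add_divide_distrib)
    finally show ?case .
  qed
  have T_cauchy: "nrm (\<lambda>z. T m f z - T n f z) \<le> (L - y n) * nrm f" if f: "f \<in> H" and "n \<le> m" for m n f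
  proof -
    have "nrm (\<lambda>z. T m f z - T n f z) \<le> (y m - y n) * nrm f"
      using \<open>n \<le> m\<close>
    proof (induction m rule: dec_induct)
      case base
      then show ?case by (simp add: nrm_zero)
    next
      case (step m)
      then show ?case
        using T_step[OF f, of m] nrm_triangle_diff[of "T (Suc m) f" "T m f" "T n f"] T_mem[OF f]
        by (simp add: algebra_simps)
    qed
    also have "\<dots> \<le> (L - y n) * nrm f"
      using L(2)[of m] nrm_nonneg[OF f] by (intro mult_right_mono) auto
    finally show ?thesis .
  qed
  have lim0: "(\<lambda>n. (L - y n) * c) \<longlonglongrightarrow> 0" for c
    using tendsto_mult_left_zero[OF tendsto_diff[OF tendsto_const[of L] L(1), simplified]] by simp
  have "\<exists>g. converges_to (\<lambda>n. T n f) g \<and> (\<forall>n. nrm (\<lambda>z. g z - T n f z) \<le> (L - y n) * nrm f)"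
    if f: "f \<in> H" for f
    using cauchy_converges[OF T_mem[OF f] T_cauchy[OF f] lim0] by metis
  then obtain Y where Y: "\<And>f. f \<in> H \<Longrightarrow> converges_to (\<lambda>n. T n f) (Y f)"
    and Y_close: "\<And>f n. f \<in> H \<Longrightarrow> nrm (\<lambda>z. Y f z - T n f z) \<le> (L - y n) * nrm f"
    by metis
  have Y_mem: "Y f \<in> H" if "f \<in> H" for f
    using Y[OF that] by (simp add: converges_to_def)
  show thesis
  proof (rule that)
    show "Y (\<lambda>z. a * f z + b * g z) = (\<lambda>z. a * Y f z + b * Y g z)" if "f \<in> H" "g \<in> H" for f g a b
    proof (rule converges_to_unique)
      show "converges_to (\<lambda>n. T n (\<lambda>z. a * f z + b * g z)) (Y (\<lambda>z. a * f z + b * g z))"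
        using that by (intro Y lincomb_mem)
      show "converges_to (\<lambda>n. T n (\<lambda>z. a * f z + b * g z)) (\<lambda>z. a * Y f z + b * Y g z)"
        using converges_to_lincomb[OF Y Y, of f g a b] that by (simp add: T_lin)
    qed
    show "nrm (Y f) \<le> nrm f" if f: "f \<in> H" for f
    proof -
      have "nrm (\<lambda>z. T n f z - 0) \<le> nrm f" for n
        using T_norm[OF f, of n] y_bounds[of n] nrm_nonneg[OF f]
          mult_right_mono[of "y n" 1 "nrm f"] by simp
      then show ?thesis
        using converges_to_nrm_le[OF Y[OF f] zero_mem, of "nrm f"] by simp
    qed
    show "ip (Y f) g = ip f (Y g)" if fg: "f \<in> H" "g \<in> H" for f g
    proof -
      have "(\<lambda>n. cnj (ip (T n g) f)) \<longlonglongrightarrow> cnj (ip (Y g) f)"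
        by (intro tendsto_cnj converges_to_ip Y fg)
      moreover have "cnj (ip (T n g) f) = ip (T n f) g" for n
        using ip_commute[OF T_mem[OF fg(2)] fg(1)] T_sym[OF fg] by simp
      moreover have "cnj (ip (Y g) f) = ip f (Y g)"
        using ip_commute[OF Y_mem[OF fg(2)] fg(1)] by simp
      ultimately show ?thesis
        using LIMSEQ_unique converges_to_ip[OF Y[OF fg(1)] fg(2)] by fastforce
    qed
    show "Y f = (\<lambda>z. 1/2 * X f z + 1/2 * Y (Y f) z)" if f: "f \<in> H" for f
    proof -
      have YY: "converges_to (\<lambda>n. T n (T n f)) (Y (Y f))"
      proof (rule converges_toI_bound)
        fix n
        have "nrm (\<lambda>z. T n (T n f) z - T n (Y f) z) \<le> (L - y n) * nrm f"
        proof -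
          have "nrm (\<lambda>z. T n (T n f) z - T n (Y f) z) = nrm (T n (\<lambda>z. T n f z - Y f z))"
            by (simp add: T_diff T_mem Y_mem f)
          also have "\<dots> \<le> y n * nrm (\<lambda>z. T n f z - Y f z)"
            by (intro T_norm diff_mem T_mem Y_mem f)
          also have "\<dots> \<le> 1 * nrm (\<lambda>z. T n f z - Y f z)"
            using y_bounds[of n] by (intro mult_right_mono nrm_nonneg diff_mem T_mem Y_mem f) auto
          also have "\<dots> = nrm (\<lambda>z. Y f z - T n f z)"
            using nrm_diff_commute[OF T_mem[OF f] Y_mem[OF f]] by simp
          finally show ?thesis using Y_close[OF f, of n] by simp
        qed
        moreover have "nrm (\<lambda>z. T n (Y f) z - Y (Y f) z) \<le> (L - y n) * nrm (Y f)"
          using Y_close[OF Y_mem[OF f], of n] nrm_diff_commute[OF T_mem Y_mem, OF Y_mem[OF f] Y_mem[OF f], of n]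
          by simp
        ultimately show "nrm (\<lambda>z. T n (T n f) z - Y (Y f) z) \<le> (L - y n) * (nrm f + nrm (Y f))"
          using nrm_triangle_diff[OF T_mem[OF T_mem[OF f]] T_mem[OF Y_mem[OF f]] Y_mem[OF Y_mem[OF f]], of n n n]
          by (simp add: distrib_left)
      next
        show "(\<lambda>n. (L - y n) * (nrm f + nrm (Y f))) \<longlonglongrightarrow> 0"
          by (rule lim0)
      qed (simp_all add: T_mem Y_mem f)
      have const: "converges_to (\<lambda>n. X f) (X f)"
        by (simp add: converges_to_def X_mem f nrm_zero)
      have "converges_to (\<lambda>n. T (Suc n) f) (\<lambda>z. 1/2 * X f z + 1/2 * Y (Y f) z)"
        using converges_to_lincomb[OF const YY, of "1/2" "1/2"] unfolding T_simps .
      note lim = this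
      have "converges_to (\<lambda>n. T (Suc n) f) (Y f)"
        using Y[OF f] LIMSEQ_Suc[of "\<lambda>n. nrm (\<lambda>z. T n f z - Y f z)" 0] T_mem[OF f]
        by (simp add: converges_to_def)
      then show ?thesis
        using lim by (rule converges_to_unique)
    qed
  qed (fact Y_mem)
qed

lemma positive_sqrt_exists:
  assumes X_mem: "\<And>f. f \<in> H \<Longrightarrow> X f \<in> H"
    and X_lin: "\<And>f g a b. f \<in> H \<Longrightarrow> g \<in> H \<Longrightarrow>
          X (\<lambda>z. a * f z + b * g z) = (\<lambda>z. a * X f z + b * X g z)"
    and X_contr: "\<And>f. f \<in> H \<Longrightarrow> nrm (X f) \<le> nrm f"
    and X_sym: "\<And>f g. f \<in> H \<Longrightarrow> g \<in> H \<Longrightarrow> ip (X f) g = ip f (X g)"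
  obtains B where "\<And>f. f \<in> H \<Longrightarrow> B f \<in> H"
    "\<And>f g a b. f \<in> H \<Longrightarrow> g \<in> H \<Longrightarrow>
       B (\<lambda>z. a * f z + b * g z) = (\<lambda>z. a * B f z + b * B g z)"
    "\<And>f. f \<in> H \<Longrightarrow> nrm (B f) \<le> 2 * nrm f"
    "\<And>f. f \<in> H \<Longrightarrow> ip (B f) f \<in> \<real>\<^sub>\<ge>\<^sub>0"
    "\<And>f. f \<in> H \<Longrightarrow> B (B f) = (\<lambda>z. f z - X f z)"
proof (rule contraction_fixed_point[OF assms])
  fix Y
  assume Y_mem: "\<And>f. f \<in> H \<Longrightarrow> Y f \<in> H"
    and Y_lin: "\<And>f g a b. f \<in> H \<Longrightarrow> g \<in> H \<Longrightarrow>
       Y (\<lambda>z. a * f z + b * g z) = (\<lambda>z. a * Y f z + b * Y g z)"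
    and Y_contr: "\<And>f. f \<in> H \<Longrightarrow> nrm (Y f) \<le> nrm f"
    and Y_sym: "\<And>f g. f \<in> H \<Longrightarrow> g \<in> H \<Longrightarrow> ip (Y f) g = ip f (Y g)"
    and Y_fix: "\<And>f. f \<in> H \<Longrightarrow> Y f = (\<lambda>z. 1/2 * X f z + 1/2 * Y (Y f) z)"
  define B where "B f = (\<lambda>z. f z - Y f z)" for f
  show thesis
  proof (rule that[of B])
    show "B f \<in> H" if "f \<in> H" for f
      using that by (simp add: B_def diff_mem Y_mem)
    show "B (\<lambda>z. a * f z + b * g z) = (\<lambda>z. a * B f z + b * B g z)" if "f \<in> H" "g \<in> H" for f g a b
      using that by (simp add: B_def Y_lin fun_eq_iff algebra_simps)
    show "nrm (B f) \<le> 2 * nrm f" if "f \<in> H" for f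
      using nrm_diff_le[OF that Y_mem[OF that]] Y_contr[OF that] by (simp add: B_def)
    show "ip (B f) f \<in> \<real>\<^sub>\<ge>\<^sub>0" if f: "f \<in> H" for f
    proof -
      have "ip (Y f) f = cnj (ip (Y f) f)"
        by (rule trans[OF Y_sym[OF f f] ip_commute[OF Y_mem[OF f] f]])
      then have "Im (ip (Y f) f) = 0"
        by (metis cnj.simps(2) equal_neg_zero)
      moreover have "Re (ip (Y f) f) \<le> nrm f * nrm f"
      proof -
        have "Re (ip (Y f) f) \<le> nrm (Y f) * nrm f"
          using cauchy_schwarz[OF Y_mem[OF f] f] complex_Re_le_cmod order_trans by blast
        also have "\<dots> \<le> nrm f * nrm f"
          using Y_contr[OF f] nrm_nonneg[OF f] by (rule mult_right_mono)
        finally show ?thesis .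
      qed
      moreover have "ip (B f) f = of_real ((nrm f)\<^sup>2) - ip (Y f) f"
        unfolding B_def by (simp add: ip_diff Y_mem f ip_self)
      ultimately show ?thesis
        by (simp add: complex_nonneg_Reals_iff power2_eq_square)
    qed
    show "B (B f) = (\<lambda>z. f z - X f z)" if f: "f \<in> H" for f
    proof -
      have "Y (\<lambda>z. f z - Y f z) = (\<lambda>z. Y f z - Y (Y f) z)"
        using Y_lin[OF f Y_mem[OF f], of 1 "-1"] by simp
      moreover have "X f z = 2 * Y f z - Y (Y f) z" for z
        using fun_cong[OF Y_fix[OF f], of z] by (simp add: field_simps)
      ultimately show ?thesis
        by (simp add: B_def) (simp add: algebra_simps)
    qed
  qed
qed

lemma eq_if_ip_eq:
  assumes "f \<in> H" "g \<in> H" "\<And>h. h \<in> H \<Longrightarrow> ip h f = ip h g"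
  shows "f = g"
proof -
  have d: "(\<lambda>z. f z - g z) \<in> H" using assms by (intro diff_mem)
  have "ip (\<lambda>z. f z - g z) (\<lambda>z. f z - g z) = 0"
    using ip_diff_right[OF assms(1,2) d] assms(3)[OF d] by simp
  then have "nrm (\<lambda>z. f z - g z) = 0"
    using ip_self[OF d] by simp
  from nrm_eq_0D[OF d this] show ?thesis by (simp add: fun_eq_iff)
qed

subsection \<open>The defect operator of a contraction\<close>

lemma adjoint_exists_unique:
  assumes T_mem: "\<And>f. f \<in> H \<Longrightarrow> T f \<in> H"
    and T_lin: "\<And>f g a b. f \<in> H \<Longrightarrow> g \<in> H \<Longrightarrow>
          T (\<lambda>z. a * f z + b * g z) = (\<lambda>z. a * T f z + b * T g z)"
    and T_contr: "\<And>f. f \<in> H \<Longrightarrow> nrm (T f) \<le> nrm f"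
    and f: "f \<in> H"
  shows "\<exists>!g. g \<in> H \<and> (\<forall>h\<in>H. ip (T h) f = ip h g)"
proof -
  obtain g where g: "g \<in> H" "\<And>h. h \<in> H \<Longrightarrow> ip (T h) f = ip h g"
  proof (rule riesz_representation[of "\<lambda>h. ip (T h) f" "nrm f"])
    show "ip (T (\<lambda>z. a * u z + b * v z)) f = a * ip (T u) f + b * ip (T v) f"
      if "u \<in> H" "v \<in> H" for u v a b
      unfolding T_lin[OF that] by (intro ip_lincomb T_mem that f)
    show "cmod (ip (T u) f) \<le> nrm f * nrm u" if u: "u \<in> H" for u
    proof -
      have "cmod (ip (T u) f) \<le> nrm (T u) * nrm f" by (intro cauchy_schwarz T_mem u f)
      also have "\<dots> \<le> nrm u * nrm f" by (intro mult_right_mono T_contr u nrm_nonneg f)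
      finally show ?thesis by (simp add: mult.commute)
    qed
  qed blast
  show ?thesis
  proof (rule ex1I[of _ g])
    show "g \<in> H \<and> (\<forall>h\<in>H. ip (T h) f = ip h g)" using g by blast
    fix g' assume g': "g' \<in> H \<and> (\<forall>h\<in>H. ip (T h) f = ip h g')"
    show "g' = g"
      by (rule eq_if_ip_eq) (use g g' in auto)
  qed
qed

text \<open>
  For a contraction \<open>T\<close>, the operator \<open>T T\<^sup>*\<close> is a self-adjoint contraction, so \<open>I - T T\<^sup>*\<close> has a
  positive square root. The adjoint is described by the same definite description that defines
  \<^const>\<open>bergman_adjoint\<close>.
\<close>

lemma defect_sqrt_exists:
  assumes T_mem: "\<And>f. f \<in> H \<Longrightarrow> T f \<in> H"
    and T_lin: "\<And>f g a b. f \<in> H \<Longrightarrow> g \<in> H \<Longrightarrow>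
          T (\<lambda>z. a * f z + b * g z) = (\<lambda>z. a * T f z + b * T g z)"
    and T_contr: "\<And>f. f \<in> H \<Longrightarrow> nrm (T f) \<le> nrm f"
    and adj: "\<And>f. adj f = (THE g. g \<in> H \<and> (\<forall>h\<in>H. ip (T h) f = ip h g))"
  shows "\<exists>B. (\<forall>f\<in>H. B f \<in> H) \<and>
    (\<forall>f\<in>H. \<forall>g\<in>H. \<forall>a b. B (\<lambda>z. a * f z + b * g z) = (\<lambda>z. a * B f z + b * B g z)) \<and>
    (\<forall>f\<in>H. nrm (B f) \<le> 2 * nrm f) \<and> (\<forall>f\<in>H. ip (B f) f \<in> \<real>\<^sub>\<ge>\<^sub>0) \<and>
    (\<forall>f\<in>H. B (B f) = (\<lambda>z. f z - T (adj f) z))"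
proof -
  have ex: "adj f \<in> H \<and> (\<forall>h\<in>H. ip (T h) f = ip h (adj f))" if "f \<in> H" for f
    unfolding adj by (rule theI'[OF adjoint_exists_unique[OF T_mem T_lin T_contr that]])
  have adj_mem: "adj f \<in> H" if "f \<in> H" for f using ex[OF that] by blast
  have adj_ip: "ip (T h) f = ip h (adj f)" if "f \<in> H" "h \<in> H" for f h using ex that by blast
  have adj_lin: "adj (\<lambda>z. a * f z + b * g z) = (\<lambda>z. a * adj f z + b * adj g z)"
    if fg: "f \<in> H" "g \<in> H" for f g a b
  proof (rule eq_if_ip_eq)
    show "adj (\<lambda>z. a * f z + b * g z) \<in> H" by (intro adj_mem lincomb_mem fg)
    show "(\<lambda>z. a * adj f z + b * adj g z) \<in> H" by (intro adj_mem lincomb_mem fg)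
    fix h assume h: "h \<in> H"
    have "ip h (adj (\<lambda>z. a * f z + b * g z)) = ip (T h) (\<lambda>z. a * f z + b * g z)"
      by (rule adj_ip[symmetric, OF lincomb_mem[OF fg] h])
    also have "\<dots> = cnj a * ip (T h) f + cnj b * ip (T h) g"
      by (simp only: ip_add_right ip_scale_right scale_mem T_mem fg h)
    also have "\<dots> = cnj a * ip h (adj f) + cnj b * ip h (adj g)"
      by (simp only: adj_ip fg h)
    also have "\<dots> = ip h (\<lambda>z. a * adj f z + b * adj g z)"
      by (simp only: ip_add_right ip_scale_right scale_mem adj_mem fg h)
    finally show "ip h (adj (\<lambda>z. a * f z + b * g z)) = ip h (\<lambda>z. a * adj f z + b * adj g z)" .
  qed
  have adj_contr: "nrm (adj f) \<le> nrm f" if f: "f \<in> H" for f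
  proof -
    have "(nrm (adj f))\<^sup>2 = cmod (ip (adj f) (adj f))"
      by (simp add: ip_self adj_mem f norm_power)
    also have "\<dots> = cmod (ip (T (adj f)) f)"
      by (simp only: adj_ip[OF f adj_mem[OF f]])
    also have "\<dots> \<le> nrm (T (adj f)) * nrm f"
      by (intro cauchy_schwarz T_mem adj_mem f)
    also have "\<dots> \<le> nrm (adj f) * nrm f"
      by (intro mult_right_mono T_contr adj_mem f nrm_nonneg)
    finally have "nrm (adj f) * nrm (adj f) \<le> nrm (adj f) * nrm f"
      by (simp add: power2_eq_square)
    then show ?thesis
      using nrm_nonneg[OF adj_mem[OF f]] nrm_nonneg[OF f] by (cases "nrm (adj f) = 0") auto
  qed
  have sym: "ip (T (adj f)) g = ip f (T (adj g))" if fg: "f \<in> H" "g \<in> H" for f g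
  proof -
    have "ip (T (adj f)) g = ip (adj f) (adj g)" by (intro adj_ip adj_mem fg)
    also have "\<dots> = cnj (ip (adj g) (adj f))" by (intro ip_commute adj_mem fg)
    also have "\<dots> = cnj (ip (T (adj g)) f)" by (simp only: adj_ip[OF fg(1) adj_mem[OF fg(2)]])
    also have "\<dots> = ip f (T (adj g))" by (intro ip_commute[symmetric] T_mem adj_mem fg)
    finally show ?thesis .
  qed
  show ?thesis
  proof (rule positive_sqrt_exists[of "\<lambda>f. T (adj f)"])
    show "T (adj f) \<in> H" if "f \<in> H" for f by (intro T_mem adj_mem that)
    show "T (adj (\<lambda>z. a * f z + b * g z)) = (\<lambda>z. a * T (adj f) z + b * T (adj g) z)"
      if "f \<in> H" "g \<in> H" for f g a b
      by (simp only: adj_lin that T_lin adj_mem)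
    show "nrm (T (adj f)) \<le> nrm f" if "f \<in> H" for f
      using T_contr[OF adj_mem[OF that]] adj_contr[OF that] by simp
  next
    fix B
    assume "\<And>f. f \<in> H \<Longrightarrow> B f \<in> H"
      "\<And>f g a b. f \<in> H \<Longrightarrow> g \<in> H \<Longrightarrow> B (\<lambda>z. a * f z + b * g z) = (\<lambda>z. a * B f z + b * B g z)"
      "\<And>f. f \<in> H \<Longrightarrow> nrm (B f) \<le> 2 * nrm f" "\<And>f. f \<in> H \<Longrightarrow> ip (B f) f \<in> \<real>\<^sub>\<ge>\<^sub>0"
      "\<And>f. f \<in> H \<Longrightarrow> B (B f) = (\<lambda>z. f z - T (adj f) z)"
    then show ?thesis by (intro exI[of _ B] conjI ballI allI)
  qed (rule sym)
qed

subsection \<open>The range of a bounded operator\<close>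

text \<open>
  Subtracting from \<open>x\<close> its projection to the kernel of \<open>B\<close> does not change \<open>B x\<close>. This makes the
  inverse in the definition of \<^const>\<open>sub_bergman_inner\<close> meaningful.
\<close>

lemma range_attained_on_kernel_complement:
  assumes B_mem: "\<And>f. f \<in> H \<Longrightarrow> B f \<in> H"
    and B_lin: "\<And>f g a b. f \<in> H \<Longrightarrow> g \<in> H \<Longrightarrow>
          B (\<lambda>z. a * f z + b * g z) = (\<lambda>z. a * B f z + b * B g z)"
    and B_bound: "\<And>f. f \<in> H \<Longrightarrow> nrm (B f) \<le> C * nrm f"
    and x: "x \<in> H"
  shows "\<exists>y\<in>H. (\<forall>h\<in>H. B h = (\<lambda>z. 0) \<longrightarrow> ip y h = 0) \<and> B y = B x"
proof -
  define M where "M = {h \<in> H. B h = (\<lambda>z. 0)}"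
  have B_diff: "B (\<lambda>z. f z - g z) = (\<lambda>z. B f z - B g z)" if "f \<in> H" "g \<in> H" for f g
    using B_lin[OF that, of 1 "-1"] by simp
  have "B (\<lambda>z. 0) = (\<lambda>z. 0)"
    using B_lin[OF zero_mem zero_mem, of 0 0] by simp
  then have M: "M \<subseteq> H" "(\<lambda>z. 0) \<in> M" using zero_mem by (auto simp: M_def)
  obtain m where m: "m \<in> M" "\<And>h. h \<in> M \<Longrightarrow> ip (\<lambda>z. x z - m z) h = 0"
  proof (rule orthogonal_projection[OF M _ _ x])
    show "(\<lambda>z. a * f z + b * g z) \<in> M" if "f \<in> M" "g \<in> M" for f g a b
      using that by (simp add: M_def lincomb_mem B_lin)
    show "g \<in> M" if s: "\<And>n. s n \<in> M" and g: "converges_to s g" for s g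
    proof -
      have gH: "g \<in> H" using g by (simp add: converges_to_def)
      have le: "nrm (B g) \<le> C * nrm (\<lambda>z. s n z - g z)" for n
      proof -
        have s': "s n \<in> H" "B (s n) = (\<lambda>z. 0)" using s[of n] by (auto simp: M_def)
        have "nrm (B g) = nrm (\<lambda>z. B (s n) z - B g z)"
          using nrm_scale[OF B_mem[OF gH], of "-1"] by (simp add: s'(2))
        also have "\<dots> = nrm (B (\<lambda>z. s n z - g z))" by (simp only: B_diff s' gH)
        also have "\<dots> \<le> C * nrm (\<lambda>z. s n z - g z)" by (intro B_bound diff_mem s' gH)
        finally show ?thesis .
      qed
      have "(\<lambda>n. C * nrm (\<lambda>z. s n z - g z)) \<longlonglongrightarrow> 0"
        using g tendsto_mult_right_zero by (auto simp: converges_to_def)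
      then have "nrm (B g) \<le> 0"
        by (rule LIMSEQ_le_const) (use le in blast)
      then have "nrm (B g) = 0" using nrm_nonneg[OF B_mem[OF gH]] by simp
      then show ?thesis using nrm_eq_0D[OF B_mem[OF gH]] gH by (simp add: M_def)
    qed
  qed (rule that)
  have mH: "m \<in> H" "B m = (\<lambda>z. 0)" using m by (auto simp: M_def)
  show ?thesis
  proof (intro bexI[of _ "\<lambda>z. x z - m z"] conjI ballI impI)
    show "ip (\<lambda>z. x z - m z) h = 0" if "h \<in> H" "B h = (\<lambda>z. 0)" for h
      using m(2) that by (simp add: M_def)
    show "B (\<lambda>z. x z - m z) = B x" by (simp add: B_diff x mH)
    show "(\<lambda>z. x z - m z) \<in> H" by (intro diff_mem x mH)
  qed
qed

text \<open>
  The uniform boundedness principle is applied to the functionals \<open>L w\<close>, which are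
  \<open>x \<mapsto> \<gamma> w \<cdot> (B x) w\<close> divided by the norm \<open>N w\<close> of \<open>x \<mapsto> (B x) w\<close>, and which have norm \<open>\<bar>\<gamma> w\<bar>\<close>. They
  are bounded at each \<open>x\<close>: if \<open>\<gamma> \<cdot> B x = B y\<close>, then the values at \<open>x\<close> are at most the norm of \<open>y\<close>.
\<close>

lemma multiplier_of_range_bounded:
  assumes B_mem: "\<And>f. f \<in> H \<Longrightarrow> B f \<in> H"
    and B_lin: "\<And>f g a b. f \<in> H \<Longrightarrow> g \<in> H \<Longrightarrow>
          B (\<lambda>z. a * f z + b * g z) = (\<lambda>z. a * B f z + b * B g z)"
    and B_bound: "\<And>f. f \<in> H \<Longrightarrow> nrm (B f) \<le> C * nrm f"
    and mult: "\<And>f. f \<in> B ` H \<Longrightarrow> (\<lambda>z. \<gamma> z * f z) \<in> B ` H"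
  shows "\<exists>K. \<forall>w. (\<exists>f\<in>B ` H. f w \<noteq> 0) \<longrightarrow> cmod (\<gamma> w) \<le> K"
proof -
  define W where "W = {w. \<exists>f\<in>B ` H. f w \<noteq> 0}"
  define N where "N w = (SUP x\<in>{x \<in> H. nrm x \<le> 1}. cmod (B x w))" for w
  have ball: "(\<lambda>z. 0) \<in> {x \<in> H. nrm x \<le> 1}" using zero_mem nrm_zero by simp
  have bdd: "bdd_above ((\<lambda>x. cmod (B x w)) ` {x \<in> H. nrm x \<le> 1})" for w
  proof -
    obtain E where E: "\<And>f. f \<in> H \<Longrightarrow> cmod (f w) \<le> E * nrm f"
      using evaluation_bounded by blast
    have "cmod (B x w) \<le> \<bar>E\<bar> * (\<bar>C\<bar> * 1)" if "x \<in> H" "nrm x \<le> 1" for x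
    proof -
      have "cmod (B x w) \<le> E * nrm (B x)" by (intro E B_mem that)
      also have "\<dots> \<le> \<bar>E\<bar> * nrm (B x)" by (intro mult_right_mono nrm_nonneg B_mem that) simp
      also have "nrm (B x) \<le> C * nrm x" by (intro B_bound that)
      also have "C * nrm x \<le> \<bar>C\<bar> * nrm x" by (intro mult_right_mono nrm_nonneg that) simp
      also have "\<bar>C\<bar> * nrm x \<le> \<bar>C\<bar> * 1" by (intro mult_left_mono that) simp
      finally show ?thesis by (simp add: mult_left_mono)
    qed
    then show ?thesis by (intro bdd_aboveI2) auto
  qed
  have unit_le: "cmod (B x w) \<le> N w" if "x \<in> H" "nrm x \<le> 1" for x w
    unfolding N_def using that bdd by (intro cSUP_upper) auto
  have B_scale: "B (\<lambda>z. c * f z) = (\<lambda>z. c * B f z)" if "f \<in> H" for c f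
    using B_lin[OF that that, of c 0] by simp
  have le: "cmod (B x w) \<le> N w * nrm x" if x: "x \<in> H" for x w
  proof (cases "nrm x = 0")
    case True
    then have "nrm (B x) = 0"
      using B_bound[OF x] nrm_nonneg[OF B_mem[OF x]] by simp
    then have "B x = (\<lambda>z. 0)" by (rule nrm_eq_0D[OF B_mem[OF x]])
    then show ?thesis using True by simp
  next
    case False
    then have n: "0 < nrm x" using nrm_nonneg[OF x] by simp
    have "nrm (\<lambda>z. of_real (1 / nrm x) * x z) = 1"
      using n nrm_scale[OF x, of "of_real (1 / nrm x)"] by (simp add: norm_divide)
    then have "cmod (B (\<lambda>z. of_real (1 / nrm x) * x z) w) \<le> N w"
      by (intro unit_le scale_mem x) simp
    then show ?thesis
      using n unfolding B_scale[OF x] by (simp add: norm_mult norm_divide field_simps)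
  qed
  have N_pos: "0 < N w" if w: "w \<in> W" for w
  proof -
    obtain x where x: "x \<in> H" "B x w \<noteq> 0" using w by (auto simp: W_def)
    then have "0 < N w * nrm x" using le[OF x(1), of w] by (metis less_le_trans zero_less_norm_iff)
    then show ?thesis using nrm_nonneg[OF x(1)] by (simp add: zero_less_mult_iff)
  qed
  define L where "L w x = \<gamma> w * B x w / of_real (N w)" for w x
  have "\<exists>K. \<forall>w\<in>W. \<forall>x\<in>H. cmod (L w x) \<le> K * nrm x"
  proof (rule uniform_boundedness)
    show "L w (\<lambda>z. a * f z + b * g z) = a * L w f + b * L w g" if "f \<in> H" "g \<in> H" for w f g a b
      unfolding L_def B_lin[OF that] by (simp add: algebra_simps add_divide_distrib)
    show "\<exists>K. \<forall>x\<in>H. cmod (L w x) \<le> K * nrm x" if w: "w \<in> W" for w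
    proof (intro exI ballI)
      fix x assume x: "x \<in> H"
      have "cmod (L w x) = cmod (\<gamma> w) * (cmod (B x w) / N w)"
        using N_pos[OF w] by (simp add: L_def norm_mult norm_divide)
      also have "\<dots> \<le> cmod (\<gamma> w) * nrm x"
        using le[OF x, of w] N_pos[OF w] by (intro mult_left_mono) (auto simp: field_simps)
      finally show "cmod (L w x) \<le> cmod (\<gamma> w) * nrm x" .
    qed
    show "\<exists>K. \<forall>w\<in>W. cmod (L w x) \<le> K" if x: "x \<in> H" for x
    proof -
      obtain y where y: "y \<in> H" "(\<lambda>z. \<gamma> z * B x z) = B y" using mult[of "B x"] x by auto
      have "cmod (L w x) \<le> nrm y" if w: "w \<in> W" for w
      proof -
        have "\<gamma> w * B x w = B y w" using fun_cong[OF y(2)] .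
        then have "cmod (L w x) = cmod (B y w) / N w"
          using N_pos[OF w] by (simp add: L_def norm_divide)
        then show ?thesis
          using le[OF y(1), of w] N_pos[OF w] by (simp add: pos_divide_le_eq mult.commute)
      qed
      then show ?thesis by blast
    qed
  qed
  then obtain K where K: "\<And>w x. w \<in> W \<Longrightarrow> x \<in> H \<Longrightarrow> cmod (L w x) \<le> K * nrm x" by blast
  have "cmod (\<gamma> w) \<le> \<bar>K\<bar>" if w: "w \<in> W" for w
  proof (cases "\<gamma> w = 0")
    case False
    have "N w \<le> \<bar>K\<bar> * N w / cmod (\<gamma> w)"
    proof -
      have "cmod (B x w) \<le> \<bar>K\<bar> * N w / cmod (\<gamma> w)" if x: "x \<in> {x \<in> H. nrm x \<le> 1}" for x
      proof -
        have "cmod (\<gamma> w) * cmod (B x w) / N w \<le> K * nrm x"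
          using K[OF w, of x] x N_pos[OF w] by (simp add: L_def norm_mult norm_divide)
        also have "\<dots> \<le> \<bar>K\<bar> * 1"
          using x nrm_nonneg[of x] by (intro mult_mono) auto
        finally show ?thesis
          using False N_pos[OF w] by (simp add: field_simps)
      qed
      then have "(SUP x\<in>{x \<in> H. nrm x \<le> 1}. cmod (B x w)) \<le> \<bar>K\<bar> * N w / cmod (\<gamma> w)"
        using ball by (intro cSUP_least) auto
      then show ?thesis by (simp only: N_def)
    qed
    then show ?thesis
      using False N_pos[OF w] by (simp add: field_simps)
  qed simp
  then show ?thesis unfolding W_def by blast
qed

end

section \<open>The weighted Bergman space is a reproducing kernel Hilbert space\<close>

text \<open>
  The Cauchy formula for \<open>f\<^sup>2\<close> on the circle of radius \<open>2 R\<close> about \<open>c\<close>, whose points have distance at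
  least \<open>R\<close> from \<open>w\<close>. Circles about moving centres replace the concentric circles of the mean value
  property, since averaging over the centre then needs only translations.
\<close>

lemma circle_average_bound:
  assumes f: "f holomorphic_on cball w (3 * R)" and R: "0 < R" and c: "c \<in> ball w R"
  shows "ennreal ((cmod (f w))\<^sup>2)
    \<le> ennreal (1 / pi) * (\<integral>\<^sup>+t. indicator {0..2 * pi} t * ennreal ((cmod (f (c + of_real (2 * R) * cis t)))\<^sup>2) \<partial>lborel)"
proof -
  have sub: "cball c (2 * R) \<subseteq> cball w (3 * R)"
  proof
    fix z assume "z \<in> cball c (2 * R)"
    then show "z \<in> cball w (3 * R)"
      using c dist_triangle[of w z c] by simp
  qed
  have "(\<lambda>z. (f z)\<^sup>2) holomorphic_on cball c (2 * R)"
    by (intro holomorphic_intros holomorphic_on_subset[OF f sub])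
  then have "((\<lambda>u. (f u)\<^sup>2 / (u - w)) has_contour_integral (2 * of_real pi * \<i> * (f w)\<^sup>2)) (circlepath c (2 * R))"
    using c R by (intro Cauchy_integral_circlepath_simple) (auto simp: dist_norm)
  then have int: "((\<lambda>t. (f (c + of_real (2 * R) * cis t))\<^sup>2 / (c + of_real (2 * R) * cis t - w) * of_real (2 * R) * \<i> * cis t)
      has_integral (2 * of_real pi * \<i> * (f w)\<^sup>2)) {0..2 * pi}"
    unfolding circlepath_def by (subst (asm) has_contour_integral_part_circlepath_iff) auto
  define u where "u t = 2 * (cmod (f (c + of_real (2 * R) * cis t)))\<^sup>2" for t
  have circ: "c + of_real (2 * R) * cis t \<in> cball w (3 * R)" for t
    using sub R by (intro subsetD[OF sub]) (simp add: dist_norm norm_mult)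
  have u_cont: "continuous_on S u" for S
    unfolding u_def using circ
    by (intro continuous_intros continuous_on_compose2[OF holomorphic_on_imp_continuous_on[OF f]]) auto
  have u_int: "u integrable_on {0..2 * pi}"
    by (intro integrable_continuous_real u_cont)
  have "norm (integral {0..2 * pi} (\<lambda>t. (f (c + of_real (2 * R) * cis t))\<^sup>2 / (c + of_real (2 * R) * cis t - w) * of_real (2 * R) * \<i> * cis t))
      \<le> integral {0..2 * pi} u"
  proof (rule integral_norm_bound_integral)
    show "norm ((f (c + of_real (2 * R) * cis t))\<^sup>2 / (c + of_real (2 * R) * cis t - w) * of_real (2 * R) * \<i> * cis t) \<le> u t" for t
    proof -
      have "2 * R \<le> cmod (c + of_real (2 * R) * cis t - w) + cmod (w - c)"
        using norm_triangle_ineq[of "c + of_real (2 * R) * cis t - w" "w - c"] R by (simp add: norm_mult)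
      moreover have "cmod (w - c) < R" using c by (simp add: dist_norm)
      ultimately have d: "R \<le> cmod (c + of_real (2 * R) * cis t - w)" by linarith
      have "norm ((f (c + of_real (2 * R) * cis t))\<^sup>2 / (c + of_real (2 * R) * cis t - w) * of_real (2 * R) * \<i> * cis t)
          = (cmod (f (c + of_real (2 * R) * cis t)))\<^sup>2 * (2 * R) / cmod (c + of_real (2 * R) * cis t - w)"
        using R by (simp add: norm_mult norm_divide norm_power)
      also have "\<dots> \<le> (cmod (f (c + of_real (2 * R) * cis t)))\<^sup>2 * (2 * R) / R"
        using d R by (intro divide_left_mono mult_pos_pos) auto
      finally show ?thesis using R by (simp add: u_def mult.commute)
    qed
  qed (use int u_int in blast)+
  then have "2 * pi * (cmod (f w))\<^sup>2 \<le> integral {0..2 * pi} u"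
    unfolding integral_unique[OF int] by (simp add: norm_mult norm_power)
  then have "ennreal ((cmod (f w))\<^sup>2) \<le> ennreal (1 / (2 * pi) * integral {0..2 * pi} u)"
    by (intro ennreal_leI) (simp add: field_simps)
  also have "\<dots> = ennreal (1 / (2 * pi)) * ennreal (integral {0..2 * pi} u)"
    by (intro ennreal_mult integral_nonneg u_int) (auto simp: u_def)
  also have "ennreal (integral {0..2 * pi} u) = (\<integral>\<^sup>+t. ennreal (u t) * indicator {0..2 * pi} t \<partial>lborel)"
  proof (rule nn_integral_has_integral_lebesgue'[symmetric])
    show "(u has_integral integral {0..2 * pi} u) {0..2 * pi}"
      using u_int by blast
  qed (auto simp: u_def)
  also have "\<dots> = (\<integral>\<^sup>+t. ennreal 2 * (indicator {0..2 * pi} t * ennreal ((cmod (f (c + of_real (2 * R) * cis t)))\<^sup>2)) \<partial>lborel)"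
    by (intro nn_integral_cong) (auto simp: u_def indicator_def ennreal_mult)
  also have "\<dots> = ennreal 2 * (\<integral>\<^sup>+t. indicator {0..2 * pi} t * ennreal ((cmod (f (c + of_real (2 * R) * cis t)))\<^sup>2) \<partial>lborel)"
  proof (rule nn_integral_cmult)
    have "continuous_on UNIV (\<lambda>t. (cmod (f (c + of_real (2 * R) * cis t)))\<^sup>2)"
      using continuous_on_divide[OF u_cont[of UNIV] continuous_on_const, of 2] by (simp add: u_def)
    then have [measurable]: "(\<lambda>t. (cmod (f (c + of_real (2 * R) * cis t)))\<^sup>2) \<in> borel_measurable borel"
      by (rule borel_measurable_continuous_onI)
    show "(\<lambda>t. indicator {0..2 * pi} t * ennreal ((cmod (f (c + of_real (2 * R) * cis t)))\<^sup>2)) \<in> borel_measurable lborel"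
      by measurable
  qed
  finally have le: "ennreal ((cmod (f w))\<^sup>2) \<le> ennreal (1 / (2 * pi)) *
      (ennreal 2 * (\<integral>\<^sup>+t. indicator {0..2 * pi} t * ennreal ((cmod (f (c + of_real (2 * R) * cis t)))\<^sup>2) \<partial>lborel))" .
  have "ennreal (1 / (2 * pi)) * ennreal 2 = ennreal (1 / pi)"
    by (subst ennreal_mult[symmetric]) auto
  with le show ?thesis
    by (simp only: mult.assoc[symmetric])
qed

text \<open>
  Integrate the previous bound over all centres \<open>c\<close> in \<open>ball w R\<close> and exchange the integrals: for
  fixed \<open>t\<close>, the map \<open>c \<mapsto> c + 2 R cis t\<close> is a translation into \<open>cball w (3 R)\<close>.
\<close>

lemma area_average_bound:
  assumes f: "f holomorphic_on cball w (3 * R)" and R: "0 < R"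
    and F: "F \<in> borel_measurable borel" "\<And>z. z \<in> cball w (3 * R) \<Longrightarrow> F z = ennreal ((cmod (f z))\<^sup>2)"
  shows "emeasure lborel (ball w R) * ennreal ((cmod (f w))\<^sup>2) \<le> 2 * (\<integral>\<^sup>+z. F z \<partial>lborel)"
proof -
  note [measurable] = F(1)
  have [measurable]: "cis \<in> borel_measurable borel"
    by (intro borel_measurable_continuous_onI continuous_intros)
  have inball: "F (c + of_real (2 * R) * cis t) = ennreal ((cmod (f (c + of_real (2 * R) * cis t)))\<^sup>2)" if "c \<in> ball w R" for c t
  proof (rule F(2))
    show "c + of_real (2 * R) * cis t \<in> cball w (3 * R)"
      using that R norm_triangle_ineq[of "c - w" "of_real (2 * R) * cis t"]
      by (simp add: dist_norm norm_minus_commute norm_mult algebra_simps)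
  qed
  have "emeasure lborel (ball w R) * ennreal ((cmod (f w))\<^sup>2)
      = (\<integral>\<^sup>+c. ennreal ((cmod (f w))\<^sup>2) * indicator (ball w R) c \<partial>lborel)"
    by (subst nn_integral_cmult_indicator) (auto simp: mult.commute)
  also have "\<dots> \<le> (\<integral>\<^sup>+c. (\<integral>\<^sup>+t. ennreal (1 / pi) * (indicator (ball w R) c * (indicator {0..2 * pi} t * F (c + of_real (2 * R) * cis t))) \<partial>lborel) \<partial>lborel)"
  proof (rule nn_integral_mono)
    fix c
    show "ennreal ((cmod (f w))\<^sup>2) * indicator (ball w R) c
      \<le> (\<integral>\<^sup>+t. ennreal (1 / pi) * (indicator (ball w R) c * (indicator {0..2 * pi} t * F (c + of_real (2 * R) * cis t))) \<partial>lborel)"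
    proof (cases "c \<in> ball w R")
      case True
      have "(\<integral>\<^sup>+t. ennreal (1 / pi) * (indicator (ball w R) c * (indicator {0..2 * pi} t * F (c + of_real (2 * R) * cis t))) \<partial>lborel)
          = ennreal (1 / pi) * (\<integral>\<^sup>+t. indicator (ball w R) c * (indicator {0..2 * pi} t * F (c + of_real (2 * R) * cis t)) \<partial>lborel)"
        by (rule nn_integral_cmult) measurable
      moreover have "ennreal ((cmod (f w))\<^sup>2)
          \<le> ennreal (1 / pi) * (\<integral>\<^sup>+t. indicator {0..2 * pi} t * F (c + of_real (2 * R) * cis t) \<partial>lborel)"
        unfolding inball[OF True] by (rule circle_average_bound[OF f R True])
      ultimately show ?thesis
        using True by simp
    qed simp
  qed
  also have "\<dots> = (\<integral>\<^sup>+t. (\<integral>\<^sup>+c. ennreal (1 / pi) * (indicator (ball w R) c * (indicator {0..2 * pi} t * F (c + of_real (2 * R) * cis t))) \<partial>lborel) \<partial>lborel)"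
  proof (rule lborel_pair.Fubini')
    have [measurable]: "ball w R \<in> sets borel" by simp
    have [measurable]: "(\<lambda>x. F (snd x + of_real (2 * R) * cis (fst x))) \<in> borel_measurable (lborel \<Otimes>\<^sub>M lborel)"
      by (rule measurable_compose[OF _ F(1)]) measurable
    show "(\<lambda>(t, c). ennreal (1 / pi) * (indicator (ball w R) c * (indicator {0..2 * pi} t * F (c + of_real (2 * R) * cis t))))
        \<in> borel_measurable (lborel \<Otimes>\<^sub>M lborel)"
      by measurable
  qed
  also have "\<dots> \<le> (\<integral>\<^sup>+t. ennreal (1 / pi) * (\<integral>\<^sup>+z. F z \<partial>lborel) * indicator {0..2 * pi} t \<partial>lborel)"
  proof (rule nn_integral_mono)
    fix t :: real
    have "(\<integral>\<^sup>+c. ennreal (1 / pi) * (indicator (ball w R) c * (indicator {0..2 * pi} t * F (c + of_real (2 * R) * cis t))) \<partial>lborel)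
        \<le> (\<integral>\<^sup>+c. ennreal (1 / pi) * indicator {0..2 * pi} t * F (of_real (2 * R) * cis t + c) \<partial>lborel)"
      by (intro nn_integral_mono) (auto simp: indicator_def add.commute)
    also have "\<dots> = ennreal (1 / pi) * indicator {0..2 * pi} t * (\<integral>\<^sup>+c. F (of_real (2 * R) * cis t + c) \<partial>lborel)"
      by (rule nn_integral_cmult) measurable
    also have "(\<integral>\<^sup>+c. F (of_real (2 * R) * cis t + c) \<partial>lborel) = (\<integral>\<^sup>+z. F z \<partial>distr lborel borel ((+) (of_real (2 * R) * cis t)))"
      by (rule nn_integral_distr[symmetric]) measurable
    also have "\<dots> = (\<integral>\<^sup>+z. F z \<partial>lborel)" by (simp only: lborel_distr_plus)
    finally show "(\<integral>\<^sup>+c. ennreal (1 / pi) * (indicator (ball w R) c * (indicator {0..2 * pi} t * F (c + of_real (2 * R) * cis t))) \<partial>lborel)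
        \<le> ennreal (1 / pi) * (\<integral>\<^sup>+z. F z \<partial>lborel) * indicator {0..2 * pi} t"
      by (simp only: mult.assoc mult.commute[of "indicator {0..2 * pi} t" "\<integral>\<^sup>+z. F z \<partial>lborel"])
  qed
  also have "\<dots> = ennreal (1 / pi) * (\<integral>\<^sup>+z. F z \<partial>lborel) * ennreal (2 * pi)"
    by (subst nn_integral_cmult_indicator) auto
  also have "\<dots> = 2 * (\<integral>\<^sup>+z. F z \<partial>lborel)"
  proof -
    have "ennreal (1 / pi) * ennreal (2 * pi) = 2"
      by (simp add: ennreal_mult[symmetric])
    moreover have "ennreal (1 / pi) * (\<integral>\<^sup>+z. F z \<partial>lborel) * ennreal (2 * pi)
        = ennreal (1 / pi) * ennreal (2 * pi) * (\<integral>\<^sup>+z. F z \<partial>lborel)"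
      by (simp only: ac_simps)
    ultimately show ?thesis by (simp only:)
  qed
  finally show ?thesis .
qed

lemma bergman_measurable:
  assumes "f \<in> bergman \<alpha>"
  shows "f \<in> borel_measurable borel"
proof -
  have "continuous_on (ball 0 1) f"
    using assms holomorphic_on_imp_continuous_on by (auto simp: bergman_def)
  then have "(\<lambda>z. indicator (ball 0 1) z *\<^sub>R f z) \<in> borel_measurable borel"
    by (intro borel_measurable_continuous_on_indicator) auto
  moreover have "(\<lambda>z. indicator (ball 0 1) z *\<^sub>R f z) = f"
    using assms by (auto simp: bergman_def indicator_def fun_eq_iff)
  ultimately show ?thesis by simp
qed

lemma sets_bergman_measure [measurable_cong, simp]: "sets (bergman_measure \<alpha>) = sets borel"
  by (simp add: bergman_measure_def)

lemma bergman_ip_integrable: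
  assumes f: "f \<in> bergman \<alpha>" and g: "g \<in> bergman \<alpha>"
  shows "integrable (bergman_measure \<alpha>) (\<lambda>z. f z * cnj (g z))"
proof (rule Bochner_Integration.integrable_bound)
  show "integrable (bergman_measure \<alpha>) (\<lambda>z. (cmod (f z))\<^sup>2 + (cmod (g z))\<^sup>2)"
    using assms by (intro Bochner_Integration.integrable_add) (auto simp: bergman_def)
  have [measurable]: "f \<in> borel_measurable borel" "g \<in> borel_measurable borel"
    using assms bergman_measurable by auto
  have [measurable]: "cnj \<in> borel_measurable borel"
    by (intro borel_measurable_continuous_onI continuous_intros)
  show "(\<lambda>z. f z * cnj (g z)) \<in> borel_measurable (bergman_measure \<alpha>)" by measurable
  have "norm (f z * cnj (g z)) \<le> norm ((cmod (f z))\<^sup>2 + (cmod (g z))\<^sup>2)" for z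
  proof -
    have "0 \<le> (cmod (f z) - cmod (g z))\<^sup>2 + (cmod (f z))\<^sup>2 + (cmod (g z))\<^sup>2" by simp
    then show ?thesis by (simp add: norm_mult power2_diff)
  qed
  then show "AE z in bergman_measure \<alpha>. norm (f z * cnj (g z)) \<le> norm ((cmod (f z))\<^sup>2 + (cmod (g z))\<^sup>2)"
    by simp
qed

lemma bergman_inner_self:
  assumes "f \<in> bergman \<alpha>"
  shows "bergman_inner \<alpha> f f = of_real (LINT z|bergman_measure \<alpha>. (cmod (f z))\<^sup>2)"
  by (simp add: bergman_inner_def complex_norm_square[symmetric] flip: of_real_power)

lemma bergman_nn_integral:
  assumes "f \<in> bergman \<alpha>"
  shows "(\<integral>\<^sup>+z. ennreal ((cmod (f z))\<^sup>2) \<partial>bergman_measure \<alpha>) = ennreal ((norm_of (bergman_inner \<alpha>) f)\<^sup>2)"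
proof -
  have "(\<integral>\<^sup>+z. ennreal ((cmod (f z))\<^sup>2) \<partial>bergman_measure \<alpha>) = ennreal (LINT z|bergman_measure \<alpha>. (cmod (f z))\<^sup>2)"
    using assms by (intro nn_integral_eq_integral) (auto simp: bergman_def)
  moreover have "0 \<le> (LINT z|bergman_measure \<alpha>. (cmod (f z))\<^sup>2)" by simp
  ultimately show ?thesis
    by (simp add: norm_of_def bergman_inner_self[OF assms])
qed

lemma bergman_lincomb:
  assumes f: "f \<in> bergman \<alpha>" and g: "g \<in> bergman \<alpha>"
  shows "(\<lambda>z. a * f z + b * g z) \<in> bergman \<alpha>"
proof -
  have "integrable (bergman_measure \<alpha>) (\<lambda>z. (cmod (a * f z + b * g z))\<^sup>2)"
  proof (rule Bochner_Integration.integrable_bound)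
    show "integrable (bergman_measure \<alpha>) (\<lambda>z. 2 * (cmod a)\<^sup>2 * (cmod (f z))\<^sup>2 + 2 * (cmod b)\<^sup>2 * (cmod (g z))\<^sup>2)"
      using assms by (intro Bochner_Integration.integrable_add integrable_mult_right) (auto simp: bergman_def)
    have [measurable]: "f \<in> borel_measurable borel" "g \<in> borel_measurable borel"
      using assms bergman_measurable by auto
    show "(\<lambda>z. (cmod (a * f z + b * g z))\<^sup>2) \<in> borel_measurable (bergman_measure \<alpha>)" by measurable
    have "norm ((cmod (a * f z + b * g z))\<^sup>2) \<le> norm (2 * (cmod a)\<^sup>2 * (cmod (f z))\<^sup>2 + 2 * (cmod b)\<^sup>2 * (cmod (g z))\<^sup>2)" for z
    proof -
      have "(cmod (a * f z + b * g z))\<^sup>2 \<le> (cmod (a * f z) + cmod (b * g z))\<^sup>2"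
        by (intro power_mono norm_triangle_ineq) simp
      also have "\<dots> \<le> 2 * (cmod (a * f z))\<^sup>2 + 2 * (cmod (b * g z))\<^sup>2"
        using zero_le_power2[of "cmod (a * f z) - cmod (b * g z)"]
        by (simp add: power2_sum power2_diff)
      finally show ?thesis by (simp add: norm_mult power_mult_distrib)
    qed
    then show "AE z in bergman_measure \<alpha>. norm ((cmod (a * f z + b * g z))\<^sup>2)
        \<le> norm (2 * (cmod a)\<^sup>2 * (cmod (f z))\<^sup>2 + 2 * (cmod b)\<^sup>2 * (cmod (g z))\<^sup>2)" by simp
  qed
  moreover have "(\<lambda>z. a * f z + b * g z) holomorphic_on ball 0 1"
    using assms by (intro holomorphic_intros) (auto simp: bergman_def)
  ultimately show ?thesis using assms by (auto simp: bergman_def)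
qed

text \<open>
  The Bergman weight is bounded below by a constant \<open>m > 0\<close> on the disc of radius \<open>\<sigma> < 1\<close>, which contains
  \<open>cball w (3 R)\<close> for all \<open>w\<close> in \<open>cball 0 \<rho>\<close>; there the area average is controlled by the Bergman norm.
\<close>

lemma bergman_local_bound:
  assumes \<alpha>: "\<alpha> > -1" and \<rho>: "\<rho> < 1"
  shows "\<exists>C. \<forall>f\<in>bergman \<alpha>. \<forall>w\<in>cball 0 \<rho>. cmod (f w) \<le> C * norm_of (bergman_inner \<alpha>) f"
proof -
  define R where "R = (1 - \<rho>) / 6"
  define \<sigma> where "\<sigma> = (1 + \<rho>) / 2"
  have R: "0 < R" using \<rho> by (simp add: R_def)
  define B where "B = measure lborel (ball (0::complex) R)"
  have B: "emeasure lborel (ball w R) = ennreal B" "0 < B" for w :: complex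
  proof -
    have "emeasure lborel (ball w R) = ennreal (measure lborel (ball w R))"
      using emeasure_lborel_ball_finite[of w R] by (intro emeasure_eq_ennreal_measure) auto
    then show "emeasure lborel (ball w R) = ennreal B"
      using R content_ball_conv_unit_ball[of R w] content_ball_conv_unit_ball[of R "0::complex"]
      by (simp add: B_def)
    show "0 < B" using R content_ball_pos[of R "0::complex"] by (simp add: B_def)
  qed
  define m where "m = (\<alpha> + 1) / pi * min 1 ((1 - \<sigma>\<^sup>2) powr \<alpha>)"
  show ?thesis
  proof (cases "0 \<le> \<rho>")
    case False
    then show ?thesis by auto
  next
    case True
    then have \<sigma>: "0 \<le> \<sigma>" "\<sigma> < 1" using \<rho> by (auto simp: \<sigma>_def)
    then have \<sigma>2: "0 < 1 - \<sigma>\<^sup>2" by (simp add: power_less_one_iff abs_square_less_1)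
    then have m: "0 < m" using \<alpha> by (simp add: m_def)
    have weight: "m \<le> (\<alpha> + 1) / pi * (1 - (cmod z)\<^sup>2) powr \<alpha>" if z: "z \<in> cball 0 \<sigma>" for z :: complex
    proof -
      have z2: "(cmod z)\<^sup>2 \<le> \<sigma>\<^sup>2" using z by (intro power_mono) auto
      have "min 1 ((1 - \<sigma>\<^sup>2) powr \<alpha>) \<le> (1 - (cmod z)\<^sup>2) powr \<alpha>"
      proof (cases "0 \<le> \<alpha>")
        case True
        then have "(1 - \<sigma>\<^sup>2) powr \<alpha> \<le> (1 - (cmod z)\<^sup>2) powr \<alpha>"
          using z2 \<sigma>2 by (intro powr_mono2) auto
        then show ?thesis by simp
      next
        case False
        have "1 powr \<alpha> \<le> (1 - (cmod z)\<^sup>2) powr \<alpha>"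
          using z2 \<sigma>2 False by (intro powr_mono2') auto
        then show ?thesis by simp
      qed
      then show ?thesis unfolding m_def using \<alpha> by (intro mult_left_mono) auto
    qed
    show ?thesis
    proof (intro exI ballI)
      fix f and w :: complex
      assume f: "f \<in> bergman \<alpha>" and w: "w \<in> cball 0 \<rho>"
      have sub: "cball w (3 * R) \<subseteq> cball 0 \<sigma>"
      proof
        fix z assume z: "z \<in> cball w (3 * R)"
        have "cmod z \<le> cmod w + dist w z" using norm_triangle_ineq[of w "z - w"] by (simp add: dist_norm norm_minus_commute)
        then show "z \<in> cball 0 \<sigma>" using z w by (simp add: R_def \<sigma>_def field_simps)
      qed
      have sub1: "cball (0::complex) \<sigma> \<subseteq> ball 0 1" using \<sigma> by auto
      have [measurable]: "f \<in> borel_measurable borel" using bergman_measurable[OF f] .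
      have [measurable]: "cball (0::complex) \<sigma> \<in> sets borel" "ball (0::complex) 1 \<in> sets borel"
        by simp_all
      let ?J = "\<integral>\<^sup>+z. indicator (cball 0 \<sigma>) z * ennreal ((cmod (f z))\<^sup>2) \<partial>lborel"
      let ?n = "norm_of (bergman_inner \<alpha>) f"
      have upper: "ennreal B * ennreal ((cmod (f w))\<^sup>2) \<le> 2 * ?J"
        unfolding B(1)[of w, symmetric]
      proof (rule area_average_bound)
        show "f holomorphic_on cball w (3 * R)"
          by (rule holomorphic_on_subset[OF _ subset_trans[OF sub sub1]])
             (use f in \<open>simp add: bergman_def\<close>)
        show "indicator (cball 0 \<sigma>) z * ennreal ((cmod (f z))\<^sup>2) = ennreal ((cmod (f z))\<^sup>2)"
          if "z \<in> cball w (3 * R)" for z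
          using subsetD[OF sub that] by simp
        show "(\<lambda>z. indicator (cball 0 \<sigma>) z * ennreal ((cmod (f z))\<^sup>2)) \<in> borel_measurable borel"
          by measurable
      qed (rule R)
      have "ennreal m * ?J \<le> ennreal (?n\<^sup>2)"
      proof -
        have "ennreal m * ?J = (\<integral>\<^sup>+z. ennreal m * (indicator (cball 0 \<sigma>) z * ennreal ((cmod (f z))\<^sup>2)) \<partial>lborel)"
          by (rule nn_integral_cmult[symmetric]) measurable
        also have "\<dots> \<le> (\<integral>\<^sup>+z. ennreal (indicator (ball 0 1) z * ((\<alpha> + 1) / pi * (1 - (cmod z)\<^sup>2) powr \<alpha>))
            * ennreal ((cmod (f z))\<^sup>2) \<partial>lborel)"
        proof (rule nn_integral_mono)
          fix z :: complex
          show "ennreal m * (indicator (cball 0 \<sigma>) z * ennreal ((cmod (f z))\<^sup>2))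
            \<le> ennreal (indicator (ball 0 1) z * ((\<alpha> + 1) / pi * (1 - (cmod z)\<^sup>2) powr \<alpha>)) * ennreal ((cmod (f z))\<^sup>2)"
          proof (cases "z \<in> cball 0 \<sigma>")
            case True
            have "z \<in> ball 0 1" using True sub1 by blast
            then have "ennreal m \<le> ennreal (indicator (ball 0 1) z * ((\<alpha> + 1) / pi * (1 - (cmod z)\<^sup>2) powr \<alpha>))"
              using weight[OF True] by (intro ennreal_leI) simp
            then have "ennreal m * ennreal ((cmod (f z))\<^sup>2)
              \<le> ennreal (indicator (ball 0 1) z * ((\<alpha> + 1) / pi * (1 - (cmod z)\<^sup>2) powr \<alpha>)) * ennreal ((cmod (f z))\<^sup>2)"
              by (rule mult_right_mono) simp
            moreover have "indicator (cball 0 \<sigma>) z = (1::ennreal)" using True by simp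
            ultimately show ?thesis by (simp only: mult_1)
          qed simp
        qed
        also have "\<dots> = (\<integral>\<^sup>+z. ennreal ((cmod (f z))\<^sup>2) \<partial>bergman_measure \<alpha>)"
          unfolding bergman_measure_def by (rule nn_integral_density[symmetric]) measurable
        also have "\<dots> = ennreal (?n\<^sup>2)" by (rule bergman_nn_integral[OF f])
        finally show ?thesis .
      qed
      note lower = this
      have "ennreal m * (ennreal B * ennreal ((cmod (f w))\<^sup>2)) \<le> ennreal m * (2 * ?J)"
        by (rule mult_left_mono[OF upper]) simp
      also have "\<dots> = 2 * (ennreal m * ?J)" by (rule mult.left_commute)
      also have "\<dots> \<le> 2 * ennreal (?n\<^sup>2)" by (rule mult_left_mono[OF lower]) simp
      finally have "ennreal m * (ennreal B * ennreal ((cmod (f w))\<^sup>2)) \<le> 2 * ennreal (?n\<^sup>2)" .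
      then have "ennreal (m * B * (cmod (f w))\<^sup>2) \<le> ennreal (2 * ?n\<^sup>2)"
        using m B(2) by (simp add: ennreal_mult mult.assoc)
      then have "m * B * (cmod (f w))\<^sup>2 \<le> 2 * ?n\<^sup>2"
        by (simp add: ennreal_le_iff)
      then have "(cmod (f w))\<^sup>2 \<le> 2 / (m * B) * ?n\<^sup>2"
        using m B(2) by (simp add: field_simps)
      then have "sqrt ((cmod (f w))\<^sup>2) \<le> sqrt (2 / (m * B) * ?n\<^sup>2)"
        by (rule real_sqrt_le_mono)
      then have "cmod (f w) \<le> sqrt (2 / (m * B)) * \<bar>?n\<bar>"
        by (simp only: real_sqrt_mult real_sqrt_abs abs_norm_cancel)
      moreover have "0 \<le> ?n" by (simp add: norm_of_def bergman_inner_self[OF f])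
      ultimately show "cmod (f w) \<le> sqrt (2 / (m * B)) * ?n"
        by simp
    qed
  qed
qed

text \<open>
  A Cauchy sequence converges locally uniformly, so its pointwise limit is holomorphic; Fatou's
  lemma for integrals shows that the limit lies in the space and that convergence holds in norm.
\<close>

lemma bergman_complete:
  assumes \<alpha>: "\<alpha> > -1" and s: "\<And>n. s n \<in> bergman \<alpha>"
    and cauchy: "\<And>e. 0 < e \<Longrightarrow> \<exists>N. \<forall>m\<ge>N. \<forall>n\<ge>N. norm_of (bergman_inner \<alpha>) (\<lambda>z. s m z - s n z) < e"
  shows "\<exists>g\<in>bergman \<alpha>. (\<lambda>n. norm_of (bergman_inner \<alpha>) (\<lambda>z. s n z - g z)) \<longlonglongrightarrow> 0"
proof -
  let ?nrm = "norm_of (bergman_inner \<alpha>)"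
  have s_diff: "(\<lambda>z. s m z - s n z) \<in> bergman \<alpha>" for m n
    using bergman_lincomb[OF s[of m] s[of n], of 1 "-1"] by simp
  define g where "g z = lim (\<lambda>n. s n z)" for z
  have unif: "uniform_limit (cball 0 \<rho>) s g sequentially" if \<rho>: "\<rho> < 1" for \<rho>
  proof -
    obtain C where C: "\<And>f w. f \<in> bergman \<alpha> \<Longrightarrow> w \<in> cball 0 \<rho> \<Longrightarrow> cmod (f w) \<le> C * ?nrm f"
      using bergman_local_bound[OF \<alpha> \<rho>] by blast
    have "uniformly_Cauchy_on (cball 0 \<rho>) s"
    proof (rule uniformly_Cauchy_onI)
      fix e :: real
      assume e: "0 < e"
      then have "0 < e / (\<bar>C\<bar> + 1)" by simp
      then obtain N where N: "\<And>m n. m \<ge> N \<Longrightarrow> n \<ge> N \<Longrightarrow> ?nrm (\<lambda>z. s m z - s n z) < e / (\<bar>C\<bar> + 1)"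
        using cauchy by meson
      have "dist (s m w) (s n w) < e" if w: "w \<in> cball 0 \<rho>" and mn: "m \<ge> N" "n \<ge> N" for w m n
      proof -
        have pos: "0 \<le> ?nrm (\<lambda>z. s m z - s n z)"
          using bergman_inner_self[OF s_diff, of m n] by (simp add: norm_of_def)
        have "cmod (s m w - s n w) \<le> C * ?nrm (\<lambda>z. s m z - s n z)" using C[OF s_diff w] .
        also have "\<dots> \<le> (\<bar>C\<bar> + 1) * ?nrm (\<lambda>z. s m z - s n z)"
          using pos by (intro mult_right_mono) auto
        also have "\<dots> < (\<bar>C\<bar> + 1) * (e / (\<bar>C\<bar> + 1))"
          using N[OF mn] by (intro mult_strict_left_mono) auto
        also have "\<dots> = e" by simp
        finally show ?thesis by (simp add: dist_norm)
      qed
      then show "\<exists>M. \<forall>x\<in>cball 0 \<rho>. \<forall>m\<ge>M. \<forall>n\<ge>M. dist (s m x) (s n x) < e" by blast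
    qed
    then show ?thesis
      using Cauchy_uniformly_convergent uniformly_convergent_uniform_limit_iff
      unfolding g_def[abs_def] by blast
  qed
  have pointwise: "(\<lambda>n. s n z) \<longlonglongrightarrow> g z" for z
  proof (cases "z \<in> ball 0 1")
    case True
    then have "cmod z < 1" by simp
    then show ?thesis by (rule tendsto_uniform_limitI[OF unif]) simp
  next
    case False
    then have "s n z = 0" for n using s[of n] by (simp add: bergman_def)
    then show ?thesis by (simp add: g_def)
  qed
  have g_hol: "g holomorphic_on ball 0 1"
  proof (rule holomorphic_uniform_sequence)
    show "s n holomorphic_on ball 0 1" for n using s[of n] by (simp add: bergman_def)
    fix x :: complex assume x: "x \<in> ball 0 1"
    define d where "d = (1 - cmod x) / 2"
    have "0 < d" using x by (simp add: d_def)
    moreover have sub: "cball x d \<subseteq> cball 0 (cmod x + d)"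
    proof
      fix z assume "z \<in> cball x d"
      then show "z \<in> cball 0 (cmod x + d)"
        using norm_triangle_ineq[of x "z - x"] by (simp add: dist_norm norm_minus_commute)
    qed
    moreover have lt: "cmod x + d < 1" using x by (simp add: d_def field_simps)
    moreover have "uniform_limit (cball x d) s g sequentially"
      by (rule uniform_limit_on_subset[OF unif[OF lt] sub])
    ultimately show "\<exists>d>0. cball x d \<subseteq> ball 0 1 \<and> uniform_limit (cball x d) s g sequentially"
      by (intro exI[of _ d] conjI) auto
  qed simp
  have g_zero: "g z = 0" if "z \<notin> ball 0 1" for z
  proof -
    have "s n z = 0" for n using s[of n] that by (simp add: bergman_def)
    then show ?thesis by (simp add: g_def)
  qed
  have s_meas [measurable]: "s n \<in> borel_measurable borel" for n by (rule bergman_measurable[OF s])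
  have g_meas [measurable]: "g \<in> borel_measurable borel"
    unfolding g_def[abs_def] by (rule borel_measurable_lim_metric) simp
  have fatou: "(\<integral>\<^sup>+z. ennreal ((cmod (s n z - g z))\<^sup>2) \<partial>bergman_measure \<alpha>) \<le> ennreal (e\<^sup>2)"
    if e: "0 < e" and n: "n \<ge> N" and N: "\<And>m n. m \<ge> N \<Longrightarrow> n \<ge> N \<Longrightarrow> ?nrm (\<lambda>z. s m z - s n z) < e" for e n N
  proof -
    have "(\<integral>\<^sup>+z. ennreal ((cmod (s n z - g z))\<^sup>2) \<partial>bergman_measure \<alpha>)
        = (\<integral>\<^sup>+z. liminf (\<lambda>m. ennreal ((cmod (s n z - s m z))\<^sup>2)) \<partial>bergman_measure \<alpha>)"
    proof (rule nn_integral_cong)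
      fix z
      have "(\<lambda>m. ennreal ((cmod (s n z - s m z))\<^sup>2)) \<longlonglongrightarrow> ennreal ((cmod (s n z - g z))\<^sup>2)"
        by (intro tendsto_ennrealI tendsto_intros pointwise)
      then show "ennreal ((cmod (s n z - g z))\<^sup>2) = liminf (\<lambda>m. ennreal ((cmod (s n z - s m z))\<^sup>2))"
        by (rule lim_imp_Liminf[OF sequentially_bot, symmetric])
    qed
    also have "\<dots> \<le> liminf (\<lambda>m. \<integral>\<^sup>+z. ennreal ((cmod (s n z - s m z))\<^sup>2) \<partial>bergman_measure \<alpha>)"
      by (rule nn_integral_liminf) measurable
    also have "\<dots> = liminf (\<lambda>m. ennreal ((?nrm (\<lambda>z. s n z - s m z))\<^sup>2))"
      by (simp only: bergman_nn_integral[OF s_diff])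
    also have "\<dots> \<le> ennreal (e\<^sup>2)"
    proof (rule Liminf_le)
      show "\<forall>\<^sub>F m in sequentially. ennreal ((?nrm (\<lambda>z. s n z - s m z))\<^sup>2) \<le> ennreal (e\<^sup>2)"
        unfolding eventually_sequentially
      proof (intro exI[of _ N] allI impI ennreal_leI power_mono)
        fix m assume "N \<le> m"
        then show "?nrm (\<lambda>z. s n z - s m z) \<le> e" using N[OF n] by (simp add: less_imp_le)
        show "0 \<le> ?nrm (\<lambda>z. s n z - s m z)"
          using bergman_inner_self[OF s_diff, of n m] by (simp add: norm_of_def)
      qed
    qed simp
    finally show ?thesis .
  qed
  have sg: "(\<lambda>z. s n z - g z) \<in> bergman \<alpha>"
    if e: "0 < e" and n: "n \<ge> N" and N: "\<And>m n. m \<ge> N \<Longrightarrow> n \<ge> N \<Longrightarrow> ?nrm (\<lambda>z. s m z - s n z) < e" for e n N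
  proof -
    have "integrable (bergman_measure \<alpha>) (\<lambda>z. (cmod (s n z - g z))\<^sup>2)"
    proof (rule integrableI_bounded)
      show "(\<lambda>z. (cmod (s n z - g z))\<^sup>2) \<in> borel_measurable (bergman_measure \<alpha>)" by measurable
      have "(\<integral>\<^sup>+z. ennreal (norm ((cmod (s n z - g z))\<^sup>2)) \<partial>bergman_measure \<alpha>) \<le> ennreal (e\<^sup>2)"
        using fatou[OF that] by simp
      then show "(\<integral>\<^sup>+z. ennreal (norm ((cmod (s n z - g z))\<^sup>2)) \<partial>bergman_measure \<alpha>) < \<infinity>"
        by (rule le_less_trans) simp
    qed
    moreover have "(\<lambda>z. s n z - g z) holomorphic_on ball 0 1"
      using s[of n] by (intro holomorphic_intros g_hol) (simp add: bergman_def)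
    ultimately show ?thesis
      using s[of n] g_zero by (simp add: bergman_def)
  qed
  have small: "?nrm (\<lambda>z. s n z - g z) \<le> e"
    if e: "0 < e" and n: "n \<ge> N" and N: "\<And>m n. m \<ge> N \<Longrightarrow> n \<ge> N \<Longrightarrow> ?nrm (\<lambda>z. s m z - s n z) < e" for e n N
  proof -
    have "ennreal ((?nrm (\<lambda>z. s n z - g z))\<^sup>2) \<le> ennreal (e\<^sup>2)"
      using fatou[OF that] by (simp only: bergman_nn_integral[OF sg[OF that]])
    then have "(?nrm (\<lambda>z. s n z - g z))\<^sup>2 \<le> e\<^sup>2" by (simp add: ennreal_le_iff)
    then show ?thesis by (rule power2_le_imp_le) (use e in simp)
  qed
  obtain N1 where "\<forall>m\<ge>N1. \<forall>n\<ge>N1. ?nrm (\<lambda>z. s m z - s n z) < 1"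
    using cauchy[OF zero_less_one] ..
  then have N1: "?nrm (\<lambda>z. s m z - s n z) < 1" if "m \<ge> N1" "n \<ge> N1" for m n
    using that by simp
  have "(\<lambda>z. s N1 z - g z) \<in> bergman \<alpha>" by (rule sg[OF zero_less_one order_refl N1])
  from bergman_lincomb[OF s[of N1] this, of 1 "-1"] have "g \<in> bergman \<alpha>" by simp
  moreover have "(\<lambda>n. ?nrm (\<lambda>z. s n z - g z)) \<longlonglongrightarrow> 0"
  proof (rule LIMSEQ_I)
    fix r :: real
    assume "0 < r"
    then have r2: "0 < r / 2" by simp
    obtain N where "\<forall>m\<ge>N. \<forall>n\<ge>N. ?nrm (\<lambda>z. s m z - s n z) < r / 2"
      using cauchy[OF r2] ..
    then have N: "?nrm (\<lambda>z. s m z - s n z) < r / 2" if "m \<ge> N" "n \<ge> N" for m n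
      using that by simp
    have "norm (?nrm (\<lambda>z. s n z - g z) - 0) < r" if n: "n \<ge> N" for n
    proof -
      have "0 \<le> ?nrm (\<lambda>z. s n z - g z)"
        using bergman_inner_self[OF sg[OF r2 n N]] by (simp add: norm_of_def)
      then show ?thesis using small[OF r2 n N] r2 by simp
    qed
    then show "\<exists>no. \<forall>n\<ge>no. norm (?nrm (\<lambda>z. s n z - g z) - 0) < r" by blast
  qed
  ultimately show ?thesis by - (rule bexI[of _ g])
qed

lemma bergman_rkhs:
  assumes \<alpha>: "\<alpha> > -1"
  shows "rkhs (bergman \<alpha>) (bergman_inner \<alpha>)"
proof
  show "(\<lambda>z. 0) \<in> bergman \<alpha>" by (simp add: bergman_def)
  show "(\<lambda>z. a * f z + b * g z) \<in> bergman \<alpha>" if "f \<in> bergman \<alpha>" "g \<in> bergman \<alpha>" for f g a b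
    using that by (rule bergman_lincomb)
  show "bergman_inner \<alpha> (\<lambda>z. a * f z + b * g z) h = a * bergman_inner \<alpha> f h + b * bergman_inner \<alpha> g h"
    if "f \<in> bergman \<alpha>" "g \<in> bergman \<alpha>" "h \<in> bergman \<alpha>" for f g h a b
  proof -
    have "bergman_inner \<alpha> (\<lambda>z. a * f z + b * g z) h
        = (LINT z|bergman_measure \<alpha>. a * (f z * cnj (h z)) + b * (g z * cnj (h z)))"
      unfolding bergman_inner_def by (intro Bochner_Integration.integral_cong) (auto simp: algebra_simps)
    also have "\<dots> = (LINT z|bergman_measure \<alpha>. a * (f z * cnj (h z))) + (LINT z|bergman_measure \<alpha>. b * (g z * cnj (h z)))"
      by (intro Bochner_Integration.integral_add integrable_mult_right bergman_ip_integrable that)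
    also have "\<dots> = a * bergman_inner \<alpha> f h + b * bergman_inner \<alpha> g h"
      by (simp only: bergman_inner_def integral_mult_right_zero)
    finally show ?thesis .
  qed
  show "bergman_inner \<alpha> g f = cnj (bergman_inner \<alpha> f g)"
    if "f \<in> bergman \<alpha>" "g \<in> bergman \<alpha>" for f g
  proof -
    have "cnj (bergman_inner \<alpha> f g) = (LINT z|bergman_measure \<alpha>. cnj (f z * cnj (g z)))"
      unfolding bergman_inner_def by (rule integral_bounded_linear[symmetric, OF bounded_linear_cnj bergman_ip_integrable[OF that]])
    then show ?thesis by (simp add: bergman_inner_def mult.commute)
  qed
  show "0 \<le> Re (bergman_inner \<alpha> f f)" if "f \<in> bergman \<alpha>" for f
    by (simp add: bergman_inner_self[OF that])
  show "\<exists>C. \<forall>f\<in>bergman \<alpha>. cmod (f z) \<le> C * norm_of (bergman_inner \<alpha>) f" for z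
  proof (cases "cmod z < 1")
    case True
    from bergman_local_bound[OF \<alpha> True] obtain C where
      "\<forall>f\<in>bergman \<alpha>. \<forall>w\<in>cball 0 (cmod z). cmod (f w) \<le> C * norm_of (bergman_inner \<alpha>) f" ..
    then have "\<forall>f\<in>bergman \<alpha>. cmod (f z) \<le> C * norm_of (bergman_inner \<alpha>) f" by simp
    then show ?thesis ..
  next
    case False
    then have "\<forall>f\<in>bergman \<alpha>. cmod (f z) \<le> 0 * norm_of (bergman_inner \<alpha>) f"
      by (auto simp: bergman_def)
    then show ?thesis by blast
  qed
  show "\<exists>g\<in>bergman \<alpha>. (\<lambda>n. norm_of (bergman_inner \<alpha>) (\<lambda>z. s n z - g z)) \<longlonglongrightarrow> 0"
    if "\<And>n. s n \<in> bergman \<alpha>"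
      "\<And>e. 0 < e \<Longrightarrow> \<exists>N. \<forall>m\<ge>N. \<forall>n\<ge>N. norm_of (bergman_inner \<alpha>) (\<lambda>z. s m z - s n z) < e" for s
    by (rule bergman_complete[OF \<alpha> that])
qed

section \<open>Sub-Bergman spaces and their multipliers\<close>

text \<open>
  The defect operator is chosen among the positive square roots; it has the properties of a square
  root because one exists.
\<close>

lemma defect_op_bounded:
  assumes \<alpha>: "\<alpha> > -1" and \<phi>: "\<phi> \<in> bergman_mult_unit_ball \<alpha>"
  shows "bergman_bounded_op \<alpha> (defect_op \<alpha> \<phi>)"
proof -
  interpret rkhs "bergman \<alpha>" "bergman_inner \<alpha>" by (rule bergman_rkhs[OF \<alpha>])
  have T_mem: "mult_op \<phi> f \<in> bergman \<alpha>" if "f \<in> bergman \<alpha>" for f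
    using \<phi> that by (auto simp: bergman_mult_unit_ball_def Mult_def)
  have T_contr: "nrm (mult_op \<phi> f) \<le> nrm f" if "f \<in> bergman \<alpha>" for f
    using \<phi> that by (simp add: bergman_mult_unit_ball_def)
  have T_lin: "mult_op \<phi> (\<lambda>z. a * f z + b * g z) = (\<lambda>z. a * mult_op \<phi> f z + b * mult_op \<phi> g z)" for f g a b
    by (simp add: mult_op_def fun_eq_iff algebra_simps)
  have "\<exists>B. (\<forall>f\<in>bergman \<alpha>. B f \<in> bergman \<alpha>) \<and>
    (\<forall>f\<in>bergman \<alpha>. \<forall>g\<in>bergman \<alpha>. \<forall>a b. B (\<lambda>z. a * f z + b * g z) = (\<lambda>z. a * B f z + b * B g z)) \<and>
    (\<forall>f\<in>bergman \<alpha>. nrm (B f) \<le> 2 * nrm f) \<and> (\<forall>f\<in>bergman \<alpha>. bergman_inner \<alpha> (B f) f \<in> \<real>\<^sub>\<ge>\<^sub>0) \<and>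
    (\<forall>f\<in>bergman \<alpha>. B (B f) = (\<lambda>z. f z - mult_op \<phi> (bergman_adjoint \<alpha> (mult_op \<phi>) f) z))"
    by (rule defect_sqrt_exists[OF T_mem T_lin T_contr]) (simp_all add: bergman_adjoint_def)
  then obtain B where "bergman_positive_op \<alpha> B"
      "\<forall>f\<in>bergman \<alpha>. B (B f) = (\<lambda>z. f z - mult_op \<phi> (bergman_adjoint \<alpha> (mult_op \<phi>) f) z)"
    unfolding bergman_positive_op_def bergman_bounded_op_def by blast
  then have "bergman_positive_op \<alpha> B \<and>
      (\<forall>f\<in>bergman \<alpha>. B (B f) = (\<lambda>z. f z - mult_op \<phi> (bergman_adjoint \<alpha> (mult_op \<phi>) f) z))" by blast
  from someI[where P = "\<lambda>B. bergman_positive_op \<alpha> B \<and>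
      (\<forall>f\<in>bergman \<alpha>. B (B f) = (\<lambda>z. f z - mult_op \<phi> (bergman_adjoint \<alpha> (mult_op \<phi>) f) z))", OF this]
  show ?thesis
    by (simp add: defect_op_def bergman_sqrt_op_def bergman_positive_op_def)
qed

text \<open>
  The general bound holds wherever some element of the space does not vanish. One nonzero element
  \<open>h\<close> suffices: its zeros are isolated, and \<open>\<gamma>\<close> is continuous.
\<close>

lemma sub_bergman_multiplier_bounded:
  assumes \<alpha>: "\<alpha> > -1" and \<phi>: "\<phi> \<in> bergman_mult_unit_ball \<alpha>"
    and nontrivial: "sub_bergman \<alpha> \<phi> \<noteq> {\<lambda>z. 0}" and \<gamma>: "\<gamma> \<in> Mult (sub_bergman \<alpha> \<phi>)"
  shows "\<exists>K. \<forall>z\<in>ball 0 1. cmod (\<gamma> z) \<le> K"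
proof -
  interpret rkhs "bergman \<alpha>" "bergman_inner \<alpha>" by (rule bergman_rkhs[OF \<alpha>])
  let ?B = "defect_op \<alpha> \<phi>"
  note bounded = defect_op_bounded[OF \<alpha> \<phi>, unfolded bergman_bounded_op_def]
  have B_mem: "?B f \<in> bergman \<alpha>" if "f \<in> bergman \<alpha>" for f
    using bounded that by (simp add: image_subset_iff)
  have B_lin: "?B (\<lambda>z. a * f z + b * g z) = (\<lambda>z. a * ?B f z + b * ?B g z)"
    if "f \<in> bergman \<alpha>" "g \<in> bergman \<alpha>" for f g a b
    using bounded[THEN conjunct2, THEN conjunct1] that by simp
  obtain C where B_bound: "nrm (?B f) \<le> C * nrm f" if "f \<in> bergman \<alpha>" for f
    using bounded[THEN conjunct2, THEN conjunct2] by metis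
  note B = B_mem B_lin B_bound
  have \<gamma>_hol: "\<gamma> holomorphic_on ball 0 1"
    and \<gamma>_mult: "\<And>f. f \<in> ?B ` bergman \<alpha> \<Longrightarrow> (\<lambda>z. \<gamma> z * f z) \<in> ?B ` bergman \<alpha>"
    using \<gamma> by (auto simp: Mult_def sub_bergman_def mult_op_def)
  obtain K where K: "\<And>w f. f \<in> ?B ` bergman \<alpha> \<Longrightarrow> f w \<noteq> 0 \<Longrightarrow> cmod (\<gamma> w) \<le> K"
    using multiplier_of_range_bounded[OF B \<gamma>_mult] by metis
  have "sub_bergman \<alpha> \<phi> \<noteq> {}" using zero_mem by (auto simp: sub_bergman_def)
  then have "\<not> sub_bergman \<alpha> \<phi> \<subseteq> {\<lambda>z. 0}"
    using nontrivial subset_singletonD by metis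
  then obtain h where h: "h \<in> ?B ` bergman \<alpha>" "h \<noteq> (\<lambda>z. 0)"
    by (auto simp only: subset_iff singleton_iff sub_bergman_def)
  have hA: "h \<in> bergman \<alpha>" using h(1) B(1) by blast
  then have h_hol: "h holomorphic_on ball 0 1" by (simp add: bergman_def)
  have "\<exists>z0. h z0 \<noteq> 0"
    using h(2) by (rule contrapos_np) (simp add: fun_eq_iff)
  then obtain z0 where hz0: "h z0 \<noteq> 0" ..
  then have z0: "z0 \<in> ball 0 1" "h z0 \<noteq> 0"
    using hA unfolding bergman_def by blast+
  have "cmod (\<gamma> z) \<le> K" if z: "z \<in> ball 0 1" for z
  proof -
    have "\<forall>\<^sub>F w in at z. h w \<noteq> 0 \<and> w \<in> ball 0 1"
      by (rule non_zero_neighbour_alt[OF h_hol open_ball connected_ball z z0])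
    then have "\<forall>\<^sub>F w in at z. cmod (\<gamma> w) \<le> K"
      by (rule eventually_mono) (rule K[OF h(1)], simp)
    moreover have "isCont \<gamma> z"
      using holomorphic_on_imp_continuous_on[OF \<gamma>_hol] z
      by (simp add: continuous_on_eq_continuous_at)
    then have "((\<lambda>w. cmod (\<gamma> w)) \<longlongrightarrow> cmod (\<gamma> z)) (at z)"
      by (intro tendsto_norm) (simp add: isCont_def)
    ultimately show ?thesis
      using tendsto_upperbound[of "\<lambda>w. cmod (\<gamma> w)" "cmod (\<gamma> z)" "at z" K] by simp
  qed
  then show ?thesis by blast
qed

text \<open>
  If \<open>\<psi>\<close> vanished, all elements of the space would have distance \<open>0\<close> from the zero function. The norm
  of \<open>g\<close> is by definition the Bergman norm of its preimage in the complement of the kernel, so that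
  preimage, and with it \<open>g\<close>, would vanish.
\<close>

lemma sub_bergman_cyclic_nonzero:
  assumes \<alpha>: "\<alpha> > -1" and \<phi>: "\<phi> \<in> bergman_mult_unit_ball \<alpha>"
    and nontrivial: "sub_bergman \<alpha> \<phi> \<noteq> {\<lambda>z. 0}"
    and dense: "closure_wrt (sub_bergman \<alpha> \<phi>) (sub_bergman_inner \<alpha> \<phi>) (mult_op \<psi> ` sub_bergman \<alpha> \<phi>)
      = sub_bergman \<alpha> \<phi>"
  shows "\<exists>z\<in>ball 0 1. \<psi> z \<noteq> 0"
proof (rule ccontr)
  assume zero: "\<not> ?thesis"
  interpret rkhs "bergman \<alpha>" "bergman_inner \<alpha>" by (rule bergman_rkhs[OF \<alpha>])
  let ?B = "defect_op \<alpha> \<phi>" and ?D = "defect_ker_compl \<alpha> \<phi>"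
  note bounded = defect_op_bounded[OF \<alpha> \<phi>, unfolded bergman_bounded_op_def]
  have B_mem: "?B f \<in> bergman \<alpha>" if "f \<in> bergman \<alpha>" for f
    using bounded that by (simp add: image_subset_iff)
  have B_lin: "?B (\<lambda>z. a * f z + b * g z) = (\<lambda>z. a * ?B f z + b * ?B g z)"
    if "f \<in> bergman \<alpha>" "g \<in> bergman \<alpha>" for f g a b
    using bounded[THEN conjunct2, THEN conjunct1] that by simp
  obtain C where B_bound: "nrm (?B f) \<le> C * nrm f" if "f \<in> bergman \<alpha>" for f
    using bounded[THEN conjunct2, THEN conjunct2] by metis
  note B = B_mem B_lin B_bound
  have g0: "g = (\<lambda>z. 0)" if g: "g \<in> sub_bergman \<alpha> \<phi>" for g
  proof -
    have zero_mult: "mult_op \<psi> h = (\<lambda>z. 0)" if "h \<in> sub_bergman \<alpha> \<phi>" for h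
    proof
      fix z
      have "h \<in> bergman \<alpha>" using that B(1) by (auto simp: sub_bergman_def)
      then show "mult_op \<psi> h z = 0"
        using zero by (cases "z \<in> ball 0 1") (auto simp: mult_op_def bergman_def)
    qed
    have small: "norm_of (sub_bergman_inner \<alpha> \<phi>) g < e" if "0 < e" for e
    proof -
      have "g \<in> closure_wrt (sub_bergman \<alpha> \<phi>) (sub_bergman_inner \<alpha> \<phi>) (mult_op \<psi> ` sub_bergman \<alpha> \<phi>)"
        using g by (simp only: dense)
      then have "\<exists>s\<in>mult_op \<psi> ` sub_bergman \<alpha> \<phi>. norm_of (sub_bergman_inner \<alpha> \<phi>) (\<lambda>z. g z - s z) < e"
        using that by (simp only: closure_wrt_def mem_Collect_eq)
      then show ?thesis using zero_mult by auto
    qed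
    define y where "y = inv_into ?D ?B g"
    have "g \<in> ?B ` ?D"
    proof -
      obtain x where x: "x \<in> bergman \<alpha>" "g = ?B x" using g by (auto simp: sub_bergman_def)
      have "\<exists>y\<in>bergman \<alpha>. (\<forall>h\<in>bergman \<alpha>. ?B h = (\<lambda>z. 0) \<longrightarrow> bergman_inner \<alpha> y h = 0) \<and> ?B y = ?B x"
        by (rule range_attained_on_kernel_complement[OF B x(1)])
      then obtain y where y: "y \<in> bergman \<alpha>"
          "\<forall>h\<in>bergman \<alpha>. ?B h = (\<lambda>z. 0) \<longrightarrow> bergman_inner \<alpha> y h = 0" "?B y = ?B x"
        by (elim bexE conjE) (rule that)
      then have "y \<in> ?D" by (simp add: defect_ker_compl_def)
      then show ?thesis using x(2) y(3) by (intro image_eqI[of _ _ y]) auto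
    qed
    then have y: "y \<in> ?D" "?B y = g"
      unfolding y_def by (rule inv_into_into, rule f_inv_into_f)
    then have yA: "y \<in> bergman \<alpha>" by (simp add: defect_ker_compl_def)
    have "norm_of (sub_bergman_inner \<alpha> \<phi>) g = nrm y"
      by (simp add: norm_of_def sub_bergman_inner_def y_def)
    then have "\<not> 0 < nrm y" using small[of "nrm y"] by auto
    then have "nrm y = 0" using nrm_nonneg[OF yA] by simp
    then have "nrm (?B y) = 0"
      using B(3)[OF yA] nrm_nonneg[OF B(1)[OF yA]] by simp
    from nrm_eq_0D[OF B(1)[OF yA] this] show ?thesis using y(2) by simp
  qed
  have "sub_bergman \<alpha> \<phi> \<noteq> {}" using zero_mem by (auto simp: sub_bergman_def)
  moreover have "sub_bergman \<alpha> \<phi> \<subseteq> {\<lambda>z. 0}"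
    by (rule subsetI) (simp only: singleton_iff g0)
  ultimately show False using nontrivial subset_singletonD by metis
qed

section \<open>Lipschitz functions are differentiable almost everywhere\<close>

text \<open>
  The intervals on which the mean slope of \<open>v\<close> is below \<open>p\<close>, taken inside an open set slightly larger
  than \<open>E\<close>, have images that form a Vitali cover of \<open>v ` E\<close>. A disjoint subfamily covers almost all of
  the image, and each image is at most \<open>p\<close> times as long as its interval.
\<close>

lemma emeasure_image_le_slope:
  fixes v w :: "real \<Rightarrow> real"
  assumes v: "strict_mono v" "continuous_on UNIV v"
    and w: "continuous_on UNIV w" "\<And>x. w (v x) = x" "\<And>y. v (w y) = y"
    and E: "E \<in> sets borel" and p: "0 < p"
    and steep: "\<And>x d. x \<in> E \<Longrightarrow> 0 < d \<Longrightarrow>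
          \<exists>a b. a < x \<and> x < b \<and> b - a < d \<and> v b - v a < p * (b - a)"
  shows "emeasure lborel (v ` E) \<le> ennreal p * emeasure lborel E"
proof (rule ennreal_le_epsilon)
  fix e :: real
  assume "0 < e"
  then have "0 < e / p" using p by simp
  then obtain U where U: "open U" "E \<subseteq> U" and UE: "emeasure lborel (U - E) < ennreal (e / p)"
    using outer_regular_lborel[OF E] by metis
  have vE_eq: "v ` E = w -` E"
    using w by (auto simp: image_iff) metis
  have [measurable]: "w \<in> borel_measurable borel"
    using w(1) by (rule borel_measurable_continuous_onI)
  have vE: "v ` E \<in> sets borel"
    unfolding vE_eq using measurable_sets[OF \<open>w \<in> borel_measurable borel\<close> E] by simp
  define K where "K = {(a, b). a < b \<and> {a<..<b} \<subseteq> U \<and> v b - v a < p * (b - a)}"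
  define c where "c = (\<lambda>(a, b). (v a + v b) / 2)"
  define r where "r = (\<lambda>(a, b). (v b - v a) / 2)"
  have ball_eq: "ball (c i) (r i) = {v (fst i)<..<v (snd i)}" for i
    by (simp add: c_def r_def greaterThanLessThan_eq_ball split_beta)
  obtain C where C: "countable C" "C \<subseteq> K"
     "pairwise (\<lambda>i j. disjnt (ball (c i) (r i)) (ball (c j) (r j))) C"
     "negligible (v ` E - (\<Union>i \<in> C. ball (c i) (r i)))"
  proof (rule Vitali_covering_theorem_balls)
    fix y d :: real
    assume "y \<in> v ` E" and d: "0 < d"
    then obtain x where x: "x \<in> E" "y = v x" by blast
    obtain s where s: "0 < s" "ball x s \<subseteq> U"
      using U x openE by blast
    have "0 < min s (d / p)" using s d p by simp
    then obtain a b where ab: "a < x" "x < b" "b - a < min s (d / p)" "v b - v a < p * (b - a)"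
      using steep[OF x(1)] by blast
    have "{a<..<b} \<subseteq> ball x s"
      using ab by (auto simp: dist_real_def)
    then have "(a, b) \<in> K"
      using ab s by (auto simp: K_def)
    moreover have "y \<in> ball (c (a, b)) (r (a, b))"
      unfolding ball_eq using ab v(1) x by (auto simp: strict_mono_def)
    moreover have "r (a, b) < d"
    proof -
      have "p * (b - a) < p * (d / p)"
        using ab p by (intro mult_strict_left_mono) auto
      then have "v b - v a < d" using ab p by simp
      then show ?thesis using d by (simp add: r_def)
    qed
    ultimately show "\<exists>i. i \<in> K \<and> y \<in> ball (c i) (r i) \<and> r i < d" by blast
  qed (rule that)
  let ?V = "\<Union>i\<in>C. {v (fst i)<..<v (snd i)}"
  have neg: "negligible (v ` E - ?V)"
    using C(4) by (simp add: ball_eq)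
  have V_meas: "?V \<in> sets borel" by (intro borel_open open_UN) auto
  have disj_v: "{v (fst i)<..<v (snd i)} \<inter> {v (fst j)<..<v (snd j)} = {}"
    if "i \<in> C" "j \<in> C" "i \<noteq> j" for i j
    using C(3) that by (auto simp: pairwise_def disjnt_def ball_eq)
  have disj: "{fst i<..<snd i} \<inter> {fst j<..<snd j} = {}" if "i \<in> C" "j \<in> C" "i \<noteq> j" for i j
  proof (rule ccontr)
    assume "\<not> ?thesis"
    then have "max (fst i) (fst j) < min (snd i) (snd j)" by auto
    then obtain t where "max (fst i) (fst j) < t" "t < min (snd i) (snd j)"
      using dense by blast
    then have "v t \<in> {v (fst i)<..<v (snd i)} \<inter> {v (fst j)<..<v (snd j)}"
      using v(1) by (auto simp: strict_mono_def)
    then show False using disj_v[OF that] by blast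
  qed
  have "emeasure lborel (v ` E) \<le> emeasure lborel (?V \<union> (v ` E - ?V))"
    using vE V_meas by (intro emeasure_mono) auto
  also have "\<dots> \<le> emeasure lborel ?V + emeasure lborel (v ` E - ?V)"
    using vE V_meas by (intro emeasure_subadditive) auto
  also have "emeasure lborel (v ` E - ?V) = 0"
  proof -
    have "v ` E - ?V \<in> null_sets lebesgue"
      using neg by (simp add: negligible_iff_null_sets)
    then show ?thesis
      using vE V_meas by (subst (asm) null_sets_completion_iff) auto
  qed
  also have "emeasure lborel ?V = (\<integral>\<^sup>+i. emeasure lborel {v (fst i)<..<v (snd i)} \<partial>count_space C)"
    using C(1) disj_v by (intro emeasure_UN_countable) (auto simp: disjoint_family_on_def)
  also have "\<dots> \<le> (\<integral>\<^sup>+i. ennreal p * emeasure lborel {fst i<..<snd i} \<partial>count_space C)"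
  proof (rule nn_integral_mono)
    fix i assume "i \<in> space (count_space C)"
    then have i: "fst i < snd i" "v (snd i) - v (fst i) < p * (snd i - fst i)"
      using C(2) by (auto simp: K_def)
    then have "v (fst i) \<le> v (snd i)"
      using v(1) by (simp add: strict_mono_less_eq)
    then show "emeasure lborel {v (fst i)<..<v (snd i)} \<le> ennreal p * emeasure lborel {fst i<..<snd i}"
      using i p by (simp add: ennreal_mult[symmetric] ennreal_leI)
  qed
  also have "\<dots> = ennreal p * (\<integral>\<^sup>+i. emeasure lborel {fst i<..<snd i} \<partial>count_space C)"
    by (rule nn_integral_cmult) simp
  also have "(\<integral>\<^sup>+i. emeasure lborel {fst i<..<snd i} \<partial>count_space C)
      = emeasure lborel (\<Union>i\<in>C. {fst i<..<snd i})"
    using C(1) disj by (intro emeasure_UN_countable[symmetric]) (auto simp: disjoint_family_on_def)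
  also have "\<dots> \<le> emeasure lborel U"
  proof (rule emeasure_mono)
    have "{fst i<..<snd i} \<subseteq> U" if "i \<in> C" for i
      using C(2) that by (cases i) (auto simp: K_def)
    then show "(\<Union>i\<in>C. {fst i<..<snd i}) \<subseteq> U" by blast
  qed (use U in simp)
  also have "emeasure lborel U \<le> emeasure lborel E + ennreal (e / p)"
  proof -
    have "emeasure lborel U \<le> emeasure lborel (E \<union> (U - E))"
      using U E by (intro emeasure_mono) auto
    also have "\<dots> \<le> emeasure lborel E + emeasure lborel (U - E)"
      using U E by (intro emeasure_subadditive) auto
    finally show ?thesis using UE by (meson add_left_mono less_imp_le order_trans)
  qed
  finally have "emeasure lborel (v ` E) \<le> ennreal p * (emeasure lborel E + ennreal (e / p))"
    by (simp add: mult_left_mono)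
  also have "\<dots> = ennreal p * emeasure lborel E + ennreal e"
    using p \<open>0 < e\<close> by (simp add: distrib_left ennreal_mult[symmetric])
  finally show "emeasure lborel (v ` E) \<le> ennreal p * emeasure lborel E + ennreal e" .
qed

text \<open>
  With \<open>g x = v x - p x\<close> this is the set of points that lie in arbitrarily short intervals on which the
  mean slope of \<open>v\<close> is below \<open>p\<close>. The points are interior to the intervals, so that the set is a
  countable intersection of open sets and hence measurable.
\<close>

definition descent_points :: "(real \<Rightarrow> real) \<Rightarrow> real set" where
  "descent_points g = {x. \<forall>n::nat. \<exists>a b. a < x \<and> x < b \<and> b - a < 1 / Suc n \<and> g b < g a}"

lemma descent_points_borel: "descent_points g \<in> sets borel"
proof -
  have "descent_points g
      = (\<Inter>n::nat. \<Union>i\<in>{i. snd i - fst i < 1 / Suc n \<and> g (snd i) < g (fst i)}. {fst i<..<snd i})"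
    unfolding descent_points_def by (simp add: set_eq_iff split_paired_Ex) metis
  moreover have "(\<Union>i\<in>{i. snd i - fst i < 1 / Suc n \<and> g (snd i) < g (fst i)}. {fst i<..<snd i}) \<in> sets borel"
    for n :: nat
    by (intro borel_open open_UN) auto
  ultimately show ?thesis by (simp add: sets.countable_INT')
qed

lemma descent_pointsD:
  assumes "x \<in> descent_points g" "0 < d"
  shows "\<exists>a b. a < x \<and> x < b \<and> b - a < d \<and> g b < g a"
proof -
  obtain n where "1 / Suc n < d"
    using reals_Archimedean[OF assms(2)] by (auto simp: inverse_eq_divide)
  moreover obtain a b where "a < x" "x < b" "b - a < 1 / Suc n" "g b < g a"
    using assms(1) unfolding descent_points_def by blast
  ultimately show ?thesis by (intro exI[of _ a] exI[of _ b]) auto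
qed

text \<open>
  A one-sided difference quotient uses an interval that has \<open>x\<close> as an endpoint. By continuity the
  interval can be enlarged a little on both sides.
\<close>

lemma descent_pointsI:
  assumes cont: "continuous_on UNIV g"
    and frq: "\<exists>\<^sub>F h in at 0. (g (x + h) - g x) / h < 0"
  shows "x \<in> descent_points g"
  unfolding descent_points_def
proof (intro CollectI allI)
  fix n :: nat
  define d where "d = 1 / real (Suc n) / 2"
  have "0 < d" by (simp add: d_def)
  then have "\<forall>\<^sub>F h in at 0. \<bar>h\<bar> < d"
    unfolding eventually_at by (intro exI[of _ d]) auto
  then have "\<exists>\<^sub>F h in at 0. \<bar>h\<bar> < d \<and> (g (x + h) - g x) / h < 0"
    by (intro frequently_rev_mp[OF frq]) (auto elim: eventually_mono)
  then have "\<exists>h. \<bar>h\<bar> < d \<and> (g (x + h) - g x) / h < 0"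
    by (rule frequently_ex)
  then obtain h where h: "\<bar>h\<bar> < d" "(g (x + h) - g x) / h < 0" by blast
  define a b where "a = min x (x + h)" and "b = max x (x + h)"
  have ab: "a \<le> x" "x \<le> b" "b - a < d" "g b < g a"
    using h by (auto simp: a_def b_def min_def max_def divide_less_0_iff split: if_splits)
  have "((\<lambda>t. g (b + t) - g (a - t)) \<longlongrightarrow> g (b + 0) - g (a - 0)) (at_right 0)"
    using cont by (intro tendsto_intros continuous_on_tendsto_compose[OF cont]) auto
  then have "\<forall>\<^sub>F t in at_right 0. g (b + t) - g (a - t) < 0"
    using ab(4) by (intro order_tendstoD) auto
  moreover have "\<forall>\<^sub>F t in at_right 0. t < d / 2"
    using \<open>0 < d\<close> by (intro eventually_at_right_less order_tendstoD(2)[OF tendsto_ident_at]) auto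
  moreover have "\<forall>\<^sub>F t in at_right (0::real). 0 < t"
    by (rule eventually_at_right_less)
  ultimately have "\<forall>\<^sub>F t in at_right 0. g (b + t) < g (a - t) \<and> t < d / 2 \<and> 0 < t"
    by eventually_elim auto
  then obtain t where t: "g (b + t) < g (a - t)" "t < d / 2" "0 < t"
    using eventually_happens[of _ "at_right (0::real)"] trivial_limit_at_right_real by blast
  have "1 / real (Suc n) = 2 * d" by (simp add: d_def del: of_nat_Suc)
  then show "\<exists>a b. a < x \<and> x < b \<and> b - a < 1 / real (Suc n) \<and> g b < g a"
    using ab t by (intro exI[of _ "a - t"] exI[of _ "b + t"]) auto
qed

text \<open>
  On the set \<open>E\<close> of points with slopes below \<open>p\<close> and above \<open>q\<close> at arbitrarily small scales, the slope
  bound for \<open>v\<close> gives \<open>\<bar>v ` E\<bar> \<le> p \<bar>E\<bar>\<close>, and the slope bound for its inverse \<open>w\<close> gives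
  \<open>\<bar>E\<bar> \<le> \<bar>v ` E\<bar> / q\<close>. If \<open>p < q\<close> and \<open>\<bar>E\<bar>\<close> is finite, then \<open>\<bar>E\<bar> = 0\<close>.
\<close>

lemma negligible_slope_oscillation:
  fixes v w :: "real \<Rightarrow> real"
  assumes v: "strict_mono v" "continuous_on UNIV v"
    and w: "strict_mono w" "continuous_on UNIV w" "\<And>x. w (v x) = x" "\<And>y. v (w y) = y"
    and pq: "0 < p" "p < q"
  shows "descent_points (\<lambda>x. v x - p * x) \<inter> descent_points (\<lambda>x. q * x - v x) \<in> null_sets lborel"
    (is "?E \<in> _")
proof -
  have E: "?E \<in> sets borel" by (intro sets.Int descent_points_borel)
  \<comment> \<open>Bounded pieces have finite measure, so that \<open>m \<le> p / q \<cdot> m\<close> forces \<open>m = 0\<close>.\<close>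
  have zero: "emeasure lborel (?E \<inter> {-real N..real N}) = 0" (is "emeasure lborel ?F = 0") for N :: nat
  proof -
    have F: "?F \<in> sets borel" using E by auto
    have up: "emeasure lborel (v ` ?F) \<le> ennreal p * emeasure lborel ?F"
    proof (rule emeasure_image_le_slope[OF v w(2-4) F pq(1)])
      fix x d :: real assume "x \<in> ?F" "0 < d"
      then obtain a b where "a < x" "x < b" "b - a < d" "v b - p * b < v a - p * a"
        using descent_pointsD[of x "\<lambda>x. v x - p * x" d] by blast
      then show "\<exists>a b. a < x \<and> x < b \<and> b - a < d \<and> v b - v a < p * (b - a)"
        by (intro exI[of _ a] exI[of _ b]) (auto simp: algebra_simps)
    qed
    have down: "emeasure lborel (w ` (v ` ?F)) \<le> ennreal (1 / q) * emeasure lborel (v ` ?F)"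
    proof (rule emeasure_image_le_slope[OF w(1,2) v(2) w(4,3)])
      have "v ` ?F = w -` ?F"
      proof
        show "v ` ?F \<subseteq> w -` ?F" using w(3) by auto
        show "w -` ?F \<subseteq> v ` ?F"
        proof
          fix y assume "y \<in> w -` ?F"
          then have "v (w y) \<in> v ` ?F" by blast
          then show "y \<in> v ` ?F" by (simp only: w(4))
        qed
      qed
      then show "v ` ?F \<in> sets borel"
        using measurable_sets[OF borel_measurable_continuous_onI[OF w(2)] F] by simp
      show "0 < 1 / q" using pq by simp
      fix y d :: real assume "y \<in> v ` ?F" and d: "0 < d"
      then obtain x where x: "x \<in> descent_points (\<lambda>x. q * x - v x)" "y = v x" by blast
      have "continuous (at x) v" using v(2) by (simp add: continuous_on_eq_continuous_at)
      then obtain s where s: "0 < s" "\<And>t. \<bar>t - x\<bar> < s \<Longrightarrow> \<bar>v t - v x\<bar> < d / 2"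
        using d unfolding continuous_at_eps_delta dist_real_def
        by (metis half_gt_zero)
      obtain a b where ab: "a < x" "x < b" "b - a < s" "q * b - v b < q * a - v a"
        using descent_pointsD[OF x(1) s(1)] by blast
      have "v b - v a < d"
        using s(2)[of a] s(2)[of b] ab by linarith
      moreover have "v a < y" "y < v b"
        using ab x v(1) by (auto simp: strict_mono_def)
      moreover have "w (v b) - w (v a) < 1 / q * (v b - v a)"
        using ab pq by (simp add: w(3) field_simps)
      ultimately show "\<exists>a b. a < y \<and> y < b \<and> b - a < d \<and> w b - w a < 1 / q * (b - a)"
        by blast
    qed
    have fin: "emeasure lborel ?F < \<infinity>"
      by (rule le_less_trans[OF emeasure_mono[of ?F "{-real N..real N}"]]) auto
    then obtain m where m: "emeasure lborel ?F = ennreal m" "0 \<le> m"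
      by (cases "emeasure lborel ?F") auto
    have "w ` (v ` ?F) = ?F" using w(3) by (auto simp: image_image)
    then have "ennreal m \<le> ennreal (1 / q) * (ennreal p * ennreal m)"
      using down up m by (metis mult_left_mono order_trans zero_le)
    also have "\<dots> = ennreal (p / q * m)"
      using pq m by (simp add: ennreal_mult[symmetric])
    finally have "m \<le> p / q * m"
      using pq m by (simp add: ennreal_le_iff)
    moreover have "p / q < 1" using pq by simp
    ultimately have "m = 0"
      using m(2) mult_strict_right_mono[of "p / q" 1 m] by force
    then show ?thesis using m by simp
  qed
  have E_eq: "?E = (\<Union>N::nat. ?E \<inter> {-real N..real N})"
  proof -
    have "\<exists>N. - real N \<le> x \<and> x \<le> real N" for x
    proof -
      obtain N where "\<bar>x\<bar> \<le> real N" using real_arch_simple by blast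
      then show ?thesis by (intro exI[of _ N]) linarith
    qed
    then show ?thesis by fastforce
  qed
  have "(\<Union>N::nat. ?E \<inter> {-real N..real N}) \<in> null_sets lborel"
    using zero E by (intro null_sets_UN null_setsI) auto
  then show ?thesis by (subst E_eq)
qed

text \<open>
  Adding \<open>(L + 1) x\<close> makes all slopes at least \<open>1\<close>, so that the function becomes an increasing
  homeomorphism. If it is not differentiable at \<open>x\<close>, rational numbers separate the lower and upper
  limits of its difference quotients, and \<open>x\<close> lies in one of countably many null sets.
\<close>

lemma lipschitz_differentiable_ae_real:
  fixes u :: "real \<Rightarrow> real"
  assumes lip: "\<And>x y. \<bar>u x - u y\<bar> \<le> L * \<bar>x - y\<bar>"
  shows "AE x in lborel. u differentiable (at x)"
proof -
  have L: "0 \<le> L"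
    using lip[of 1 0] by simp
  define v where "v x = u x + (L + 1) * x" for x
  have slope: "y - x \<le> v y - v x" "v y - v x \<le> (2 * L + 1) * (y - x)" if "x \<le> y" for x y
    using lip[of y x] that by (auto simp: v_def algebra_simps abs_le_iff)
  have v: "strict_mono v"
  proof (rule strict_monoI)
    fix x y :: real
    assume "x < y"
    then show "v x < v y" using slope(1)[of x y] by simp
  qed
  have "L-lipschitz_on UNIV u"
    using lip L by (intro lipschitz_onI) (auto simp: dist_real_def)
  then have v_cont: "continuous_on UNIV v"
    unfolding v_def by (intro continuous_intros lipschitz_on_continuous_on)
  have surj: "\<exists>x. v x = y" for y
  proof -
    have "v (- \<bar>y - v 0\<bar>) \<le> y" "y \<le> v \<bar>y - v 0\<bar>"
      using slope(1)[of "- \<bar>y - v 0\<bar>" 0] slope(1)[of 0 "\<bar>y - v 0\<bar>"] by auto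
    then show ?thesis
      using IVT'[of v "- \<bar>y - v 0\<bar>" y "\<bar>y - v 0\<bar>"] v_cont continuous_on_subset by fastforce
  qed
  define w where "w = inv v"
  have wv: "w (v x) = x" for x
    unfolding w_def by (rule inv_f_f[OF strict_mono_imp_inj_on[OF v]])
  have vw: "v (w y) = y" for y
  proof -
    obtain x where "v x = y" using surj by blast
    then show ?thesis using wv[of x] by simp
  qed
  have w_lip: "\<bar>w x - w y\<bar> \<le> 1 * \<bar>x - y\<bar>" for x y
    using slope(1)[of "w x" "w y"] slope(1)[of "w y" "w x"] by (cases "w x \<le> w y") (auto simp: vw)
  have w: "strict_mono w"
    unfolding strict_mono_def using v vw by (metis strict_mono_less)
  have "1-lipschitz_on UNIV w"
    using w_lip by (intro lipschitz_onI) (auto simp: dist_real_def)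
  then have w_cont: "continuous_on UNIV w"
    by (rule lipschitz_on_continuous_on)
  define E where "E p q = descent_points (\<lambda>x. v x - p * x) \<inter> descent_points (\<lambda>x. q * x - v x)" for p q
  define N where "N = (\<Union>(p, q) \<in> {(p, q). (0::rat) < p \<and> p < q}. E (of_rat p) (of_rat q))"
  have "N \<in> null_sets lborel"
    unfolding N_def
  proof (rule null_sets_UN')
    show "countable {(p, q). (0::rat) < p \<and> p < q}"
      by (rule countable_subset[of _ UNIV]) auto
    fix i assume "i \<in> {(p, q). (0::rat) < p \<and> p < q}"
    then show "(case i of (p, q) \<Rightarrow> E (of_rat p) (of_rat q)) \<in> null_sets lborel"
      using negligible_slope_oscillation[OF v v_cont w w_cont wv vw]
      by (auto simp: E_def of_rat_less)
  qed
  then show ?thesis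
  proof (rule AE_I')
    show "{x \<in> space lborel. \<not> u differentiable (at x)} \<subseteq> N"
    proof clarify
      fix x assume nd: "\<not> u differentiable (at x)"
      define s where "s h = (v (x + h) - v x) / h" for h
      have s_bounds: "1 \<le> s h \<and> s h \<le> 2 * L + 1" if "h \<noteq> 0" for h
        using slope[of x "x + h"] slope[of "x + h" x] that
        by (cases "0 < h") (auto simp: s_def field_simps)
      have s_ev: "\<forall>\<^sub>F h in at 0. 1 \<le> ereal (s h)" "\<forall>\<^sub>F h in at 0. ereal (s h) \<le> 2 * L + 1"
        using s_bounds by (auto simp: eventually_at intro!: exI[of _ 1])
      let ?l = "Liminf (at 0) (\<lambda>h. ereal (s h))" and ?m = "Limsup (at 0) (\<lambda>h. ereal (s h))"
      have l1: "1 \<le> ?l" and m1: "?m \<le> 2 * L + 1"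
        using Liminf_bounded[OF s_ev(1)] Limsup_bounded[OF s_ev(2)] by auto
      have lm: "?l \<le> ?m" by (rule Liminf_le_Limsup) simp
      have "?l \<noteq> ?m"
      proof
        assume eq: "?l = ?m"
        have "\<bar>?l\<bar> \<noteq> \<infinity>" using l1 m1 lm eq by auto
        then obtain D where D: "?l = ereal D" by auto
        have "((\<lambda>h. ereal (s h)) \<longlongrightarrow> ereal D) (at 0)"
          using D eq by (intro Liminf_eq_Limsup) auto
        then have "(v has_real_derivative D) (at x)"
          by (simp add: DERIV_def s_def)
        then have "((\<lambda>x. v x - (L + 1) * x) has_real_derivative D - (L + 1) * 1) (at x)"
          by (auto intro!: derivative_eq_intros)
        then have "(u has_real_derivative D - (L + 1)) (at x)"
          by (simp add: v_def)
        then show False using nd real_differentiable_def by blast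
      qed
      with lm have "?l < ?m" by simp
      then obtain p :: rat where p: "?l < ereal (of_rat p)" "ereal (of_rat p) < ?m"
        using ereal_dense3 by blast
      then obtain q :: rat where q: "ereal (of_rat p) < ereal (of_rat q)" "ereal (of_rat q) < ?m"
        using ereal_dense3 by blast
      have "1 < ereal (of_rat p)" using l1 p(1) by (rule le_less_trans)
      then have "(0::real) < of_rat p" by (simp add: one_ereal_def)
      then have p0: "0 < p" by simp
      have pq: "p < q" using q by (simp add: of_rat_less)
      have freq_p: "\<exists>\<^sub>F h in at 0. s h < of_rat p"
      proof (rule ccontr)
        assume "\<not> ?thesis"
        then have "\<forall>\<^sub>F h in at 0. ereal (of_rat p) \<le> ereal (s h)"
          by (simp add: not_frequently not_less)
        from Liminf_bounded[OF this] show False using p by simp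
      qed
      have freq_q: "\<exists>\<^sub>F h in at 0. of_rat q < s h"
      proof (rule ccontr)
        assume "\<not> ?thesis"
        then have "\<forall>\<^sub>F h in at 0. ereal (s h) \<le> ereal (of_rat q)"
          by (simp add: not_frequently not_less)
        from Limsup_bounded[OF this] show False using q by simp
      qed
      have nz: "\<forall>\<^sub>F h in at (0::real). h \<noteq> 0"
        by (auto simp: eventually_at intro!: exI[of _ 1])
      have "\<exists>\<^sub>F h in at 0. (v (x + h) - of_rat p * (x + h) - (v x - of_rat p * x)) / h < 0"
      proof (rule frequently_rev_mp[OF freq_p eventually_mono[OF nz]], rule impI)
        fix h :: real
        assume h: "h \<noteq> 0" "s h < of_rat p"
        have "(v (x + h) - of_rat p * (x + h) - (v x - of_rat p * x)) / h = s h - of_rat p"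
          using h(1) by (simp add: s_def field_simps)
        then show "(v (x + h) - of_rat p * (x + h) - (v x - of_rat p * x)) / h < 0"
          using h(2) by simp
      qed
      moreover have "\<exists>\<^sub>F h in at 0. (of_rat q * (x + h) - v (x + h) - (of_rat q * x - v x)) / h < 0"
      proof (rule frequently_rev_mp[OF freq_q eventually_mono[OF nz]], rule impI)
        fix h :: real
        assume h: "h \<noteq> 0" "of_rat q < s h"
        have "(of_rat q * (x + h) - v (x + h) - (of_rat q * x - v x)) / h = of_rat q - s h"
          using h(1) by (simp add: s_def field_simps)
        then show "(of_rat q * (x + h) - v (x + h) - (of_rat q * x - v x)) / h < 0"
          using h(2) by simp
      qed
      moreover have "continuous_on UNIV (\<lambda>x. v x - of_rat p * x)"
        "continuous_on UNIV (\<lambda>x. of_rat q * x - v x)"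
        by (intro continuous_intros v_cont)+
      ultimately have "x \<in> E (of_rat p) (of_rat q)"
        unfolding E_def by (intro IntI descent_pointsI)
      then show "x \<in> N" using p0 pq by (auto simp: N_def)
    qed
  qed
qed

theorem lipschitz_differentiable_ae:
  fixes u :: "real \<Rightarrow> complex"
  assumes lip: "\<And>x y. cmod (u x - u y) \<le> L * \<bar>x - y\<bar>"
  shows "AE x in lborel. \<exists>D. (u has_vector_derivative D) (at x)"
proof -
  have "AE x in lborel. (\<lambda>t. Re (u t)) differentiable (at x)"
  proof (rule lipschitz_differentiable_ae_real)
    show "\<bar>Re (u x) - Re (u y)\<bar> \<le> L * \<bar>x - y\<bar>" for x y
      using abs_Re_le_cmod[of "u x - u y"] lip[of x y] by simp
  qed
  moreover have "AE x in lborel. (\<lambda>t. Im (u t)) differentiable (at x)"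
  proof (rule lipschitz_differentiable_ae_real)
    show "\<bar>Im (u x) - Im (u y)\<bar> \<le> L * \<bar>x - y\<bar>" for x y
      using abs_Im_le_cmod[of "u x - u y"] lip[of x y] by simp
  qed
  ultimately show ?thesis
  proof eventually_elim
    case (elim x)
    then obtain a b where "((\<lambda>t. Re (u t)) has_real_derivative a) (at x)"
      "((\<lambda>t. Im (u t)) has_real_derivative b) (at x)"
      by (auto simp: real_differentiable_def)
    then have "((\<lambda>t. Complex (Re (u t)) (Im (u t))) has_vector_derivative Complex a b) (at x)"
      by (simp add: has_vector_derivative_complex_iff has_real_derivative_iff_has_vector_derivative)
    then show ?case by auto
  qed
qed

section \<open>Fatou's theorem for bounded holomorphic functions\<close>

text \<open>
  On the unit circle \<open>1 - cnj z \<zeta> = \<zeta> cnj (\<zeta> - z)\<close>, so the Poisson kernel is a Cauchy integrand for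
  the function \<open>(1 - \<bar>z\<bar>\<^sup>2) / (1 - cnj z \<zeta>)\<close>, whose value at \<open>z\<close> is \<open>1\<close>.
\<close>

lemma poisson_kernel_has_integral:
  assumes z: "cmod z < 1"
  shows "((\<lambda>t. (1 - (cmod z)\<^sup>2) / (cmod (circlepath 0 1 t - z))\<^sup>2) has_integral 1) {0..1}"
proof -
  define g where "g = (\<lambda>\<zeta>. (1 - z * cnj z) / (1 - cnj z * \<zeta>))"
  have nz: "1 - cnj z * \<zeta> \<noteq> 0" if "cmod \<zeta> \<le> 1" for \<zeta>
  proof
    assume "1 - cnj z * \<zeta> = 0"
    then have "cmod (cnj z * \<zeta>) = 1" by simp
    moreover have "cmod z * cmod \<zeta> \<le> cmod z * 1"
      using that by (intro mult_left_mono) auto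
    ultimately show False using z by (simp add: norm_mult)
  qed
  have "g holomorphic_on cball 0 1"
    unfolding g_def using nz by (intro holomorphic_intros) auto
  then have "((\<lambda>\<zeta>. g \<zeta> / (\<zeta> - z)) has_contour_integral (2 * of_real pi * \<i> * g z)) (circlepath 0 1)"
    using z by (intro Cauchy_integral_circlepath_simple) auto
  moreover have "g z = 1"
    using nz[of z] z by (simp add: g_def mult.commute)
  ultimately have "((\<lambda>t. g (circlepath 0 1 t) / (circlepath 0 1 t - z)
      * vector_derivative (circlepath 0 1) (at t within {0..1})) has_integral (2 * of_real pi * \<i>)) {0..1}"
    by (simp add: has_contour_integral_def)
  from has_integral_mult_right[OF this, of "1 / (2 * of_real pi * \<i>)"]
  have "((\<lambda>t. 1 / (2 * of_real pi * \<i>) * (g (circlepath 0 1 t) / (circlepath 0 1 t - z)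
      * vector_derivative (circlepath 0 1) (at t within {0..1}))) has_integral 1) {0..1}"
    by simp
  then have "((\<lambda>t. of_real ((1 - (cmod z)\<^sup>2) / (cmod (circlepath 0 1 t - z))\<^sup>2)) has_integral (1::complex)) {0..1}"
  proof (rule has_integral_eq[rotated])
    fix t :: real
    assume t: "t \<in> {0..1}"
    define \<zeta> where "\<zeta> = circlepath 0 1 t"
    have \<zeta>: "cmod \<zeta> = 1" "\<zeta> = exp (2 * of_real pi * \<i> * t)"
      by (simp_all add: \<zeta>_def circlepath)
    then have one: "\<zeta> * cnj \<zeta> = 1"
      by (simp add: complex_norm_square[symmetric])
    have "\<zeta> \<noteq> z" using \<zeta> z by auto
    have "1 - cnj z * \<zeta> = \<zeta> * cnj (\<zeta> - z)"
      using one by (simp add: algebra_simps)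
    then have "g \<zeta> / (\<zeta> - z) * \<zeta> = (1 - z * cnj z) / ((\<zeta> - z) * cnj (\<zeta> - z))"
      using \<zeta> by (auto simp: g_def)
    also have "\<dots> = of_real ((1 - (cmod z)\<^sup>2) / (cmod (\<zeta> - z))\<^sup>2)"
      by (simp only: of_real_divide of_real_diff of_real_1 complex_norm_square)
    finally have *: "g \<zeta> / (\<zeta> - z) * \<zeta> = of_real ((1 - (cmod z)\<^sup>2) / (cmod (\<zeta> - z))\<^sup>2)" .
    have "vector_derivative (circlepath 0 1) (at t within {0..1}) = 2 * of_real pi * \<i> * \<zeta>"
      using t \<zeta>(2) by (simp add: vector_derivative_circlepath01)
    then show "1 / (2 * of_real pi * \<i>) * (g (circlepath 0 1 t) / (circlepath 0 1 t - z)
      * vector_derivative (circlepath 0 1) (at t within {0..1}))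
      = of_real ((1 - (cmod z)\<^sup>2) / (cmod (circlepath 0 1 t - z))\<^sup>2)"
      using * unfolding \<zeta>_def[symmetric] by (simp add: field_simps)
  qed
  from has_integral_linear[OF this bounded_linear_Re] show ?thesis
    by (simp add: o_def)
qed

text \<open>
  The Cauchy kernel \<open>1 / (\<zeta> - z)\<^sup>2\<close> of the derivative is not small for \<open>z\<close> near the circle and \<open>\<zeta>\<close>
  away from \<open>z\<close>: multiplied by \<open>\<bar>\<zeta> - z\<bar>\<close> it still has integrals that grow logarithmically. Subtracting
  the kernel of the reflected point \<open>1 / cnj z\<close> gains the factor \<open>(1 - \<bar>z\<bar>\<^sup>2) / \<bar>\<zeta> - z\<bar>\<close>.
\<close>

lemma reflected_kernel_bound:
  fixes z \<zeta> :: complex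
  assumes z: "z \<noteq> 0" "cmod z < 1" and \<zeta>: "cmod \<zeta> = 1"
  shows "cmod (1 / (\<zeta> - z)\<^sup>2 - 1 / (\<zeta> - 1 / cnj z)\<^sup>2) \<le> 2 * (1 - (cmod z)\<^sup>2) / (cmod (\<zeta> - z)) ^ 3"
proof -
  define w where "w = 1 / cnj z"
  define r where "r = cmod z"
  have r: "0 < r" "r < 1" using z by (auto simp: r_def)
  define d where "d = cmod (\<zeta> - z)"
  have d: "0 < d" using z \<zeta> by (auto simp: d_def)
  have one: "\<zeta> * cnj \<zeta> = 1"
    using \<zeta> by (simp add: complex_norm_square[symmetric])
  have "cnj z * (\<zeta> - w) = - (\<zeta> * cnj (\<zeta> - z))"
    using one z by (simp add: w_def algebra_simps)
  then have "r * cmod (\<zeta> - w) = d"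
    using \<zeta> by (metis norm_mult norm_minus_cancel complex_mod_cnj r_def d_def mult_1)
  then have dw: "cmod (\<zeta> - w) = d / r" using r by (simp add: field_simps)
  then have "\<zeta> - w \<noteq> 0" using d r by auto
  moreover have "\<zeta> - z \<noteq> 0" using d by (auto simp: d_def)
  ultimately have eq: "1 / (\<zeta> - z)\<^sup>2 - 1 / (\<zeta> - w)\<^sup>2
      = (z - w) * ((\<zeta> - z) + (\<zeta> - w)) / ((\<zeta> - z)\<^sup>2 * (\<zeta> - w)\<^sup>2)"
    by (simp add: divide_simps) (simp add: power2_eq_square algebra_simps)
  have zw: "cmod (z - w) = (1 - r\<^sup>2) / r"
  proof -
    have "cnj z * (z - w) = of_real (r\<^sup>2 - 1)"
      using z complex_norm_square[of z] by (simp add: w_def r_def algebra_simps)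
    then have "r * cmod (z - w) = \<bar>r\<^sup>2 - 1\<bar>"
      by (metis norm_mult norm_of_real complex_mod_cnj r_def)
    moreover have "r\<^sup>2 \<le> 1" using r by (simp add: power_le_one)
    ultimately show ?thesis using r by (simp add: field_simps)
  qed
  have "cmod (1 / (\<zeta> - z)\<^sup>2 - 1 / (\<zeta> - w)\<^sup>2)
      = (1 - r\<^sup>2) / r * cmod ((\<zeta> - z) + (\<zeta> - w)) / (d\<^sup>2 * (d / r)\<^sup>2)"
    unfolding eq by (simp add: norm_mult norm_divide norm_power zw dw d_def[symmetric])
  also have "\<dots> \<le> (1 - r\<^sup>2) / r * (d + d / r) / (d\<^sup>2 * (d / r)\<^sup>2)"
    using r norm_triangle_ineq[of "\<zeta> - z" "\<zeta> - w"]
    by (intro divide_right_mono mult_left_mono) (auto simp: dw d_def[symmetric] power_le_one)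
  also have "\<dots> = (1 - r\<^sup>2) * (r + 1) / d ^ 3"
    using r d by (simp add: divide_simps) (simp add: power2_eq_square power3_eq_cube power4_eq_xxxx algebra_simps)
  also have "\<dots> \<le> (1 - r\<^sup>2) * 2 / d ^ 3"
    using r d by (intro divide_right_mono mult_left_mono) (auto simp: power_le_one)
  finally show ?thesis by (simp add: w_def r_def d_def mult.commute)
qed

text \<open>
  The reflected kernel contributes nothing to the Cauchy integral, since the reflected point lies
  outside the disc. The hypothesis compares the corrected integrand with the Poisson kernel.
\<close>

lemma derivative_bound_by_reflected_kernel:
  assumes cont: "continuous_on (cball 0 1) h" and hol: "h holomorphic_on ball 0 1"
    and z: "z \<noteq> 0" "cmod z < 1" and nonneg: "0 \<le> a" "0 \<le> b"
    and bound: "\<And>\<zeta>. cmod \<zeta> = 1 \<Longrightarrow> cmod (h \<zeta>) * (2 * (1 - (cmod z)\<^sup>2) / (cmod (\<zeta> - z)) ^ 3)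
        \<le> a * ((1 - (cmod z)\<^sup>2) / (cmod (\<zeta> - z))\<^sup>2) + b"
  shows "cmod (deriv h z) \<le> a + b"
proof -
  define w where "w = 1 / cnj z"
  define k where "k = (\<lambda>\<zeta>. 1 / (\<zeta> - z)\<^sup>2 - 1 / (\<zeta> - w)\<^sup>2)"
  let ?C = "circlepath 0 (1::real)"
  have w: "1 < cmod w" using z by (simp add: w_def norm_divide)
  have inside: "(\<lambda>\<zeta>. h \<zeta> / (\<zeta> - z)\<^sup>2) contour_integrable_on ?C"
    "(h has_field_derivative (1 / (2 * of_real pi * \<i>) * contour_integral ?C (\<lambda>\<zeta>. h \<zeta> / (\<zeta> - z)\<^sup>2))) (at z)"
    using z by (intro Cauchy_derivative_integral_circlepath[OF cont hol]; simp)+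
  have outside: "((\<lambda>\<zeta>. h \<zeta> / (\<zeta> - w)\<^sup>2) has_contour_integral 0) ?C"
  proof (rule Cauchy_theorem_convex)
    have "\<zeta> \<noteq> w" if "cmod \<zeta> \<le> 1" for \<zeta> using w that by auto
    then show "continuous_on (cball 0 1) (\<lambda>\<zeta>. h \<zeta> / (\<zeta> - w)\<^sup>2)"
      by (intro continuous_intros cont) auto
    show "(\<lambda>\<zeta>. h \<zeta> / (\<zeta> - w)\<^sup>2) field_differentiable at x" if "x \<in> interior (cball 0 1) - {}" for x
    proof -
      have x: "x \<in> ball 0 1" using that by simp
      then have "x \<noteq> w" using w by auto
      moreover have "h field_differentiable at x"
        using hol x holomorphic_on_imp_differentiable_at by blast
      ultimately show ?thesis
        by (intro derivative_intros) auto
    qed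
  qed auto
  have int: "((\<lambda>\<zeta>. h \<zeta> * k \<zeta>) has_contour_integral (2 * of_real pi * \<i> * deriv h z)) ?C"
  proof -
    have "((\<lambda>\<zeta>. h \<zeta> / (\<zeta> - z)\<^sup>2 - h \<zeta> / (\<zeta> - w)\<^sup>2) has_contour_integral
        (contour_integral ?C (\<lambda>\<zeta>. h \<zeta> / (\<zeta> - z)\<^sup>2) - 0)) ?C"
      by (intro has_contour_integral_diff has_contour_integral_integral inside(1) outside)
    moreover have "contour_integral ?C (\<lambda>\<zeta>. h \<zeta> / (\<zeta> - z)\<^sup>2) = 2 * of_real pi * \<i> * deriv h z"
      using DERIV_imp_deriv[OF inside(2)] by simp
    ultimately show ?thesis by (simp add: k_def algebra_simps)
  qed
  let ?f = "\<lambda>t. h (?C t) * k (?C t) * vector_derivative ?C (at t within {0..1})"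
  let ?g = "\<lambda>t. 2 * pi * (a * ((1 - (cmod z)\<^sup>2) / (cmod (?C t - z))\<^sup>2) + b)"
  have f: "(?f has_integral (2 * of_real pi * \<i> * deriv h z)) {0..1}"
    using int by (simp add: has_contour_integral_def)
  have g: "(?g has_integral (2 * pi * (a * 1 + b))) {0..1}"
    using has_integral_const_real[of b 0 1]
    by (intro has_integral_mult_right has_integral_add poisson_kernel_has_integral z) simp
  have "norm (integral {0..1} ?f) \<le> integral {0..1} ?g"
  proof (rule integral_norm_bound_integral)
    show "norm (?f t) \<le> ?g t" if t: "t \<in> {0..1}" for t
    proof -
      have C: "cmod (?C t) = 1" by (simp add: circlepath)
      have "cmod (vector_derivative ?C (at t within {0..1})) = 2 * pi"
        using t by (simp add: vector_derivative_circlepath01 norm_mult)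
      then have "norm (?f t) = 2 * pi * (cmod (h (?C t)) * cmod (k (?C t)))"
        by (simp add: norm_mult)
      also have "\<dots> \<le> 2 * pi * (cmod (h (?C t)) * (2 * (1 - (cmod z)\<^sup>2) / (cmod (?C t - z)) ^ 3))"
        unfolding k_def w_def by (intro mult_left_mono reflected_kernel_bound z C) auto
      also have "\<dots> \<le> ?g t"
        by (intro mult_left_mono bound C) auto
      finally show ?thesis .
    qed
  qed (use f g in blast)+
  then have "cmod (2 * of_real pi * \<i> * deriv h z) \<le> 2 * pi * (a + b)"
    unfolding integral_unique[OF f] integral_unique[OF g] by simp
  then show ?thesis by (simp add: norm_mult)
qed

text \<open>
  A point \<open>\<zeta>\<close> of the circle near \<open>cis t\<close> is \<open>cis (t + s)\<close>, where \<open>s\<close> is the imaginary part of a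
  logarithm and is at most twice the distance from \<open>\<zeta>\<close> to \<open>cis t\<close>.
\<close>

lemma tangential_decay:
  assumes h0: "h (cis t) = 0" and der: "((\<lambda>s. h (cis s)) has_vector_derivative 0) (at t)" and e: "0 < e"
  obtains d where "0 < d" "\<And>\<zeta>. cmod \<zeta> = 1 \<Longrightarrow> cmod (\<zeta> - cis t) < d \<Longrightarrow> cmod (h \<zeta>) \<le> e * cmod (\<zeta> - cis t)"
proof -
  have "((\<lambda>s. h (cis s)) has_derivative (\<lambda>x. 0)) (at t)"
    using der by (simp add: has_vector_derivative_def)
  then obtain d where d: "0 < d"
    "\<And>s. \<bar>s - t\<bar> < d \<Longrightarrow> cmod (h (cis s)) \<le> e / 2 * \<bar>s - t\<bar>"
  proof -
    have "\<forall>e>0. \<exists>d>0. \<forall>s. norm (s - t) < d \<longrightarrow>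
        norm (h (cis s) - h (cis t) - 0) \<le> e * norm (s - t)"
      using \<open>((\<lambda>s. h (cis s)) has_derivative (\<lambda>x. 0)) (at t)\<close> unfolding has_derivative_at_alt by blast
    then obtain d where "0 < d" "\<forall>s. norm (s - t) < d \<longrightarrow>
        norm (h (cis s) - h (cis t) - 0) \<le> e / 2 * norm (s - t)"
      using e half_gt_zero by blast
    then show thesis
      using that[of d] h0 by simp
  qed
  show thesis
  proof (rule that)
    show "0 < min (1/2) (d / 2)" using d by simp
    fix \<zeta> assume \<zeta>: "cmod \<zeta> = 1" and close: "cmod (\<zeta> - cis t) < min (1/2) (d / 2)"
    define w where "w = \<zeta> / cis t - 1"
    have "w = (\<zeta> - cis t) / cis t" by (simp add: w_def diff_divide_distrib)
    then have nw: "cmod w = cmod (\<zeta> - cis t)" by (simp add: norm_divide)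
    define s where "s = Im (Ln (1 + w))"
    have unit: "cmod (1 + w) = 1" using \<zeta> by (simp add: w_def norm_divide)
    then have nz: "1 + w \<noteq> 0" by auto
    have "\<bar>s\<bar> \<le> cmod (Ln (1 + w))" by (simp add: s_def abs_Im_le_cmod)
    also have "\<dots> \<le> 2 * cmod w" using close nw by (intro norm_Ln_le) auto
    finally have s: "\<bar>s\<bar> \<le> 2 * cmod w" .
    have "Ln (1 + w) = \<i> * of_real s"
      using nz unit by (simp add: s_def complex_eq_iff)
    then have "cis s = 1 + w"
      using nz exp_Ln[of "1 + w"] by (simp add: cis_conv_exp)
    then have "cis (t + s) = \<zeta>" by (simp add: w_def flip: cis_mult)
    moreover have "\<bar>t + s - t\<bar> < d" using s close nw by simp
    ultimately have "cmod (h \<zeta>) \<le> e / 2 * \<bar>s\<bar>" using d(2)[of "t + s"] by simp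
    also have "\<dots> \<le> e / 2 * (2 * cmod w)" using s e by (intro mult_left_mono) auto
    finally show "cmod (h \<zeta>) \<le> e * cmod (\<zeta> - cis t)" by (simp add: nw)
  qed
qed

lemma has_vector_derivative_cis: "(cis has_vector_derivative \<i> * cis t) (at t)"
  by (auto simp: has_vector_derivative_complex_iff intro!: derivative_eq_intros)

text \<open>
  Subtracting the first-order expansion of \<open>G\<close> at \<open>\<xi> = cis t\<close> leaves a function \<open>h\<close> with derivative
  \<open>F - c\<close> and \<open>h \<zeta> = o (\<bar>\<zeta> - \<xi>\<bar>)\<close> on the circle. In a Stolz region
  \<open>\<bar>\<zeta> - \<xi>\<bar> \<le> (1 + M) \<bar>\<zeta> - z\<bar>\<close>, so near \<open>\<xi>\<close> the corrected integrand is at most a small multiple of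
  the Poisson kernel, while away from \<open>\<xi>\<close> it tends to zero uniformly.
\<close>

lemma nontangential_limit_of_derivative:
  assumes cont: "continuous_on (cball 0 1) G"
    and G: "\<And>z. z \<in> ball 0 1 \<Longrightarrow> (G has_field_derivative F z) (at z)"
    and der: "((\<lambda>s. G (cis s)) has_vector_derivative D) (at t)"
  shows "has_nontangential_limit F (cis t) (D / (\<i> * cis t))"
  unfolding has_nontangential_limit_def
proof (intro allI impI)
  fix M :: real
  assume M: "1 < M"
  define \<xi> where "\<xi> = cis t"
  define c where "c = D / (\<i> * \<xi>)"
  define h where "h \<zeta> = G \<zeta> - G \<xi> - c * (\<zeta> - \<xi>)" for \<zeta>
  have h_cont: "continuous_on (cball 0 1) h"
    unfolding h_def by (intro continuous_intros cont)
  have h_der: "(h has_field_derivative (F z - c)) (at z)" if "z \<in> ball 0 1" for z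
    unfolding h_def using G[OF that] by (auto intro!: derivative_eq_intros)
  then have h_hol: "h holomorphic_on ball 0 1"
    by (meson field_differentiable_at_within field_differentiable_def holomorphic_on_def)
  have cis_der: "(cis has_vector_derivative \<i> * \<xi>) (at t)"
    unfolding \<xi>_def by (rule has_vector_derivative_cis)
  have "((\<lambda>s. h (cis s)) has_vector_derivative (D - 0 - c * (\<i> * \<xi> - 0))) (at t)"
    unfolding h_def
    by (intro has_vector_derivative_diff has_vector_derivative_mult_right der cis_der
        has_vector_derivative_const)
  then have h_flat: "((\<lambda>s. h (cis s)) has_vector_derivative 0) (at t)"
    by (simp add: c_def \<xi>_def)
  obtain A where A: "0 < A" "\<And>\<zeta>. cmod \<zeta> \<le> 1 \<Longrightarrow> cmod (h \<zeta>) \<le> A"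
    using compact_imp_bounded[OF compact_continuous_image[OF h_cont compact_cball]]
    unfolding bounded_pos by auto
  show "(F \<longlongrightarrow> D / (\<i> * cis t)) (at (cis t) within stolz_region M (cis t))"
    unfolding \<xi>_def[symmetric] c_def[symmetric]
  proof (rule tendstoI)
    fix e :: real
    assume e: "0 < e"
    \<comment> \<open>With these constants the bound \<open>2 \<epsilon> (1 + M)\<close> near \<open>\<xi>\<close> and the bound \<open>Q \<eta>\<close> away from \<open>\<xi>\<close> are each at most \<open>e / 4\<close>.\<close>
    define \<epsilon> where "\<epsilon> = e / (8 * (1 + M))"
    have "0 < \<epsilon>" using e M by (simp add: \<epsilon>_def)
    then obtain d where d: "0 < d"
      "\<And>\<zeta>. cmod \<zeta> = 1 \<Longrightarrow> cmod (\<zeta> - \<xi>) < d \<Longrightarrow> cmod (h \<zeta>) \<le> \<epsilon> * cmod (\<zeta> - \<xi>)"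
      using tangential_decay[of h t \<epsilon>] h_flat by (auto simp: h_def \<xi>_def)
    define Q where "Q = 4 * A * (1 + M) ^ 3 / d ^ 3"
    have Q: "0 < Q" using A M d by (simp add: Q_def)
    define \<eta> where "\<eta> = min (1/2) (e / (4 * Q))"
    have "0 < \<eta>" using e Q by (simp add: \<eta>_def)
    moreover have "dist (F z) c < e" if z: "z \<in> stolz_region M \<xi>" and dz: "dist z \<xi> < \<eta>" for z
    proof -
      have z1: "cmod z < 1" and zM: "cmod (z - \<xi>) < M * (1 - cmod z)"
        using z by (auto simp: stolz_region_def)
      have z\<eta>: "cmod (z - \<xi>) < \<eta>" using dz by (simp add: dist_norm)
      then have "cmod (z - \<xi>) < 1" by (simp add: \<eta>_def)
      then have z0: "z \<noteq> 0" by (auto simp: \<xi>_def)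
      have "1 - cmod z \<le> cmod (z - \<xi>)"
        using norm_triangle_ineq2[of \<xi> z] by (simp add: \<xi>_def norm_minus_commute)
      then have "1 - cmod z \<le> \<eta>" using z\<eta> by simp
      then have small: "1 - (cmod z)\<^sup>2 \<le> 2 * \<eta>"
        using z1 mult_right_mono[of "1 + cmod z" 2 "1 - cmod z"]
        by (simp add: power2_eq_square algebra_simps)
      have pos: "0 \<le> 1 - (cmod z)\<^sup>2" using z1 by (simp add: power_le_one)
      have "cmod (deriv h z) \<le> 2 * \<epsilon> * (1 + M) + Q * \<eta>"
      proof (rule derivative_bound_by_reflected_kernel[OF h_cont h_hol z0 z1])
        show "0 \<le> 2 * \<epsilon> * (1 + M)" using \<open>0 < \<epsilon>\<close> M by simp
        show "0 \<le> Q * \<eta>" using Q \<open>0 < \<eta>\<close> by simp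
        fix \<zeta> assume \<zeta>: "cmod \<zeta> = 1"
        define r where "r = cmod (\<zeta> - z)"
        have "1 - cmod z \<le> r"
          using norm_triangle_ineq2[of \<zeta> z] by (simp add: r_def \<zeta>)
        then have "M * (1 - cmod z) \<le> M * r"
          using M by (intro mult_left_mono) auto
        then have "cmod (z - \<xi>) \<le> M * r"
          using zM by linarith
        then have r\<xi>: "cmod (\<zeta> - \<xi>) \<le> (1 + M) * r"
          using norm_triangle_ineq[of "\<zeta> - z" "z - \<xi>"] by (simp add: r_def algebra_simps)
        have r: "0 < r" using \<zeta> z1 by (auto simp: r_def)
        show "cmod (h \<zeta>) * (2 * (1 - (cmod z)\<^sup>2) / cmod (\<zeta> - z) ^ 3)
           \<le> 2 * \<epsilon> * (1 + M) * ((1 - (cmod z)\<^sup>2) / (cmod (\<zeta> - z))\<^sup>2) + Q * \<eta>"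
        proof (cases "cmod (\<zeta> - \<xi>) < d")
          case True
          have "cmod (h \<zeta>) \<le> \<epsilon> * cmod (\<zeta> - \<xi>)" using d(2)[OF \<zeta> True] .
          also have "\<dots> \<le> \<epsilon> * ((1 + M) * r)" using r\<xi> \<open>0 < \<epsilon>\<close> by (intro mult_left_mono) auto
          finally have "cmod (h \<zeta>) * (2 * (1 - (cmod z)\<^sup>2) / r ^ 3)
              \<le> \<epsilon> * ((1 + M) * r) * (2 * (1 - (cmod z)\<^sup>2) / r ^ 3)"
            using pos r by (intro mult_right_mono) auto
          also have "\<dots> = 2 * \<epsilon> * (1 + M) * ((1 - (cmod z)\<^sup>2) / r\<^sup>2)"
            using r by (simp add: power2_eq_square power3_eq_cube)
          finally show ?thesis using Q \<open>0 < \<eta>\<close> by (simp add: r_def add_increasing2)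
        next
          case False
          then have "d \<le> (1 + M) * r" using r\<xi> by simp
          then have "d ^ 3 \<le> ((1 + M) * r) ^ 3" using d(1) by (intro power_mono) auto
          then have "d ^ 3 \<le> (1 + M) ^ 3 * r ^ 3" by (simp only: power_mult_distrib)
          then have r3: "1 / r ^ 3 \<le> (1 + M) ^ 3 / d ^ 3"
            using r d(1) by (simp add: divide_simps mult.commute)
          have "cmod (h \<zeta>) * (2 * (1 - (cmod z)\<^sup>2) / r ^ 3) = cmod (h \<zeta>) * (2 * (1 - (cmod z)\<^sup>2)) * (1 / r ^ 3)"
            by simp
          also have "\<dots> \<le> A * (2 * (2 * \<eta>)) * ((1 + M) ^ 3 / d ^ 3)"
            using A \<zeta> small pos r r3 \<open>0 < \<eta>\<close> by (intro mult_mono) auto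
          also have "\<dots> = Q * \<eta>" by (simp add: Q_def)
          finally show ?thesis
            using \<open>0 < \<epsilon>\<close> M pos by (simp add: r_def add_increasing)
        qed
      qed
      moreover have "deriv h z = F z - c"
        using h_der z1 by (intro DERIV_imp_deriv) auto
      moreover have "2 * \<epsilon> * (1 + M) = e / 4"
        using M by (simp add: \<epsilon>_def divide_simps)
      moreover have "Q * \<eta> \<le> Q * (e / (4 * Q))"
        using Q by (intro mult_left_mono) (auto simp: \<eta>_def)
      ultimately show ?thesis using Q e by (simp add: dist_norm)
    qed
    ultimately show "\<forall>\<^sub>F z in at \<xi> within stolz_region M \<xi>. dist (F z) c < e"
      unfolding eventually_at by blast
  qed
qed

text \<open>
  The bounded function is the derivative of a Lipschitz function, whose boundary values are
  differentiable almost everywhere.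
\<close>

theorem fatou_nontangential_limits:
  assumes hol: "F holomorphic_on ball 0 1" and bound: "\<And>z. z \<in> ball 0 1 \<Longrightarrow> cmod (F z) \<le> K"
  shows "AE t in lborel. \<exists>l. has_nontangential_limit F (cis t) l"
proof -
  obtain G0 where G0': "\<And>z. z \<in> ball 0 1 \<Longrightarrow> (G0 has_field_derivative F z) (at z within ball 0 1)"
    using holomorphic_convex_primitive'[OF convex_ball open_ball hol] by blast
  then have G0: "(G0 has_field_derivative F z) (at z)" if "z \<in> ball 0 1" for z
    using G0'[OF that] at_within_open[OF that open_ball] by (simp only:)
  have K: "0 \<le> K" using order_trans[OF norm_ge_zero bound[of 0]] by simp
  have "K-lipschitz_on (ball 0 1) G0"
  proof (rule lipschitz_onI)
    fix x y :: complex
    assume xy: "x \<in> ball 0 1" "y \<in> ball 0 1"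
    show "dist (G0 x) (G0 y) \<le> K * dist x y"
      unfolding dist_norm
      by (rule field_differentiable_bound[OF convex_ball G0' bound xy])
  qed (rule K)
  then obtain G where lip: "K-lipschitz_on (closure (ball 0 1)) G" and GG0: "\<And>z. z \<in> ball 0 1 \<Longrightarrow> G z = G0 z"
    using lipschitz_extend_closure by blast
  have lip': "K-lipschitz_on (cball 0 1) G" using lip by simp
  have G: "(G has_field_derivative F z) (at z)" if "z \<in> ball 0 1" for z
    by (rule has_field_derivative_transform_within_open[OF G0[OF that] open_ball that])
       (simp add: GG0)
  have cis_lip: "cmod (cis x - cis y) \<le> \<bar>x - y\<bar>" for x y
  proof -
    have "norm (cis x - cis y) \<le> 1 * norm (x - y)"
    proof (rule differentiable_bound[OF convex_UNIV])
      show "(cis has_derivative (\<lambda>h. h *\<^sub>R (\<i> * cis s))) (at s within UNIV)" for s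
        using has_vector_derivative_cis[of s] by (simp add: has_vector_derivative_def)
      show "onorm (\<lambda>h. h *\<^sub>R (\<i> * cis s)) \<le> 1" for s
        by (rule onorm_bound) (auto simp: norm_mult)
    qed auto
    then show ?thesis by simp
  qed
  have "AE t in lborel. \<exists>D. ((\<lambda>s. G (cis s)) has_vector_derivative D) (at t)"
  proof (rule lipschitz_differentiable_ae)
    fix x y
    have "cmod (G (cis x) - G (cis y)) \<le> K * cmod (cis x - cis y)"
      using lipschitz_onD[OF lip', of "cis x" "cis y"] by (simp add: dist_norm)
    also have "\<dots> \<le> K * \<bar>x - y\<bar>"
      using cis_lip K by (rule mult_left_mono)
    finally show "cmod (G (cis x) - G (cis y)) \<le> K * \<bar>x - y\<bar>" .
  qed
  then show ?thesis
  proof eventually_elim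
    case (elim t)
    then obtain D where "((\<lambda>s. G (cis s)) has_vector_derivative D) (at t)" by blast
    from nontangential_limit_of_derivative[OF lipschitz_on_continuous_on[OF lip'] G this]
    show ?case by blast
  qed
qed

section \<open>Boundary values of bounded holomorphic functions vanish only on null sets\<close>

lemma holomorphic_factor_zero_global:
  assumes q: "q holomorphic_on S" "open S" "connected S" and a: "a \<in> S" and z0: "z0 \<in> S" "q z0 \<noteq> 0"
  obtains m :: nat and g where "g holomorphic_on S" "g a \<noteq> 0" "\<And>z. z \<in> S \<Longrightarrow> q z = (z - a) ^ m * g z"
proof (cases "q a = 0")
  case False
  then show thesis using that[of q 0] q by simp
next
  case True
  then have "\<not> q constant_on S" using a z0 unfolding constant_on_def by metis
  then obtain g r m where gr: "0 < m" "0 < r" "ball a r \<subseteq> S" "g holomorphic_on ball a r"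
    and g: "\<And>w. w \<in> ball a r \<Longrightarrow> q w = (w - a) ^ m * g w" "\<And>w. w \<in> ball a r \<Longrightarrow> g w \<noteq> 0"
    using holomorphic_factor_zero_nonconstant[OF q a True] by metis
  define k where "k z = (if z \<in> ball a r then g z else q z / (z - a) ^ m)" for z
  have k_out: "k z = q z / (z - a) ^ m" if "z \<noteq> a" for z
    using that g(1) by (simp add: k_def)
  have "k holomorphic_on ball a r"
    by (rule holomorphic_transform[OF gr(4)]) (simp add: k_def)
  moreover have "k holomorphic_on (S - {a})"
  proof (rule holomorphic_transform)
    show "(\<lambda>z. q z / (z - a) ^ m) holomorphic_on (S - {a})"
      using q(1) by (intro holomorphic_intros holomorphic_on_subset[OF q(1)]) auto
  qed (auto simp: k_out)
  ultimately have "k holomorphic_on (ball a r \<union> (S - {a}))"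
    using q(2) by (intro holomorphic_on_Un) auto
  moreover have "ball a r \<union> (S - {a}) = S" using gr(2,3) a by auto
  ultimately have "k holomorphic_on S" by simp
  moreover have "k a \<noteq> 0" using gr(2) g(2) by (simp add: k_def)
  moreover have "q z = (z - a) ^ m * k z" if "z \<in> S" for z
    using True gr(1) by (cases "z = a") (simp_all add: k_out)
  ultimately show thesis using that by blast
qed

lemma circle_mean_value:
  fixes k :: "complex \<Rightarrow> complex"
  assumes r: "0 < r" and k: "continuous_on (cball 0 r) k" "k holomorphic_on ball 0 r"
  shows "((\<lambda>t. k (r * cis t)) has_integral (2 * pi * k 0)) {0..2 * pi}"
proof -
  have "((\<lambda>u. k u / (u - 0)) has_contour_integral (2 * of_real pi * \<i> * k 0)) (circlepath 0 r)"
    by (rule Cauchy_integral_circlepath[OF k]) (use r in simp)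
  then have "((\<lambda>t. k (0 + r * cis t) / (0 + r * cis t - 0) * r * \<i> * cis t)
      has_integral (2 * of_real pi * \<i> * k 0)) {0..2 * pi}"
    unfolding circlepath_def by (subst (asm) has_contour_integral_part_circlepath_iff) auto
  from has_integral_mult_right[OF this, of "- \<i>"] show ?thesis
    using r by (simp add: field_simps)
qed

text \<open>
  A function without zeros in \<open>cball 0 r\<close> has no zeros in a slightly larger disc either, and has a
  holomorphic \<open>n\<close>-th root \<open>k\<close> there; the inequality is the mean value property of \<open>k\<close>.
\<close>

lemma root_mean_nonvanishing:
  assumes r: "0 < r" "r < 1" and g: "g holomorphic_on ball 0 1"
    and nz: "\<And>z. z \<in> cball 0 r \<Longrightarrow> g z \<noteq> 0" and n: "0 < n"
  shows "2 * pi * root n (cmod (g 0)) \<le> integral {0..2 * pi} (\<lambda>t. root n (cmod (g (r * cis t))))"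
proof -
  define U where "U = {z \<in> ball 0 1. g z \<noteq> 0}"
  have "open U"
  proof -
    have "open (ball 0 1 \<inter> g -` (- {0}))"
      by (rule continuous_open_preimage[OF holomorphic_on_imp_continuous_on[OF g]]) auto
    moreover have "U = ball 0 1 \<inter> g -` (- {0})" by (auto simp: U_def)
    ultimately show ?thesis by simp
  qed
  moreover have "cball 0 r \<subseteq> U" using nz r by (auto simp: U_def)
  ultimately obtain \<epsilon> where \<epsilon>: "0 < \<epsilon>" "(\<Union>x\<in>cball 0 r. ball x \<epsilon>) \<subseteq> U"
    using compact_subset_open_imp_ball_epsilon_subset[OF compact_cball] by blast
  have sub: "ball 0 (r + \<epsilon>) \<subseteq> U"
  proof
    fix z :: complex assume z: "z \<in> ball 0 (r + \<epsilon>)"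
    show "z \<in> U"
    proof (cases "cmod z \<le> r")
      case True
      then show ?thesis using \<open>cball 0 r \<subseteq> U\<close> by auto
    next
      case False
      define x where "x = of_real (r / cmod z) * z"
      have "0 < cmod z" using False r by linarith
      then have "z \<noteq> 0" by simp
      then have "cmod x = r" using r by (simp add: x_def norm_mult norm_divide)
      moreover have "dist x z < \<epsilon>"
      proof -
        have "x - z = of_real (r / cmod z - 1) * z" by (simp add: x_def algebra_simps)
        then have "cmod (x - z) = \<bar>r / cmod z - 1\<bar> * cmod z" by (simp only: norm_mult norm_of_real)
        also have "\<dots> = cmod z - r" using False \<open>z \<noteq> 0\<close> by (simp add: abs_if field_simps)
        finally show ?thesis using z by (simp add: dist_norm)
      qed
      ultimately have "z \<in> (\<Union>x\<in>cball 0 r. ball x \<epsilon>)"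
        by (intro UN_I[of x]) auto
      then show ?thesis using \<epsilon>(2) by blast
    qed
  qed
  obtain l where l: "l holomorphic_on ball 0 (r + \<epsilon>)" "\<And>z. z \<in> ball 0 (r + \<epsilon>) \<Longrightarrow> exp (l z) = g z"
  proof (rule holomorphic_logarithm_exists[OF convex_ball open_ball, of g 0 "r + \<epsilon>" 0])
    show "g holomorphic_on ball 0 (r + \<epsilon>)"
      by (rule holomorphic_on_subset[OF g]) (use sub in \<open>auto simp: U_def\<close>)
    show "g z \<noteq> 0" if "z \<in> ball 0 (r + \<epsilon>)" for z using sub that by (auto simp: U_def)
    show "0 \<in> ball 0 (r + \<epsilon>)" using r \<epsilon> by simp
  qed (rule that)
  define k where "k z = exp (l z / of_nat n)" for z
  have k: "k holomorphic_on ball 0 (r + \<epsilon>)"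
    unfolding k_def using n by (intro holomorphic_intros l) auto
  have kroot: "cmod (k z) = root n (cmod (g z))" if "z \<in> ball 0 (r + \<epsilon>)" for z
  proof -
    have "k z ^ n = g z" using n l(2)[OF that] by (simp add: k_def flip: exp_of_nat_mult)
    then have "cmod (k z) ^ n = cmod (g z)" by (metis norm_power)
    then show ?thesis using n by (metis norm_ge_zero real_root_power_cancel)
  qed
  have mean: "((\<lambda>t. k (r * cis t)) has_integral (2 * pi * k 0)) {0..2 * pi}"
  proof (rule circle_mean_value)
    have "cball (0::complex) r \<subseteq> ball 0 (r + \<epsilon>)" using \<epsilon> by auto
    then show "continuous_on (cball 0 r) k"
      using holomorphic_on_imp_continuous_on[OF k] continuous_on_subset by blast
    show "k holomorphic_on ball 0 r"
      using \<epsilon> by (intro holomorphic_on_subset[OF k]) auto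
  qed (rule r)
  have circ: "r * cis t \<in> ball 0 (r + \<epsilon>)" for t using r \<epsilon> by (simp add: norm_mult)
  have "norm (integral {0..2 * pi} (\<lambda>t. k (r * cis t)))
      \<le> integral {0..2 * pi} (\<lambda>t. root n (cmod (g (r * cis t))))"
  proof (rule integral_norm_bound_integral)
    show "(\<lambda>t. k (r * cis t)) integrable_on {0..2 * pi}" using mean by blast
    have "continuous_on {0..2 * pi} (\<lambda>t. k (of_real r * cis t))"
      using circ by (intro continuous_on_compose2[OF holomorphic_on_imp_continuous_on[OF k]] continuous_intros) auto
    then have "continuous_on {0..2 * pi} (\<lambda>t. cmod (k (of_real r * cis t)))"
      by (intro continuous_intros)
    then show "(\<lambda>t. root n (cmod (g (r * cis t)))) integrable_on {0..2 * pi}"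
      using integrable_continuous_real by (simp add: kroot[OF circ])
    show "norm (k (r * cis t)) \<le> root n (cmod (g (r * cis t)))" for t
      by (simp only: kroot[OF circ] order_refl)
  qed
  moreover have "norm (integral {0..2 * pi} (\<lambda>t. k (r * cis t))) = 2 * pi * root n (cmod (g 0))"
    using kroot[of 0] r \<epsilon> by (simp add: integral_unique[OF mean] norm_mult)
  ultimately show ?thesis by simp
qed

text \<open>
  For each zero \<open>a\<close>, replace the factor \<open>z - a\<close> by \<open>(r\<^sup>2 - cnj a z) / r\<close>. Both have the same modulus on
  the circle of radius \<open>r\<close>; the new factor has no zeros in the disc and is larger at \<open>0\<close>.
\<close>

lemma remove_zeros:
  assumes r: "0 < r" "r < 1" and "q holomorphic_on ball 0 1" "q 0 \<noteq> 0"
    and "\<And>z. cmod z = r \<Longrightarrow> q z \<noteq> 0"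
  shows "\<exists>g. g holomorphic_on ball 0 1 \<and> (\<forall>z\<in>cball 0 r. g z \<noteq> 0)
      \<and> (\<forall>z. cmod z = r \<longrightarrow> cmod (g z) = cmod (q z)) \<and> cmod (q 0) \<le> cmod (g 0)"
proof -
  have fin: "finite {z \<in> cball 0 r. q z = 0}" if "q holomorphic_on ball 0 1" "q 0 \<noteq> 0" for q :: "complex \<Rightarrow> complex"
  proof (cases "q constant_on ball 0 1")
    case True
    then obtain c where "\<forall>z\<in>ball 0 1. q z = c" by (auto simp: constant_on_def)
    then have "{z \<in> cball 0 r. q z = 0} = {}" using that(2) r by auto
    then show ?thesis by (simp only: finite.emptyI)
  next
    case False
    then show ?thesis
      using r by (intro holomorphic_compact_finite_zeros[OF that(1)]) auto
  qed
  show ?thesis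
    using assms(3-)
  proof (induction "card {z \<in> cball 0 r. q z = 0}" arbitrary: q rule: less_induct)
    case less
    show ?case
    proof (cases "\<exists>a\<in>cball 0 r. q a = 0")
      case False
      then show ?thesis using less.prems by (intro exI[of _ q]) auto
    next
      case True
      then obtain a where a: "cmod a \<le> r" "q a = 0" by auto
      then have ar: "cmod a < r" using less.prems(3)[of a] by fastforce
      have a0: "a \<noteq> 0" using a less.prems by auto
      obtain m k where k: "k holomorphic_on ball 0 1" "k a \<noteq> 0"
        and qk: "\<And>z. z \<in> ball 0 1 \<Longrightarrow> q z = (z - a) ^ m * k z"
        by (rule holomorphic_factor_zero_global[OF less.prems(1) open_ball connected_ball, of a 0])
           (use ar r less.prems in auto)
      define b where "b z = (of_real (r\<^sup>2) - cnj a * z) / of_real r" for z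
      define p where "p z = b z ^ m * k z" for z
      have b_nz: "b z \<noteq> 0" if "cmod z \<le> r" for z
      proof
        assume "b z = 0"
        then have "cnj a * z = of_real (r\<^sup>2)" using r by (simp add: b_def)
        then have "cmod a * cmod z = r\<^sup>2"
          by (metis norm_mult complex_mod_cnj norm_of_real abs_power2)
        moreover have "cmod a * cmod z \<le> cmod a * r" using that by (intro mult_left_mono) auto
        moreover have "cmod a * r < r * r" using ar r by (intro mult_strict_right_mono) auto
        ultimately show False by (simp add: power2_eq_square)
      qed
      have b_circle: "cmod (b z) = cmod (z - a)" if "cmod z = r" for z
      proof -
        have "of_real (r\<^sup>2) = z * cnj z" using that complex_norm_square[of z] by simp
        then have "of_real (r\<^sup>2) - cnj a * z = z * cnj (z - a)" by (simp add: algebra_simps)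
        then have "cmod (b z) = cmod z * cmod (z - a) / r"
          using r by (simp only: b_def norm_divide norm_mult complex_mod_cnj) simp
        then show ?thesis using that r by simp
      qed
      have p_hol: "p holomorphic_on ball 0 1"
        unfolding p_def b_def using r by (intro holomorphic_intros k) auto
      have q0: "q 0 = (- a) ^ m * k 0" using qk[of 0] by simp
      have p0: "p 0 = of_real r ^ m * k 0" using r by (simp add: p_def b_def power2_eq_square)
      have p0_nz: "p 0 \<noteq> 0" using less.prems(2) q0 p0 r by auto
      have p_circle: "cmod (p z) = cmod (q z)" if "cmod z = r" for z
        using qk[of z] that r b_circle[OF that] by (simp add: p_def norm_mult norm_power)
      have p_ge: "cmod (q 0) \<le> cmod (p 0)"
      proof -
        have "cmod a ^ m * cmod (k 0) \<le> r ^ m * cmod (k 0)"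
          using a by (intro mult_right_mono power_mono) auto
        then show ?thesis using r by (simp add: q0 p0 norm_mult norm_power)
      qed
      have "card {z \<in> cball 0 r. p z = 0} < card {z \<in> cball 0 r. q z = 0}"
      proof (rule psubset_card_mono[OF fin[OF less.prems(1,2)]])
        have "q z = 0" if "z \<in> cball 0 r" "p z = 0" for z
          using that b_nz[of z] qk[of z] r by (auto simp: p_def)
        moreover have "p a \<noteq> 0" using b_nz[OF a(1)] k(2) by (simp add: p_def)
        ultimately show "{z \<in> cball 0 r. p z = 0} \<subset> {z \<in> cball 0 r. q z = 0}"
          using a by auto
      qed
      moreover have "p z \<noteq> 0" if "cmod z = r" for z
        using p_circle[OF that] less.prems(3)[OF that] by auto
      ultimately obtain g where "g holomorphic_on ball 0 1" "\<forall>z\<in>cball 0 r. g z \<noteq> 0"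
          "\<forall>z. cmod z = r \<longrightarrow> cmod (g z) = cmod (p z)" "cmod (p 0) \<le> cmod (g 0)"
        using less.hyps[of p] p_hol p0_nz by blast
      then show ?thesis using p_circle p_ge by (intro exI[of _ g]) auto
    qed
  qed
qed

lemma root_mean_inequality:
  assumes r: "0 < r" "r < 1" and q: "q holomorphic_on ball 0 1" "q 0 \<noteq> 0"
    "\<And>z. cmod z = r \<Longrightarrow> q z \<noteq> 0" and n: "0 < n"
  shows "2 * pi * root n (cmod (q 0)) \<le> integral {0..2 * pi} (\<lambda>t. root n (cmod (q (r * cis t))))"
proof -
  obtain g where g: "g holomorphic_on ball 0 1" "\<forall>z\<in>cball 0 r. g z \<noteq> 0"
      "\<forall>z. cmod z = r \<longrightarrow> cmod (g z) = cmod (q z)" "cmod (q 0) \<le> cmod (g 0)"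
    using remove_zeros[OF r q] by blast
  have "2 * pi * root n (cmod (q 0)) \<le> 2 * pi * root n (cmod (g 0))"
    using g(4) n by (intro mult_left_mono) auto
  also have "\<dots> \<le> integral {0..2 * pi} (\<lambda>t. root n (cmod (g (r * cis t))))"
    using g(2) by (intro root_mean_nonvanishing r g(1) n) auto
  also have "\<dots> = integral {0..2 * pi} (\<lambda>t. root n (cmod (q (r * cis t))))"
    using g(3) r by (simp add: norm_mult)
  finally show ?thesis .
qed

lemma nontangential_imp_radial_limit:
  fixes r :: "nat \<Rightarrow> real"
  assumes lim: "has_nontangential_limit f (cis t) l"
    and r: "\<And>k. 0 < r k" "\<And>k. r k < 1" "r \<longlonglongrightarrow> 1"
  shows "(\<lambda>k. f (r k * cis t)) \<longlonglongrightarrow> l"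
proof -
  have "(f \<longlongrightarrow> l) (at (cis t) within stolz_region 2 (cis t))"
    using lim by (simp add: has_nontangential_limit_def)
  moreover have "filterlim (\<lambda>k. r k * cis t) (at (cis t) within stolz_region 2 (cis t)) sequentially"
    unfolding filterlim_at
  proof
    have "(\<lambda>k. of_real (r k) * cis t) \<longlonglongrightarrow> of_real 1 * cis t"
      by (intro tendsto_intros r(3))
    then show "(\<lambda>k. r k * cis t) \<longlonglongrightarrow> cis t" by simp
    have "r k * cis t \<in> stolz_region 2 (cis t) \<and> r k * cis t \<noteq> cis t" for k
    proof -
      have "of_real (r k) * cis t - cis t = of_real (r k - 1) * cis t" by (simp add: algebra_simps)
      then have "cmod (of_real (r k) * cis t - cis t) = \<bar>r k - 1\<bar>"
        by (simp only: norm_mult norm_of_real norm_cis mult_1_right)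
      then show ?thesis
        using r(1)[of k] r(2)[of k] by (auto simp: stolz_region_def norm_mult)
    qed
    then show "\<forall>\<^sub>F k in sequentially. r k * cis t \<in> stolz_region 2 (cis t) \<and> r k * cis t \<noteq> cis t"
      by simp
  qed
  ultimately show ?thesis by (rule filterlim_compose)
qed

text \<open>
  The moduli of the zeros form a countable set, so radii outside of it exist in every interval.
\<close>

lemma radii_avoiding_zeros:
  assumes q: "q holomorphic_on ball 0 1" "z0 \<in> ball 0 1" "q z0 \<noteq> 0"
  obtains r :: "nat \<Rightarrow> real" where "\<And>k. 1/2 < r k" "\<And>k. r k < 1" "r \<longlonglongrightarrow> 1"
    "\<And>k z. cmod z = r k \<Longrightarrow> q z \<noteq> 0"
proof -
  have "countable {z \<in> ball 0 1. q z = 0}"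
  proof (cases "q constant_on ball 0 1")
    case True
    then have "{z \<in> ball 0 1. q z = 0} = {}" using q by (auto simp: constant_on_def)
    then show ?thesis by (simp only: countable_empty)
  next
    case False
    have "(\<Union>n::nat. cball 0 (1 - 1 / Suc n)) = ball (0::complex) 1"
    proof (intro equalityI subsetI)
      fix z :: complex
      assume "z \<in> ball 0 1"
      then have "0 < 1 - cmod z" by simp
      then obtain n where "1 / real (Suc n) < 1 - cmod z"
        using reals_Archimedean unfolding inverse_eq_divide by blast
      then show "z \<in> (\<Union>n::nat. cball 0 (1 - 1 / Suc n))"
        by (intro UN_I[of n]) (auto simp del: of_nat_Suc)
    next
      fix z :: complex
      assume "z \<in> (\<Union>n::nat. cball 0 (1 - 1 / Suc n))"
      then obtain n where "cmod z \<le> 1 - 1 / real (Suc n)" by (auto simp del: of_nat_Suc)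
      moreover have "0 < 1 / real (Suc n)" by simp
      ultimately have "cmod z < 1" by linarith
      then show "z \<in> ball 0 1" by simp
    qed
    then have "fsigma (ball (0::complex) 1)"
      using fsigma.intros[of "\<lambda>n::nat. cball (0::complex) (1 - 1 / Suc n)"] by simp
    with False show ?thesis
      by (intro holomorphic_countable_zeros[OF q(1)]) auto
  qed
  then have C: "countable (cmod ` {z \<in> ball 0 1. q z = 0})" by (rule countable_image)
  have "\<exists>x. x \<in> {1 - 1 / real (k + 2)<..<1} - cmod ` {z \<in> ball 0 1. q z = 0}" for k
  proof (rule ccontr)
    assume "\<not> ?thesis"
    then have "{1 - 1 / real (k + 2)<..<1} \<subseteq> cmod ` {z \<in> ball 0 1. q z = 0}" by blast
    then have "countable {1 - 1 / real (k + 2)<..<1}" using C countable_subset by blast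
    moreover have "uncountable {1 - 1 / real (k + 2)<..<1}"
      by (subst uncountable_open_interval) simp
    ultimately show False by blast
  qed
  then obtain r where r: "\<And>k. r k \<in> {1 - 1 / real (k + 2)<..<1} - cmod ` {z \<in> ball 0 1. q z = 0}"
    by metis
  show thesis
  proof (rule that)
    fix k
    have "1 / real (k + 2) \<le> 1 / 2" by (intro divide_left_mono) auto
    moreover have "1 - 1 / real (k + 2) < r k"
      using r[of k] by (simp only: Diff_iff greaterThanLessThan_iff)
    ultimately show "1/2 < r k" by linarith
    show "r k < 1" using r[of k] by simp
    show "q z \<noteq> 0" if "cmod z = r k" for z
      using r[of k] that by force
  next
    have lim: "(\<lambda>k. 1 - 1 / real (k + 2)) \<longlonglongrightarrow> 1 - 0"
      by (intro tendsto_intros LIMSEQ_ignore_initial_segment[OF lim_1_over_n])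
    show "r \<longlonglongrightarrow> 1"
      by (rule tendsto_sandwich[OF _ _ lim[simplified] tendsto_const])
         (use r in \<open>auto intro!: always_eventually less_imp_le\<close>)
  qed
qed

text \<open>
  With \<open>\<psi> z = z\<^sup>m q z\<close> and \<open>q 0 \<noteq> 0\<close>, the mean inequality for \<open>q\<close> bounds the means of the \<open>n\<close>-th roots
  of \<open>\<bar>\<psi>\<bar>\<close> on circles of radius at least \<open>1/2\<close> from below by the \<open>n\<close>-th root of a constant \<open>\<kappa> > 0\<close>. Dominated
  convergence in the radius carries this to the boundary function \<open>\<Phi>\<close>, and dominated convergence in
  \<open>n\<close> turns it into \<open>2 pi \<le> \<bar>{t. \<Phi> t \<noteq> 0}\<bar>\<close>.
\<close>

theorem nontangential_limits_nonzero:
  assumes hol: "\<psi> holomorphic_on ball 0 1" and bound: "\<And>z. z \<in> ball 0 1 \<Longrightarrow> cmod (\<psi> z) \<le> K0"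
    and z0: "z0 \<in> ball 0 1" "\<psi> z0 \<noteq> 0"
  shows "AE t in lebesgue_on {0..2 * pi}. \<forall>l. has_nontangential_limit \<psi> (cis t) l \<longrightarrow> l \<noteq> 0"
proof -
  define K where "K = max 1 K0"
  have K: "1 \<le> K" "\<And>z. z \<in> ball 0 1 \<Longrightarrow> cmod (\<psi> z) \<le> K"
    using bound by (auto simp: K_def intro: max.coboundedI2)
  let ?M = "lebesgue_on {0..2 * pi}"
  obtain m q where q: "q holomorphic_on ball 0 1" "q 0 \<noteq> 0"
    and \<psi>q: "\<And>z. z \<in> ball 0 1 \<Longrightarrow> \<psi> z = (z - 0) ^ m * q z"
    by (rule holomorphic_factor_zero_global[OF hol open_ball connected_ball, of 0 z0]) (use z0 in auto)
  obtain r where r: "\<And>k. 1/2 < r k" "\<And>k. r k < 1" "r \<longlonglongrightarrow> 1"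
    and r_nz: "\<And>k z. cmod z = r k \<Longrightarrow> q z \<noteq> 0"
    using radii_avoiding_zeros[OF q(1), of 0] q(2) by auto
  have r0: "0 < r k" for k using r(1)[of k] by simp
  define f where "f k t = \<psi> (r k * cis t)" for k t
  define \<Phi> where "\<Phi> t = lim (\<lambda>k. f k t)" for t
  define \<kappa> where "\<kappa> = (1/2) ^ m * cmod (q 0)"
  have \<kappa>: "0 < \<kappa>" using q(2) by (simp add: \<kappa>_def)
  have inball: "r k * cis t \<in> ball 0 1" for k t
    using r0[of k] r(2)[of k] by (simp add: norm_mult)
  have f_cont: "continuous_on S (f k)" for k S
    unfolding f_def using inball
    by (intro continuous_on_compose2[OF holomorphic_on_imp_continuous_on[OF hol]] continuous_intros) auto
  have f_bound: "cmod (f k t) \<le> K" for k t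
    unfolding f_def using inball K(2) by blast
  have root_bound: "root (Suc n) x \<le> K" if "0 \<le> x" "x \<le> K" for n x
  proof -
    have "x \<le> K ^ Suc n" using that(2) power_increasing[of 1 "Suc n" K] K(1) by (simp del: power_Suc)
    then have "root (Suc n) x \<le> root (Suc n) (K ^ Suc n)" by simp
    then show ?thesis using K(1) by (simp add: real_root_power_cancel del: power_Suc)
  qed
  have "AE t in lborel. \<exists>l. has_nontangential_limit \<psi> (cis t) l"
    by (rule fatou_nontangential_limits[OF hol bound])
  then have "AE t in lborel. convergent (\<lambda>k. f k t)"
  proof eventually_elim
    case (elim t)
    then show ?case
      using nontangential_imp_radial_limit[of \<psi> t _ r] r0 r(2,3) by (auto simp: f_def convergent_def)
  qed
  then have "AE t in lebesgue. convergent (\<lambda>k. f k t)" by (rule AE_completion)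
  then have f_lim: "AE t in ?M. (\<lambda>k. f k t) \<longlonglongrightarrow> \<Phi> t"
    by (subst AE_restrict_space_iff) (auto elim!: eventually_mono simp: \<Phi>_def convergent_LIMSEQ_iff)
  have f_meas: "f k \<in> borel_measurable ?M" for k
    by (intro continuous_imp_measurable_on_sets_lebesgue f_cont) simp
  then have \<Phi>_meas: "\<Phi> \<in> borel_measurable ?M"
    unfolding \<Phi>_def[abs_def] by (rule borel_measurable_lim_metric)
  have int_const: "integrable ?M (\<lambda>t. c)" for c :: real
    by (intro continuous_imp_integrable_real continuous_intros)
  have lower: "2 * pi * root (Suc n) \<kappa> \<le> (LINT t|?M. root (Suc n) (cmod (\<Phi> t)))" for n
  proof (rule LIMSEQ_le_const)
    show "(\<lambda>k. LINT t|?M. root (Suc n) (cmod (f k t))) \<longlonglongrightarrow> (LINT t|?M. root (Suc n) (cmod (\<Phi> t)))"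
    proof (rule integral_dominated_convergence[where w = "\<lambda>t. K"])
      show "(\<lambda>t. root (Suc n) (cmod (\<Phi> t))) \<in> borel_measurable ?M"
        using \<Phi>_meas by measurable
      show "(\<lambda>t. root (Suc n) (cmod (f k t))) \<in> borel_measurable ?M" for k
        using f_meas[of k] by measurable
      show "AE t in ?M. (\<lambda>k. root (Suc n) (cmod (f k t))) \<longlonglongrightarrow> root (Suc n) (cmod (\<Phi> t))"
        using f_lim by eventually_elim (intro tendsto_intros)
      show "AE t in ?M. norm (root (Suc n) (cmod (f k t))) \<le> K" for k
        using root_bound[OF norm_ge_zero f_bound] by simp
    qed (rule int_const)
    have "2 * pi * root (Suc n) \<kappa> \<le> (LINT t|?M. root (Suc n) (cmod (f k t)))" for k
    proof -
      have "\<kappa> \<le> r k ^ m * cmod (q 0)"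
        unfolding \<kappa>_def using r(1)[of k] by (intro mult_right_mono power_mono) auto
      then have "2 * pi * root (Suc n) \<kappa> \<le> 2 * pi * root (Suc n) (r k ^ m * cmod (q 0))"
        by (intro mult_left_mono) auto
      also have "\<dots> = root (Suc n) (r k ^ m) * (2 * pi * root (Suc n) (cmod (q 0)))"
        by (simp add: real_root_mult)
      also have "\<dots> \<le> root (Suc n) (r k ^ m) * integral {0..2 * pi} (\<lambda>t. root (Suc n) (cmod (q (r k * cis t))))"
        using r0[of k] by (intro mult_left_mono root_mean_inequality r(2) q r_nz) (auto intro: less_imp_le)
      also have "\<dots> = integral {0..2 * pi} (\<lambda>t. root (Suc n) (r k ^ m) * root (Suc n) (cmod (q (r k * cis t))))"
        by simp
      also have "\<dots> = integral {0..2 * pi} (\<lambda>t. root (Suc n) (cmod (f k t)))"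
        using r0[of k] \<psi>q[OF inball]
        by (intro integral_cong) (simp add: f_def norm_mult norm_power real_root_mult)
      also have "\<dots> = (LINT t|?M. root (Suc n) (cmod (f k t)))"
        by (intro lebesgue_integral_eq_integral[symmetric] continuous_imp_integrable_real
            continuous_intros f_cont) simp
      finally show ?thesis .
    qed
    then show "\<exists>N. \<forall>k\<ge>N. 2 * pi * root (Suc n) \<kappa> \<le> (LINT t|?M. root (Suc n) (cmod (f k t)))"
      by blast
  qed
  have \<Phi>_bound: "AE t in ?M. cmod (\<Phi> t) \<le> K"
    using f_lim
  proof eventually_elim
    case (elim t)
    show ?case
      by (rule tendsto_upperbound[OF tendsto_norm[OF elim]]) (auto simp: f_bound)
  qed
  define I where "I t = (if \<Phi> t = 0 then 0 else 1::real)" for t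
  have I_meas: "I \<in> borel_measurable ?M"
    unfolding I_def[abs_def] using \<Phi>_meas by measurable
  have I_int: "integrable ?M I"
    by (rule Bochner_Integration.integrable_bound[OF int_const[of 1] I_meas]) (auto simp: I_def)
  have "2 * pi * 1 \<le> (LINT t|?M. I t)"
  proof (rule LIMSEQ_le)
    show "(\<lambda>n. 2 * pi * root (Suc n) \<kappa>) \<longlonglongrightarrow> 2 * pi * 1"
      by (intro tendsto_intros LIMSEQ_Suc LIMSEQ_root_const \<kappa>)
    show "(\<lambda>n. LINT t|?M. root (Suc n) (cmod (\<Phi> t))) \<longlonglongrightarrow> (LINT t|?M. I t)"
    proof (rule integral_dominated_convergence[where w = "\<lambda>t. K"])
      show "(\<lambda>t. root (Suc n) (cmod (\<Phi> t))) \<in> borel_measurable ?M" for n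
        using \<Phi>_meas by measurable
      show "AE t in ?M. (\<lambda>n. root (Suc n) (cmod (\<Phi> t))) \<longlonglongrightarrow> I t"
      proof (intro always_eventually allI)
        fix t
        show "(\<lambda>n. root (Suc n) (cmod (\<Phi> t))) \<longlonglongrightarrow> I t"
          using LIMSEQ_Suc[OF LIMSEQ_root_const[of "cmod (\<Phi> t)"]] by (simp add: I_def)
      qed
      show "AE t in ?M. norm (root (Suc n) (cmod (\<Phi> t))) \<le> K" for n
        using \<Phi>_bound by eventually_elim (use root_bound[OF norm_ge_zero] in simp)
    qed (rule I_meas int_const)+
  qed (use lower in auto)
  moreover have "(LINT t|?M. 1 - I t) = (LINT t|?M. 1) - (LINT t|?M. I t)"
    by (rule Bochner_Integration.integral_diff[OF int_const I_int])
  moreover have "(LINT t|?M. (1::real)) = 2 * pi"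
    using lebesgue_integral_eq_integral[OF int_const, of 1] by simp
  moreover have "0 \<le> (LINT t|?M. 1 - I t)"
    by (rule Bochner_Integration.integral_nonneg) (auto simp: I_def)
  ultimately have "(LINT t|?M. 1 - I t) = 0" by simp
  then have "AE t in ?M. 1 - I t = 0"
  proof (subst (asm) integral_nonneg_eq_0_iff_AE)
    show "integrable ?M (\<lambda>t. 1 - I t)"
      by (intro Bochner_Integration.integrable_diff int_const I_int)
    show "AE t in ?M. 0 \<le> 1 - I t" by (simp add: I_def)
  qed
  then show ?thesis
    using f_lim
  proof eventually_elim
    case (elim t)
    then have \<Phi>0: "\<Phi> t \<noteq> 0" by (auto simp: I_def)
    have "l = \<Phi> t" if "has_nontangential_limit \<psi> (cis t) l" for l
      using LIMSEQ_unique[OF _ elim(2)] nontangential_imp_radial_limit[OF that r0 r(2,3)]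
      by (simp add: f_def)
    then show ?case using \<Phi>0 by (intro allI impI) simp
  qed
qed

section \<open>Boundary values of quotients\<close>

lemma nontangential_limit_divide:
  assumes \<gamma>: "has_nontangential_limit \<gamma> \<xi> a" and \<psi>: "has_nontangential_limit \<psi> \<xi> b" and b: "b \<noteq> 0"
    and f: "\<And>z. z \<in> ball 0 1 \<Longrightarrow> f z = \<gamma> z / \<psi> z"
  shows "has_nontangential_limit f \<xi> (a / b)"
  unfolding has_nontangential_limit_def
proof (intro allI impI)
  fix M :: real assume "1 < M"
  then have "((\<lambda>z. \<gamma> z / \<psi> z) \<longlongrightarrow> a / b) (at \<xi> within stolz_region M \<xi>)"
    using \<gamma> \<psi> b by (intro tendsto_divide) (auto simp: has_nontangential_limit_def)
  moreover have "\<forall>\<^sub>F z in at \<xi> within stolz_region M \<xi>. \<gamma> z / \<psi> z = f z"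
    using f by (auto simp: eventually_at_filter stolz_region_def)
  ultimately show "(f \<longlongrightarrow> a / b) (at \<xi> within stolz_region M \<xi>)"
    by (rule Lim_transform_eventually)
qed

theorem theorem2p8:
  fixes \<alpha> :: real and \<phi> f :: "complex \<Rightarrow> complex"
  assumes "\<alpha> > -1"
    and "\<phi> \<in> bergman_mult_unit_ball \<alpha>"
    and "sub_bergman \<alpha> \<phi> \<noteq> {\<lambda>z. 0}"
    and "f \<in> smirnov_class (sub_bergman \<alpha> \<phi>) (sub_bergman_inner \<alpha> \<phi>)"
  shows "AE t in lebesgue_on {0..2*pi}. \<exists>l. has_nontangential_limit f (cis t) l"
proof -
  obtain \<gamma> \<psi> where \<gamma>: "\<gamma> \<in> Mult (sub_bergman \<alpha> \<phi>)" and \<psi>: "\<psi> \<in> Mult (sub_bergman \<alpha> \<phi>)"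
    and dense: "closure_wrt (sub_bergman \<alpha> \<phi>) (sub_bergman_inner \<alpha> \<phi>) (mult_op \<psi> ` sub_bergman \<alpha> \<phi>)
      = sub_bergman \<alpha> \<phi>"
    and f: "\<And>z. z \<in> ball 0 1 \<Longrightarrow> f z = \<gamma> z / \<psi> z"
    using assms(4) unfolding smirnov_class_def mem_Collect_eq by (elim bexE conjE) auto
  have hol: "\<gamma> holomorphic_on ball 0 1" "\<psi> holomorphic_on ball 0 1"
    using \<gamma> \<psi> by (auto simp: Mult_def)
  obtain K where K: "\<And>z. z \<in> ball 0 1 \<Longrightarrow> cmod (\<gamma> z) \<le> K"
    using sub_bergman_multiplier_bounded[OF assms(1-3) \<gamma>] by blast
  obtain L where L: "\<And>z. z \<in> ball 0 1 \<Longrightarrow> cmod (\<psi> z) \<le> L"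
    using sub_bergman_multiplier_bounded[OF assms(1-3) \<psi>] by blast
  obtain z0 where z0: "z0 \<in> ball 0 1" "\<psi> z0 \<noteq> 0"
    using sub_bergman_cyclic_nonzero[OF assms(1-3) dense] by blast
  have on_circle: "AE t in lebesgue_on {0..2*pi}. \<exists>l. has_nontangential_limit g (cis t) l"
    if g: "g holomorphic_on ball 0 1" "\<And>z. z \<in> ball 0 1 \<Longrightarrow> cmod (g z) \<le> K'" for g K'
  proof -
    have "AE t in lebesgue. \<exists>l. has_nontangential_limit g (cis t) l"
      by (rule AE_completion[OF fatou_nontangential_limits[OF g]])
    then have "AE t in lebesgue. t \<in> {0..2*pi} \<longrightarrow> (\<exists>l. has_nontangential_limit g (cis t) l)"
      by eventually_elim simp
    then show ?thesis
      by (subst AE_restrict_space_iff) simp_all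
  qed
  have "AE t in lebesgue_on {0..2*pi}. \<exists>l. has_nontangential_limit \<gamma> (cis t) l"
    by (rule on_circle[OF hol(1) K])
  moreover have "AE t in lebesgue_on {0..2*pi}. \<exists>l. has_nontangential_limit \<psi> (cis t) l"
    by (rule on_circle[OF hol(2) L])
  moreover have "AE t in lebesgue_on {0..2*pi}. \<forall>l. has_nontangential_limit \<psi> (cis t) l \<longrightarrow> l \<noteq> 0"
    by (rule nontangential_limits_nonzero[OF hol(2) L z0])
  ultimately show ?thesis
  proof eventually_elim
    case (elim t)
    then obtain a b where "has_nontangential_limit \<gamma> (cis t) a" "has_nontangential_limit \<psi> (cis t) b" "b \<noteq> 0"
      by blast
    from nontangential_limit_divide[OF this f] show ?case by blast
  qed
qed

end
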